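(* Let $T>0$ and let $p\in\mathbb N$, $p\ge1$, be such that the following uniqueness assumption holds: for every $N_t\in\mathbb N$, $N_t\ge 1$ (with $h_t=T/N_t$), every $\mu\in\mathbb R$, every $f\in L^2(0,T)$ and every $\psi_0\in\mathbb C$, the problem $$\text{find } \psi_{h_t}^p\in \psi_0+S^p_{h_t,0,\bullet}(0,T;\mathbb C):\quad \mathrm i(\partial_t\psi_{h_t}^p,w)_{J_T}+\mu(\psi_{h_t}^p,w)_{J_T}=(f,w)_{J_T}\quad \forall\, w\in S^{p-1}_{h_t}(0,T;\mathbb C)$$ has a unique solution. Then the discrete formulation: find $u_{h_t}^p,v_{h_t}^p\in S^p_{h_t,0,\bullet}(0,T;\mathbb R)$ such that $$\begin{cases}(\partial_t u_{h_t}^p,\partial_t\chi)_{J_T}+(\partial_t v_{h_t}^p,\chi)_{J_T}=0 & \forall\,\chi\in S^p_{h_t,\bullet,0}(0,T;\mathbb R),\\ (\partial_t v_{h_t}^p,\partial_t\lambda)_{J_T}-\mu_w(\partial_t u_{h_t}^p,\lambda)_{J_T}=(f,\partial_t\lambda)_{J_T} & \forall\,\lambda\in S^p_{h_t,\bullet,0}(0,T;\mathbb R),\end{cases}$$ is unconditionally stable; that is, for every $\mu_w>0$ (with no restriction relating $h_t$, $p$ and $\mu_w$), the Schur complements $$\mathbf B^p_{h_t}+\mu_w\,\mathbf C^p_{h_t}(\mathbf B^p_{h_t})^{-1}\mathbf C^p_{h_t},\qquad h_t=T/N_t,\ N_t\ge1,$$ of its system matrices $\begin{pmatrix}\mathbf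 B^p_{h_t}&\mathbf C^p_{h_t}\\-\mu_w\mathbf C^p_{h_t}&\mathbf B^p_{h_t}\end{pmatrix}$ form a weakly well-conditioned family.
   Context: Let $J_T=(0,T)$, $(u,v)_{J_T}=\int_0^T u\,\overline v\,dt$. For $N_t\in\mathbb N$, $N_t\ge1$, let $h_t=T/N_t$, $t_j=jh_t$. For $q\ge 0$ and $\mathbb K\in\{\mathbb R,\mathbb C\}$, $S^q_{h_t}(0,T;\mathbb K)$ is the space of $\mathbb K$-valued functions that are polynomials of degree at most $q$ on each $(t_{j-1},t_j)$, $j=1,\dots,N_t$, and belong to $C^{q-1}([0,T])$ (no continuity is required when $q=0$). $S^q_{h_t,0,\bullet}$ and $S^q_{h_t,\bullet,0}$ denote the subspaces of functions vanishing at $t=0$ and at $t=T$, respectively. Let $\{\varphi_j^p\}_{j=0}^{N_t+p-1}$ be the B-spline basis of $S^p_{h_t}(0,T;\mathbb R)$ given by the Cox–de Boor recursion for the open knot vector with $0$ and $T$ each repeated $p+1$ times and $t_1,\dots,t_{N_t-1}$ each of multiplicity one. Then $\{\varphi_j^p\}_{j=1}^{N_t+p-1}$ is a basis of $S^p_{h_t,0,\bullet}$ and $\{\varphi_j^p\}_{j=0}^{N_t+p-2}$ is a basis of $S^p_{h_t,\bullet,0}$. For $\ell,j=1,\dots,N_t+p-1$, $$\mathbf B^p_{h_t}[\ell,j]=(\partial_t\varphi^p_j,\partial_t\varphi^p_{\ell-1})_{J_T},\qquad \mathbf C^p_{h_t}[\ell,j]=(\partial_t\varphi^p_j,\varphi^p_{\ell-1})_{J_T}.$$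 The matrices $\mathbf B^p_{h_t}$ are invertible. A family of nonsingular matrices indexed by $h_t=T/N_t$, of size $n=N_t+p-1$, is weakly well-conditioned if their condition numbers grow at most as a power of $n$ (equivalently, of $1/h_t$): there are constants $C,s\ge0$ independent of $N_t$ such that $\kappa\le C n^s$ for all $N_t\ge1$. This does not depend on which of the usual matrix norms is used. The first-order system $\partial_tu-v=0$, $\partial_tv+\mu_wu=f$, $u(0)=v(0)=0$, with $\mu_w>0$ and $f\in L^2(0,T)$ real-valued, is discretized by the formulation: find $u_{h_t}^p,v_{h_t}^p\in S^p_{h_t,0,\bullet}(0,T;\mathbb R)$ such that $(\partial_t u_{h_t}^p,\partial_t\chi)_{J_T}+(\partial_t v_{h_t}^p,\chi)_{J_T}=0$ for all $\chi\in S^p_{h_t,\bullet,0}(0,T;\mathbb R)$ and $(\partial_t v_{h_t}^p,\partial_t\lambda)_{J_T}-\mu_w(\partial_t u_{h_t}^p,\lambda)_{J_T}=(f,\partial_t\lambda)_{J_T}$ for all $\lambda\in S^p_{h_t,\bullet,0}(0,T;\mathbb R)$. Stability of this discrete formulation is understood in the sense of weak well-conditioning of the Schur complements $\mathbf B^p_{h_t}+\mu_w\,\mathbf C^p_{h_t}(\mathbf B^p_{h_t})^{-1}\mathbf C^p_{h_t}$ of its system matrices $\begin{pmatrix}\mathbf B^p_{h_t}&\mathbf C^p_{h_t}\\-\mu_w\mathbf C^p_{h_t}&\mathbf B^p_{h_t}\end{pmatrix}$. *)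

theory Defs
  imports "HOL-Analysis.Analysis" "Jordan_Normal_Form.Gauss_Jordan_Elimination"
begin

section \<open>Function spaces on the time interval\<close>

text \<open>The inner products only see the values on the open interval \<open>(0,T)\<close> up to null sets.\<close>

definition L2_space :: "real \<Rightarrow> (real \<Rightarrow> 'a::real_normed_vector) set" where
  "L2_space T = {f. f \<in> borel_measurable (lebesgue_on {0<..<T}) \<and>
                    integrable (lebesgue_on {0<..<T}) (\<lambda>t. (norm (f t))\<^sup>2)}"

definition inner_J :: "real \<Rightarrow> (real \<Rightarrow> complex) \<Rightarrow> (real \<Rightarrow> complex) \<Rightarrow> complex" where
  "inner_J T u v = (LINT t|lebesgue_on {0<..<T}. u t * cnj (v t))"

definition real_inner_J :: "real \<Rightarrow> (real \<Rightarrow> real) \<Rightarrow> (real \<Rightarrow> real) \<Rightarrow> real" where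
  "real_inner_J T u v = (LINT t|lebesgue_on {0<..<T}. u t * v t)"

text \<open>The classical derivative. For splines of degree one it does not exist at the breakpoints,
  where \<^const>\<open>vector_derivative\<close> takes an arbitrary value; these form a null set.\<close>

definition dt :: "(real \<Rightarrow> 'a::real_normed_vector) \<Rightarrow> real \<Rightarrow> 'a" where
  "dt u t = vector_derivative u (at t)"

text \<open>Functions of class \<open>C\<^sup>k\<close> on a set, here a compact interval, with one-sided derivatives at its
  end points; \<open>D j\<close> is the \<open>j\<close>-th derivative.\<close>

definition C_k_on :: "nat \<Rightarrow> real set \<Rightarrow> (real \<Rightarrow> 'a::real_normed_vector) set" where
  "C_k_on k S = {f. \<exists>D. D 0 = f \<and>
     (\<forall>j<k. \<forall>t\<in>S. (D j has_vector_derivative D (Suc j) t) (at t within S)) \<and>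
     continuous_on S (D k)}"

definition time_node :: "real \<Rightarrow> nat \<Rightarrow> nat \<Rightarrow> real" where
  "time_node T N j = real j * (T / real N)"

text \<open>\<open>S\<^sup>q\<close> with \<open>N\<close> subintervals, real or complex according to the type. Elements are functions on
  the whole real line whose values outside \<open>[0,T]\<close> are irrelevant, so equality of splines means
  equality on \<open>[0,T]\<close>.\<close>

definition spline_space :: "real \<Rightarrow> nat \<Rightarrow> nat \<Rightarrow> (real \<Rightarrow> 'a::real_normed_field) set" where
  "spline_space T N q = {f.
     (\<forall>j\<in>{1..N}. \<exists>P. degree P \<le> q \<and>
        (\<forall>t\<in>{time_node T N (j - 1)<..<time_node T N j}. f t = poly P (of_real t))) \<and>
     (q \<ge> 1 \<longrightarrow> f \<in> C_k_on (q - 1) {0..T})}"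

definition spline_space_init :: "real \<Rightarrow> nat \<Rightarrow> nat \<Rightarrow> (real \<Rightarrow> 'a::real_normed_field) set" where
  "spline_space_init T N q = {f \<in> spline_space T N q. f 0 = 0}"

definition spline_space_final :: "real \<Rightarrow> nat \<Rightarrow> nat \<Rightarrow> (real \<Rightarrow> 'a::real_normed_field) set" where
  "spline_space_final T N q = {f \<in> spline_space T N q. f T = 0}"

section \<open>The first-order problem of the uniqueness assumption\<close>

definition discrete_ode_solution ::
  "real \<Rightarrow> nat \<Rightarrow> nat \<Rightarrow> real \<Rightarrow> (real \<Rightarrow> complex) \<Rightarrow> complex \<Rightarrow> (real \<Rightarrow> complex) \<Rightarrow> bool" where
  "discrete_ode_solution T N p \<mu> f \<psi>0 \<psi> \<longleftrightarrow>
     (\<lambda>t. \<psi> t - \<psi>0) \<in> spline_space_init T N p \<and>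
     (\<forall>w\<in>spline_space T N (p - 1).
        \<i> * inner_J T (dt \<psi>) w + complex_of_real \<mu> * inner_J T \<psi> w = inner_J T f w)"

section \<open>B-splines\<close>

text \<open>The open knot vector \<open>\<xi>\<^sub>0, \<dots>, \<xi>\<^sub>N\<^sub>+\<^sub>2\<^sub>p\<close>: the index \<open>min (i - p) N\<close>, with truncated subtraction,
  equals \<open>0\<close> for \<open>i \<le> p\<close> and \<open>N\<close> for \<open>i \<ge> N + p\<close>.\<close>

definition open_knot :: "real \<Rightarrow> nat \<Rightarrow> nat \<Rightarrow> nat \<Rightarrow> real" where
  "open_knot T N p i = time_node T N (min (i - p) N)"

text \<open>Cox--de Boor recursion for a knot sequence \<open>\<xi>\<close> with last knot \<open>T\<close>. Quotients with denominator
  \<open>0\<close> count as \<open>0\<close>, which is the HOL convention. The last nonempty knot interval is closed at \<open>T\<close>, so that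
  the basis functions are continuous on \<open>[0,T]\<close>.\<close>

primrec cox_de_boor :: "real \<Rightarrow> (nat \<Rightarrow> real) \<Rightarrow> nat \<Rightarrow> nat \<Rightarrow> real \<Rightarrow> real" where
  "cox_de_boor T \<xi> 0 i t =
     (if \<xi> i \<le> t \<and> t < \<xi> (i + 1) \<or> \<xi> i < T \<and> \<xi> (i + 1) = T \<and> t = T then 1 else 0)"
| "cox_de_boor T \<xi> (Suc k) i t =
     (t - \<xi> i) / (\<xi> (i + Suc k) - \<xi> i) * cox_de_boor T \<xi> k i t +
     (\<xi> (i + Suc k + 1) - t) / (\<xi> (i + Suc k + 1) - \<xi> (i + 1)) * cox_de_boor T \<xi> k (i + 1) t"

definition bspline :: "real \<Rightarrow> nat \<Rightarrow> nat \<Rightarrow> nat \<Rightarrow> real \<Rightarrow> real" where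
  "bspline T N p j = cox_de_boor T (open_knot T N p) p j"

section \<open>The discrete formulation and its matrices\<close>

text \<open>Left-hand sides of the two equations of the discrete formulation.\<close>

definition form1 :: "real \<Rightarrow> (real \<Rightarrow> real) \<Rightarrow> (real \<Rightarrow> real) \<Rightarrow> (real \<Rightarrow> real) \<Rightarrow> real" where
  "form1 T u v chi = real_inner_J T (dt u) (dt chi) + real_inner_J T (dt v) chi"

definition form2 :: "real \<Rightarrow> real \<Rightarrow> (real \<Rightarrow> real) \<Rightarrow> (real \<Rightarrow> real) \<Rightarrow> (real \<Rightarrow> real) \<Rightarrow> real" where
  "form2 T \<mu>w u v lam = real_inner_J T (dt v) (dt lam) - \<mu>w * real_inner_J T (dt u) lam"

definition discrete_solution ::
  "real \<Rightarrow> nat \<Rightarrow> nat \<Rightarrow> real \<Rightarrow> (real \<Rightarrow> real) \<Rightarrow> (real \<Rightarrow> real) \<Rightarrow> (real \<Rightarrow> real) \<Rightarrow> bool" where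
  "discrete_solution T N p \<mu>w f u v \<longleftrightarrow>
     u \<in> spline_space_init T N p \<and> v \<in> spline_space_init T N p \<and>
     (\<forall>chi\<in>spline_space_final T N p. form1 T u v chi = 0) \<and>
     (\<forall>lam\<in>spline_space_final T N p. form2 T \<mu>w u v lam = real_inner_J T f (dt lam))"

text \<open>Matrix indices start at \<open>0\<close>: entry \<open>(r, c)\<close> pairs the trial function number \<open>c + 1\<close> with the test
  function number \<open>r\<close>.\<close>

definition B_mat :: "real \<Rightarrow> nat \<Rightarrow> nat \<Rightarrow> real Matrix.mat" where
  "B_mat T N p = Matrix.mat (N + p - 1) (N + p - 1)
     (\<lambda>(r, c). real_inner_J T (dt (bspline T N p (c + 1))) (dt (bspline T N p r)))"

definition C_mat :: "real \<Rightarrow> nat \<Rightarrow> nat \<Rightarrow> real Matrix.mat" where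
  "C_mat T N p = Matrix.mat (N + p - 1) (N + p - 1)
     (\<lambda>(r, c). real_inner_J T (dt (bspline T N p (c + 1))) (bspline T N p r))"

text \<open>The system matrix of the discrete formulation in the B-spline bases, with unknowns ordered as
  \<open>(u, v)\<close> and the first equations (tested with \<open>chi\<close>) before the second ones (tested with \<open>lam\<close>).\<close>

definition system_matrix :: "real \<Rightarrow> nat \<Rightarrow> nat \<Rightarrow> real \<Rightarrow> real Matrix.mat" where
  "system_matrix T N p \<mu>w = (let n = N + p - 1; \<phi> = bspline T N p in four_block_mat
     (Matrix.mat n n (\<lambda>(r, c). form1 T (\<phi> (c + 1)) (\<lambda>_. 0) (\<phi> r)))
     (Matrix.mat n n (\<lambda>(r, c). form1 T (\<lambda>_. 0) (\<phi> (c + 1)) (\<phi> r)))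
     (Matrix.mat n n (\<lambda>(r, c). form2 T \<mu>w (\<phi> (c + 1)) (\<lambda>_. 0) (\<phi> r)))
     (Matrix.mat n n (\<lambda>(r, c). form2 T \<mu>w (\<lambda>_. 0) (\<phi> (c + 1)) (\<phi> r))))"

abbreviation mat_inv :: "real Matrix.mat \<Rightarrow> real Matrix.mat" where
  "mat_inv A \<equiv> the (mat_inverse A)"

definition schur_complement :: "nat \<Rightarrow> real Matrix.mat \<Rightarrow> real Matrix.mat" where
  "schur_complement n M =
     (case split_block M n n of (A, B, C, D) \<Rightarrow> D - C * mat_inv A * B)"

lemma dt_zero [simp]: "dt (\<lambda>_. 0) = (\<lambda>_. 0)"
  by (simp add: dt_def fun_eq_iff)

lemma system_matrix_eq:
  "system_matrix T N p \<mu>w =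
     four_block_mat (B_mat T N p) (C_mat T N p) ((- \<mu>w) \<cdot>\<^sub>m C_mat T N p) (B_mat T N p)"
proof -
  have z: "real_inner_J T (\<lambda>_. 0) g = 0" for g
    by (simp add: real_inner_J_def)
  have "(- \<mu>w) \<cdot>\<^sub>m C_mat T N p = Matrix.mat (N + p - 1) (N + p - 1)
     (\<lambda>(r, c). - (\<mu>w * real_inner_J T (dt (bspline T N p (c + 1))) (bspline T N p r)))"
    by (rule eq_matI) (auto simp: C_mat_def)
  then show ?thesis
    by (simp add: system_matrix_def Let_def form1_def form2_def z B_mat_def C_mat_def)
qed

lemma schur_complement_system_matrix:
  assumes "invertible_mat (B_mat T N p)"
  shows "schur_complement (N + p - 1) (system_matrix T N p \<mu>w) =
     B_mat T N p + \<mu>w \<cdot>\<^sub>m (C_mat T N p * mat_inv (B_mat T N p) * C_mat T N p)"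
proof -
  define n where "n = N + p - 1"
  define B where "B = B_mat T N p"
  define C where "C = C_mat T N p"
  have car: "B \<in> carrier_mat n n" "C \<in> carrier_mat n n"
    by (auto simp: B_def C_def B_mat_def C_mat_def n_def)
  obtain X where X: "B * X = 1\<^sub>m n" "X * B = 1\<^sub>m (dim_row X)"
    using assms car unfolding invertible_mat_def inverts_mat_def B_def[symmetric] by auto
  have Xc: "X \<in> carrier_mat n n"
    using arg_cong[OF X(1), of dim_col] arg_cong[OF X(2), of dim_col] car by auto
  have "B \<in> Units (ring_mat TYPE(real) n undefined)"
    using X Xc car by (auto simp: Units_def ring_mat_def)
  then obtain I where I: "mat_inverse B = Some I"
    using mat_inverse(1)[OF car(1), of undefined] by (cases "mat_inverse B") auto
  have Ic: "I \<in> carrier_mat n n"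
    using mat_inverse(2)[OF car(1) I] by simp
  have "split_block (four_block_mat B C ((- \<mu>w) \<cdot>\<^sub>m C) B) n n = (B, C, (- \<mu>w) \<cdot>\<^sub>m C, B)"
    using car by (auto simp: split_block_def Let_def intro!: eq_matI)
  then have "schur_complement n (system_matrix T N p \<mu>w) = B - ((- \<mu>w) \<cdot>\<^sub>m C) * I * C"
    by (simp add: schur_complement_def system_matrix_eq B_def[symmetric] C_def[symmetric] I)
  also have "((- \<mu>w) \<cdot>\<^sub>m C) * I * C = (- \<mu>w) \<cdot>\<^sub>m (C * I * C)"
    using car Ic by (metis mult_carrier_mat mult_smult_assoc_mat)
  also have "B - (- \<mu>w) \<cdot>\<^sub>m (C * I * C) = B + \<mu>w \<cdot>\<^sub>m (C * I * C)"
    using car Ic by (intro eq_matI) auto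
  finally show ?thesis
    by (simp add: B_def C_def n_def I[unfolded B_def])
qed

section \<open>Weakly well-conditioned families\<close>

text \<open>Spectral norm, that is, the operator norm induced by the Euclidean vector norm.\<close>

definition euclid_norm :: "real Matrix.vec \<Rightarrow> real" where
  "euclid_norm v = sqrt (scalar_prod v v)"

definition spectral_norm :: "real Matrix.mat \<Rightarrow> real" where
  "spectral_norm A =
     (SUP v\<in>{v \<in> carrier_vec (dim_col A). euclid_norm v \<le> 1}. euclid_norm (A *\<^sub>v v))"

definition condition_number :: "real Matrix.mat \<Rightarrow> real" where
  "condition_number A = spectral_norm A * spectral_norm (mat_inv A)"

definition weakly_well_conditioned :: "(nat \<Rightarrow> real Matrix.mat) \<Rightarrow> bool" where
  "weakly_well_conditioned A \<longleftrightarrow>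
     (\<forall>N\<ge>1. invertible_mat (A N)) \<and>
     (\<exists>C s. C \<ge> 0 \<and> s \<ge> 0 \<and>
        (\<forall>N\<ge>1. condition_number (A N) \<le> C * real (dim_row (A N)) powr s))"

end

theory Submission
  imports Defs "Jordan_Normal_Form.Determinant"
begin

text \<open>Let \<open>\<alpha>\<^sup>2 = \<mu>\<^sub>w\<close>. If \<open>S x = y\<close> for the Schur complement \<open>S\<close>, and \<open>z = B\<^sup>-\<^sup>1 C x\<close>, let \<open>U\<close> and \<open>V\<close> be the
  splines with coefficients \<open>x\<close> and \<open>\<alpha> z\<close>. Integration by parts turns the two equations into
  \<open>(V' + \<alpha> U, w) = 0\<close> and \<open>(U' - \<alpha> V, w) = \<ell>\<^sub>y(w)\<close> for all splines \<open>w\<close> of degree \<open>p - 1\<close>, that is,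
  \<open>\<psi> = U + \<i> V\<close> solves the discrete first-order problem with \<open>\<mu> = - \<alpha>\<close>. Hence the uniqueness
  assumption makes every \<open>S\<close> injective. It is needed only for finitely many meshes: the Galerkin
  projection of \<open>\<psi>' + \<i> \<alpha> \<psi>\<close> differs from the exact residual by the approximation error of \<open>\<psi>\<close> in splines
  of degree \<open>p - 1\<close>, which a quasi-interpolant bounds by \<open>O(h\<^sup>1\<^sup>/\<^sup>2)\<close> times the norm of \<open>\<psi>'\<close>. For small \<open>h\<close> the
  energy estimate of the differential equation absorbs this error and bounds \<open>\<psi>'\<close> by \<open>\<ell>\<^sub>y\<close>. Passing
  between coefficients and functions costs powers of \<open>1/h\<close>, by Markov's inequality.\<close>

text \<open>Uniqueness is qualitative: it makes each matrix invertible but says nothing about the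
  growth of the inverses. The rate has to come from an estimate uniform in the mesh. Since any
  polynomial loss is allowed, every passage between norms may be crude. The factor \<alpha> in
  \<open>V\<close> distributes \<mu> evenly over the two equations and makes their coupling
  skew-symmetric, so that it cancels in the derivative of \<open>U^2 + V^2\<close>. The size of
  \<mu> then enters only the constants and the threshold for the mesh, and no relation between mesh
  and \<mu> survives. The step to degree \<open>p - 1\<close> rests on the fact that differentiation
  maps the splines vanishing at 0, and likewise those vanishing at T, onto all splines of degree
  \<open>p - 1\<close>; thus every such spline is the derivative of a test function. In the
  residuals \<open>V' + \<alpha> U\<close> and \<open>U' - \<alpha> V\<close> the derivatives
  already have degree \<open>p - 1\<close>; only the undifferentiated terms have to be
  approximated.\<close>

lemma scalar_prod_self_nonneg: "0 \<le> scalar_prod v (v :: real Matrix.vec)"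
  unfolding scalar_prod_def by (intro sum_nonneg) auto

lemma scalar_prod_Cauchy_Schwarz:
  assumes "a \<in> carrier_vec n" "y \<in> carrier_vec n"
  shows "(scalar_prod a y)\<^sup>2 \<le> scalar_prod a a * scalar_prod y (y :: real Matrix.vec)"
  using assms Cauchy_Schwarz_ineq_sum[of "\<lambda>i. a $ i" "\<lambda>i. y $ i" "{0..<n}"]
  by (simp add: scalar_prod_def power2_eq_square)

section \<open>Polynomials on an interval\<close>

lemma pderiv_sum: "pderiv (sum f A) = (\<Sum>x\<in>A. pderiv (f x))"
  by (induction A rule: infinite_finite_induct) (auto simp: pderiv_add)

text \<open>The leading coefficient is removed by passing to \<open>P(x) - 2\<^sup>q\<^sup>+\<^sup>1 P(x/2)\<close>.\<close>

lemma poly_coeff_bound: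
  "\<exists>C\<ge>0. \<forall>(P::real poly) M. degree P \<le> q \<longrightarrow> (\<forall>x\<in>{0..<1}. \<bar>poly P x\<bar> \<le> M) \<longrightarrow> (\<forall>i. \<bar>coeff P i\<bar> \<le> C * M)"
proof (induction q)
  case 0
  have "\<bar>coeff P i\<bar> \<le> 1 * M" if P: "degree P \<le> 0" "\<forall>x\<in>{0..<1}. \<bar>poly P x\<bar> \<le> M" for P :: "real poly" and M i
  proof -
    have "\<bar>coeff P 0\<bar> \<le> M" using P(2)[rule_format, of 0] by (simp add: poly_0_coeff_0)
    moreover have "coeff P i = 0" if "i > 0" using P(1) that by (simp add: coeff_eq_0)
    ultimately show ?thesis by (cases "i = 0") auto
  qed
  then show ?case by (intro exI[of _ 1]) auto
next
  case (Suc q)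
  then obtain C where C: "C \<ge> 0"
    "\<And>(P::real poly) M i. degree P \<le> q \<Longrightarrow> (\<forall>x\<in>{0..<1}. \<bar>poly P x\<bar> \<le> M) \<Longrightarrow> \<bar>coeff P i\<bar> \<le> C * M"
    by blast
  define K :: real where "K = 2 ^ Suc q"
  define D where "D = C * (1 + K)"
  have K: "K \<ge> 1" unfolding K_def by (rule one_le_power) simp
  have D: "D \<ge> 0" using C(1) K by (simp add: D_def)
  have main: "\<bar>coeff P i\<bar> \<le> (D + K * (1 + real (Suc q) * D)) * M"
    if P: "degree P \<le> Suc q" "\<forall>x\<in>{0..<1}. \<bar>poly P x\<bar> \<le> M" for P :: "real poly" and M i
  proof -
    define R where "R = P - Polynomial.smult K (pcompose P [:0, 1/2:])"
    have M: "M \<ge> 0" using P(2)[rule_format, of 0] by auto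
    have cR: "coeff R j = coeff P j * (1 - K / 2 ^ j)" for j
      by (simp add: R_def coeff_pcompose_linear algebra_simps power_divide)
    have degR: "degree R \<le> q"
    proof (rule degree_le, intro allI impI)
      fix j assume "j > q"
      then consider "j = Suc q" | "j > Suc q" by linarith
      then show "coeff R j = 0"
        using P(1) by cases (auto simp: cR K_def coeff_eq_0)
    qed
    have "\<bar>poly R x\<bar> \<le> (1 + K) * M" if "x \<in> {0..<1}" for x
    proof -
      have "\<bar>poly P x\<bar> \<le> M" "\<bar>poly P (x/2)\<bar> \<le> M"
        using P(2)[rule_format, of x] P(2)[rule_format, of "x/2"] that by auto
      moreover have "poly R x = poly P x - K * poly P (x/2)"
        by (simp add: R_def poly_pcompose)
      moreover have "\<bar>K * poly P (x/2)\<bar> \<le> K * M"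
        using calculation(2) K by (simp add: abs_mult)
      ultimately show ?thesis by (simp add: algebra_simps)
    qed
    then have R: "\<bar>coeff R j\<bar> \<le> D * M" for j
      using C(2)[OF degR, of "(1+K)*M" j] by (simp add: D_def mult.assoc)
    \<comment> \<open>The factor \<open>1 - 2 ^ (q + 1 - j)\<close> is 0 for the top coefficient and
      has modulus at least 1 for every lower one, so \<open>R\<close> controls all lower
      coefficients of \<open>P\<close>.\<close>
    have low: "\<bar>coeff P j\<bar> \<le> D * M" if "j \<le> q" for j
    proof -
      have e: "K / 2 ^ j = 2 ^ (Suc q - j)"
        using that by (simp add: K_def power_diff)
      have "(2::real) ^ 1 \<le> 2 ^ (Suc q - j)" using that by (intro power_increasing) auto
      then have "\<bar>1 - K / 2 ^ j\<bar> \<ge> 1" by (simp add: e)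
      then have "\<bar>coeff P j\<bar> * 1 \<le> \<bar>coeff R j\<bar>" unfolding cR abs_mult
        by (intro mult_left_mono) auto
      with R[of j] show ?thesis by simp
    qed
    \<comment> \<open>The top coefficient is what remains of the value at 1/2 once the lower terms
      are bounded.\<close>
    have top: "\<bar>coeff P (Suc q)\<bar> \<le> K * (1 + real (Suc q) * D) * M"
    proof (cases "degree P = Suc q")
      case True
      have "poly P (1/2) = (\<Sum>j\<le>Suc q. coeff P j * (1/2) ^ j)"
        unfolding poly_altdef True ..
      then have "coeff P (Suc q) * (1/2)^Suc q = poly P (1/2) - (\<Sum>j\<le>q. coeff P j * (1/2) ^ j)"
        by simp
      moreover have "\<bar>poly P (1/2)\<bar> \<le> M" using P(2)[rule_format, of "1/2"] by auto
      moreover have "\<bar>\<Sum>j\<le>q. coeff P j * (1/2) ^ j\<bar> \<le> real (Suc q) * (D * M)"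
      proof -
        have "\<bar>\<Sum>j\<le>q. coeff P j * (1/2) ^ j\<bar> \<le> (\<Sum>j\<le>q. D * M)"
        proof (rule order.trans[OF sum_abs], rule sum_mono)
          fix j assume "j \<in> {..q}"
          then have "\<bar>coeff P j\<bar> * (1/2)^j \<le> (D * M) * 1"
            using low D M by (intro mult_mono power_le_one) auto
          then show "\<bar>coeff P j * (1/2)^j\<bar> \<le> D * M" by (simp add: abs_mult power_abs)
        qed
        then show ?thesis by simp
      qed
      ultimately have "\<bar>coeff P (Suc q) * (1/2)^Suc q\<bar> \<le> M + real (Suc q) * (D * M)" by linarith
      then have "\<bar>coeff P (Suc q)\<bar> / K \<le> M + real (Suc q) * (D * M)"
        by (simp add: abs_mult K_def power_divide)
      then have "\<bar>coeff P (Suc q)\<bar> \<le> K * (M + real (Suc q) * (D * M))"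
        using K by (simp add: field_simps)
      then show ?thesis by (simp add: algebra_simps)
    next
      case False
      then have "coeff P (Suc q) = 0" using P(1) by (simp add: coeff_eq_0)
      then show ?thesis using K D M by simp
    qed
    have nn: "0 \<le> D * M" "0 \<le> K * (1 + real (Suc q) * D) * M" using K D M by auto
    consider "i \<le> q" | "i = Suc q" | "i > Suc q" by linarith
    then show ?thesis
    proof cases
      case 1 with low[OF 1] nn show ?thesis unfolding distrib_right by linarith
    next
      case 2 with top nn show ?thesis unfolding distrib_right by (auto intro: order.trans)
    next
      case 3
      then have "coeff P i = 0" using P(1) by (simp add: coeff_eq_0)
      with nn show ?thesis unfolding distrib_right by simp
    qed
  qed
  show ?case
    using main D K by (intro exI[of _ "D + K * (1 + real (Suc q) * D)"]) auto
qed

text \<open>A crude Markov inequality: rescaling to the unit interval produces the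
  \<open>1 / h\<close>, and there the supremum controls all coefficients. The intervals are
  half-open like the knot intervals of the Cox-de Boor recursion.\<close>

lemma poly_pderiv_bound:
  "\<exists>C\<ge>0. \<forall>(P::real poly) M a h. degree P \<le> q \<longrightarrow> h > 0 \<longrightarrow> (\<forall>x\<in>{a..<a+h}. \<bar>poly P x\<bar> \<le> M) \<longrightarrow>
     (\<forall>x\<in>{a..<a+h}. \<bar>poly (pderiv P) x\<bar> \<le> C * M / h)"
proof -
  obtain C where C: "C \<ge> 0"
    "\<And>(P::real poly) M i. degree P \<le> q \<Longrightarrow> (\<forall>x\<in>{0..<1}. \<bar>poly P x\<bar> \<le> M) \<Longrightarrow> \<bar>coeff P i\<bar> \<le> C * M"
    using poly_coeff_bound[of q] by blast
  define C' where "C' = real (Suc q) * (real (Suc q) * C)"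
  have "\<bar>poly (pderiv P) x\<bar> \<le> C' * M / h"
    if P: "degree P \<le> q" and h: "h > 0" and b: "\<forall>x\<in>{a..<a+h}. \<bar>poly P x\<bar> \<le> M" and x: "x \<in> {a..<a+h}"
    for P :: "real poly" and M a h x
  proof -
    define Q where "Q = pcompose P [:a, h:]"
    define y where "y = (x - a) / h"
    have y: "0 \<le> y" "y < 1" "a + h * y = x" using x h by (auto simp: y_def field_simps)
    have M: "M \<ge> 0" using b[rule_format, of x] x by auto
    have degQ: "degree Q \<le> q" using P h by (simp add: Q_def degree_pcompose)
    have "\<bar>poly Q z\<bar> \<le> M" if "z \<in> {0..<1}" for z
    proof -
      have "h * z < h * 1" using that h by (intro mult_strict_left_mono) auto
      then show ?thesis
        using that h b[rule_format, of "a + h * z"] by (simp add: Q_def poly_pcompose mult.commute)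
    qed
    then have c: "\<bar>coeff Q i\<bar> \<le> C * M" for i using C(2)[OF degQ] by blast
    have "\<bar>poly (pderiv Q) y\<bar> \<le> C' * M"
    proof -
      have d: "degree (pderiv Q) \<le> q" using degree_pderiv[of Q] degQ by linarith
      have "poly (pderiv Q) y = (\<Sum>i\<le>degree (pderiv Q). coeff (pderiv Q) i * y ^ i)"
        by (simp add: poly_altdef)
      also have "\<bar>\<dots>\<bar> \<le> (\<Sum>i\<le>degree (pderiv Q). real (Suc q) * (C * M))"
      proof (rule order.trans[OF sum_abs], rule sum_mono)
        fix i assume i: "i \<in> {..degree (pderiv Q)}"
        have "\<bar>coeff (pderiv Q) i\<bar> * y ^ i \<le> (real (Suc q) * (C * M)) * 1"
          unfolding coeff_pderiv using i d c[of "Suc i"] C(1) M y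
          by (intro mult_mono power_le_one) (auto simp: abs_mult intro!: mult_mono)
        then show "\<bar>coeff (pderiv Q) i * y ^ i\<bar> \<le> real (Suc q) * (C * M)"
          using y by (simp add: abs_mult power_abs)
      qed
      also have "\<dots> = real (Suc (degree (pderiv Q))) * (real (Suc q) * (C * M))" by simp
      also have "\<dots> \<le> real (Suc q) * (real (Suc q) * (C * M))"
        using d C(1) M by (intro mult_right_mono) auto
      finally show ?thesis by (simp add: C'_def mult_ac)
    qed
    moreover have "poly (pderiv Q) y = poly (pderiv P) x * h"
      using y by (simp add: Q_def pderiv_pcompose poly_pcompose pderiv_pCons mult.commute)
    ultimately show ?thesis using h by (simp add: abs_mult field_simps)
  qed
  moreover have "C' \<ge> 0" using C(1) by (simp add: C'_def)
  ultimately show ?thesis by blast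
qed

section \<open>The polynomial pieces of B-splines\<close>

text \<open>\<open>bspline_piece \<xi> m k i\<close> is the polynomial that represents the B-spline number \<open>i\<close> of degree \<open>k\<close>
  on the knot interval from \<open>\<xi> m\<close> to \<open>\<xi> (m + 1)\<close>.\<close>

primrec bspline_piece :: "(nat \<Rightarrow> real) \<Rightarrow> nat \<Rightarrow> nat \<Rightarrow> nat \<Rightarrow> real poly" where
  "bspline_piece \<xi> m 0 i = (if i = m then 1 else 0)"
| "bspline_piece \<xi> m (Suc k) i =
     Polynomial.smult (1 / (\<xi> (i + Suc k) - \<xi> i)) ([:- \<xi> i, 1:] * bspline_piece \<xi> m k i) +
     Polynomial.smult (1 / (\<xi> (i + Suc k + 1) - \<xi> (i + 1))) ([:\<xi> (i + Suc k + 1), -1:] * bspline_piece \<xi> m k (i + 1))"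

lemma poly_bspline_piece_Suc:
  "poly (bspline_piece \<xi> m (Suc k) i) t =
     (t - \<xi> i) / (\<xi> (i + Suc k) - \<xi> i) * poly (bspline_piece \<xi> m k i) t +
     (\<xi> (i + Suc k + 1) - t) / (\<xi> (i + Suc k + 1) - \<xi> (i + 1)) * poly (bspline_piece \<xi> m k (i + 1)) t"
  by (simp add: algebra_simps diff_divide_distrib)

lemma bspline_piece_outside: "m < i \<or> i + k < m \<Longrightarrow> bspline_piece \<xi> m k i = 0"
  by (induction k arbitrary: i) auto

lemma degree_bspline_piece: "degree (bspline_piece \<xi> m k i) \<le> k"
proof (induction k arbitrary: i)
  case (Suc k)
  have "degree (Polynomial.smult c ([:a, b:] * bspline_piece \<xi> m k j)) \<le> Suc k" for a b c :: real and j
  proof -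
    have "degree (Polynomial.smult c ([:a, b:] * bspline_piece \<xi> m k j)) \<le> degree [:a, b:] + degree (bspline_piece \<xi> m k j)"
      using degree_smult_le degree_mult_le le_trans by blast
    also have "\<dots> \<le> Suc k" using Suc[of j] by simp
    finally show ?thesis .
  qed
  then show ?case unfolding bspline_piece.simps by (intro degree_add_le)
qed simp

lemma bspline_piece_shift:
  "bspline_piece \<xi> (Suc m) k (Suc i) = bspline_piece (\<lambda>j. \<xi> (Suc j)) m k i"
  by (induction k arbitrary: i) auto

text \<open>The algebraic core of the derivative formula. Here \<open>n\<close> is the value of the
  middle B-spline, while \<open>x\<close> and \<open>z\<close> are the outer ones already divided by
  their spans, so that an empty span there needs no special treatment. The two sides differ by a
  multiple of \<open>w * (e2 - a1) - s * (e - a0)\<close>, which is \<open>1 - 1\<close>.\<close>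

lemma bspline_recursion_identity:
  fixes e :: real
  assumes "e - a1 > 0" "e - a0 > 0" "e2 - a1 > 0"
  shows "(t - a0) / (e - a0) * (x - n / (e - a1)) + (e2 - t) / (e2 - a1) * (n / (e - a1) - z) =
    ((t - a0) * x + (e - t) / (e - a1) * n) / (e - a0) - ((t - a1) / (e - a1) * n + (e2 - t) * z) / (e2 - a1)"
proof -
  have ne: "e - a1 \<noteq> 0" "e - a0 \<noteq> 0" "e2 - a1 \<noteq> 0" using assms by auto
  define r s w where "r = inverse (e - a1)" and "s = inverse (e - a0)" and "w = inverse (e2 - a1)"
  have i: "r * (e - a1) = 1" "s * (e - a0) = 1" "w * (e2 - a1) = 1" using ne by (auto simp: r_def s_def w_def)
  have "(t - a0) * s * (x - n * r) + (e2 - t) * w * (n * r - z) =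
    ((t - a0) * x + (e - t) * r * n) * s - ((t - a1) * r * n + (e2 - t) * z) * w"
  proof -
    have "(t - a0) * s * (x - n * r) + (e2 - t) * w * (n * r - z) -
      (((t - a0) * x + (e - t) * r * n) * s - ((t - a1) * r * n + (e2 - t) * z) * w)
      = n * r * (w * (e2 - a1) - s * (e - a0))"
      by (simp add: algebra_simps)
    then show ?thesis using i by simp
  qed
  then show ?thesis by (simp add: divide_inverse r_def s_def w_def)
qed

context
  fixes \<xi> :: "nat \<Rightarrow> real" and m :: nat
  assumes knots_mono: "mono \<xi>" and knots_less: "\<xi> m < \<xi> (Suc m)"
begin

lemma cox_de_boor_eq_piece:
  assumes "\<xi> m \<le> t" "t < \<xi> (Suc m)" "\<xi> (Suc m) \<le> T"
  shows "cox_de_boor T \<xi> k i t = poly (bspline_piece \<xi> m k i) t"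
proof (induction k arbitrary: i)
  case 0
  have "\<xi> i \<le> t \<and> t < \<xi> (i + 1) \<longleftrightarrow> i = m"
  proof
    assume *: "\<xi> i \<le> t \<and> t < \<xi> (i + 1)"
    have "\<not> Suc m \<le> i" using * assms monoD[OF knots_mono, of "Suc m" i] by linarith
    moreover have "\<not> Suc i \<le> m" using * assms monoD[OF knots_mono, of "Suc i" m] by auto
    ultimately show "i = m" by linarith
  qed (use assms in auto)
  then show ?case using assms by auto
next
  case (Suc k)
  show ?case unfolding cox_de_boor.simps poly_bspline_piece_Suc Suc.IH ..
qed

text \<open>At T the half-open rule alone would give 0 everywhere; the closing convention hands this
  point to the last nonempty knot interval.\<close>

lemma cox_de_boor_eq_piece_right_end:
  assumes "\<xi> (Suc m) = T" "\<And>j. \<xi> j \<le> T"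
  shows "cox_de_boor T \<xi> k i T = poly (bspline_piece \<xi> m k i) T"
proof (induction k arbitrary: i)
  case 0
  have "\<xi> i < T \<and> \<xi> (i + 1) = T \<longleftrightarrow> i = m"
  proof
    assume *: "\<xi> i < T \<and> \<xi> (i + 1) = T"
    have "\<not> Suc m \<le> i" using * assms monoD[OF knots_mono, of "Suc m" i] by linarith
    moreover have "\<not> Suc i \<le> m" using * assms knots_less monoD[OF knots_mono, of "Suc i" m] by auto
    ultimately show "i = m" by linarith
  qed (use assms knots_less in auto)
  moreover have "\<not> (\<xi> i \<le> T \<and> T < \<xi> (i + 1))" using assms(2)[of "i+1"] by auto
  ultimately show ?case using assms by auto
next
  case (Suc k)
  show ?case unfolding cox_de_boor.simps poly_bspline_piece_Suc Suc.IH ..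
qed

lemma bspline_piece_nonneg:
  assumes "\<xi> m \<le> t" "t \<le> \<xi> (Suc m)"
  shows "poly (bspline_piece \<xi> m k i) t \<ge> 0"
proof (induction k arbitrary: i)
  case (Suc k)
  have "0 \<le> (t - \<xi> i) / (\<xi> (i + Suc k) - \<xi> i) * poly (bspline_piece \<xi> m k i) t"
  proof (cases "i \<le> m")
    case True
    then show ?thesis using Suc assms monoD[OF knots_mono, of i m] monoD[OF knots_mono, of i "i + Suc k"]
      by (intro mult_nonneg_nonneg divide_nonneg_nonneg) auto
  qed (simp add: bspline_piece_outside)
  moreover have "0 \<le> (\<xi> (i + Suc k + 1) - t) / (\<xi> (i + Suc k + 1) - \<xi> (i + 1)) * poly (bspline_piece \<xi> m k (i + 1)) t"
  proof (cases "m \<le> i + 1 + k")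
    case True
    then show ?thesis
      using Suc assms monoD[OF knots_mono, of "Suc m" "i + Suc k + 1"] monoD[OF knots_mono, of "i + 1" "i + Suc k + 1"]
      by (intro mult_nonneg_nonneg divide_nonneg_nonneg) auto
  qed (simp add: bspline_piece_outside)
  ultimately show ?case unfolding poly_bspline_piece_Suc by linarith
qed simp

text \<open>A B-spline that lives on the fixed knot interval has a positive span, so division by 0
  can only occur next to a factor that vanishes anyway.\<close>

lemma knots_less_support:
  assumes "i \<le> m" "m < i + k"
  shows "\<xi> i < \<xi> (i + k)"
  using assms monoD[OF knots_mono, of i m] monoD[OF knots_mono, of "Suc m" "i + k"] knots_less by auto

text \<open>By induction: differentiating the linear factors of the recursion yields one copy of the
  claimed difference, and differentiating the B-splines in it yields, by the hypothesis and
  \<open>key\<close>, as many further copies as their degree.\<close>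

lemma pderiv_bspline_piece:
  "pderiv (bspline_piece \<xi> m (Suc k) i) =
     Polynomial.smult (real (Suc k)) (Polynomial.smult (1 / (\<xi> (i + Suc k) - \<xi> i)) (bspline_piece \<xi> m k i)
       - Polynomial.smult (1 / (\<xi> (i + Suc k + 1) - \<xi> (i + 1))) (bspline_piece \<xi> m k (i + 1)))"
proof (induction k arbitrary: i)
  case 0
  show ?case by (simp add: pderiv_add pderiv_smult pderiv_pCons pderiv_mult one_pCons)
next
  case (Suc k)
  show ?case
  proof (rule poly_ext)
    fix t
    define N where "N j = poly (bspline_piece \<xi> m k j) t" for j
    define d where "d j l = \<xi> (j + l) - \<xi> j" for j l
    have N1: "poly (bspline_piece \<xi> m (Suc k) j) t =
       (t - \<xi> j) / d j (Suc k) * N j + (\<xi> (j + Suc k + 1) - t) / d (j + 1) (Suc k) * N (j + 1)" for j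
      by (simp only: poly_bspline_piece_Suc N_def d_def) (simp add: add_ac)
    have D1: "poly (pderiv (bspline_piece \<xi> m (Suc k) j)) t
       = real (Suc k) * (N j / d j (Suc k) - N (j + 1) / d (j + 1) (Suc k))" for j
      unfolding Suc.IH by (simp add: N_def d_def algebra_simps)
    have key: "(t - \<xi> i) / d i (Suc (Suc k)) * (N i / d i (Suc k) - N (i + 1) / d (i + 1) (Suc k)) +
      (\<xi> (i + Suc (Suc k) + 1) - t) / d (i + 1) (Suc (Suc k)) * (N (i + 1) / d (i + 1) (Suc k) - N (i + 2) / d (i + 2) (Suc k))
      = ((t - \<xi> i) / d i (Suc k) * N i + (\<xi> (i + Suc k + 1) - t) / d (i + 1) (Suc k) * N (i + 1)) / d i (Suc (Suc k))
      - ((t - \<xi> (i + 1)) / d (i + 1) (Suc k) * N (i + 1) + (\<xi> (i + Suc (Suc k) + 1) - t) / d (i + 2) (Suc k) * N (i + 2)) / d (i + 1) (Suc (Suc k))"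
    \<comment> \<open>If the middle B-spline vanishes, its spans do not matter; otherwise all three
      denominators are positive and the algebraic identity applies.\<close>
    proof (cases "N (i + 1) = 0")
      case True
      then show ?thesis by (simp add: mult_ac)
    next
      case False
      then have "\<not> (m < i + 1 \<or> i + 1 + k < m)" using bspline_piece_outside[of m "i + 1" k \<xi>] by (auto simp: N_def)
      then have "d (i + 1) (Suc k) > 0" "d i (Suc (Suc k)) > 0" "d (i + 1) (Suc (Suc k)) > 0"
        using knots_less_support[of "i + 1" "Suc k"] knots_less_support[of i "Suc (Suc k)"]
          knots_less_support[of "i + 1" "Suc (Suc k)"] by (auto simp: d_def)
      then show ?thesis
        using bspline_recursion_identity[of "\<xi> (i + Suc k + 1)" "\<xi> (i + 1)" "\<xi> i" "\<xi> (i + Suc (Suc k) + 1)"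
            t "N i / d i (Suc k)" "N (i + 1)" "N (i + 2) / d (i + 2) (Suc k)"]
        by (simp add: d_def)
    qed
    have key': "(t - \<xi> i) / d i (Suc (Suc k)) * (N i / d i (Suc k) - N (i + 1) / d (i + 1) (Suc k)) +
      (\<xi> (i + Suc (Suc k) + 1) - t) / d (i + 1) (Suc (Suc k)) * (N (i + 1) / d (i + 1) (Suc k) - N (i + 2) / d (i + 2) (Suc k))
      = poly (bspline_piece \<xi> m (Suc k) i) t / d i (Suc (Suc k)) - poly (bspline_piece \<xi> m (Suc k) (i + 1)) t / d (i + 1) (Suc (Suc k))"
      unfolding key N1[of i] N1[of "i + 1"] by simp
    have lin: "poly (pderiv (Polynomial.smult c ([:a, b:] * P))) t = c * (b * poly P t + (a + b * t) * poly (pderiv P) t)"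
      for a b c and P :: "real poly"
      unfolding pderiv_smult pderiv_mult by (simp add: pderiv_pCons algebra_simps)
    have "poly (pderiv (bspline_piece \<xi> m (Suc (Suc k)) i)) t =
      poly (bspline_piece \<xi> m (Suc k) i) t / d i (Suc (Suc k)) - poly (bspline_piece \<xi> m (Suc k) (i + 1)) t / d (i + 1) (Suc (Suc k))
      + (t - \<xi> i) / d i (Suc (Suc k)) * poly (pderiv (bspline_piece \<xi> m (Suc k) i)) t
      + (\<xi> (i + Suc (Suc k) + 1) - t) / d (i + 1) (Suc (Suc k)) * poly (pderiv (bspline_piece \<xi> m (Suc k) (i + 1))) t"
      unfolding bspline_piece.simps(2)[of \<xi> m "Suc k" i] pderiv_add poly_add lin
      by (simp add: d_def diff_divide_distrib add_divide_distrib left_diff_distrib del: bspline_piece.simps)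
    also have "\<dots> = poly (bspline_piece \<xi> m (Suc k) i) t / d i (Suc (Suc k)) - poly (bspline_piece \<xi> m (Suc k) (i + 1)) t / d (i + 1) (Suc (Suc k))
      + real (Suc k) * ((t - \<xi> i) / d i (Suc (Suc k)) * (N i / d i (Suc k) - N (i + 1) / d (i + 1) (Suc k)) +
      (\<xi> (i + Suc (Suc k) + 1) - t) / d (i + 1) (Suc (Suc k)) * (N (i + 1) / d (i + 1) (Suc k) - N (i + 2) / d (i + 2) (Suc k)))"
      unfolding D1 by (simp add: algebra_simps)
    also have "\<dots> = (1 + real (Suc k)) * (poly (bspline_piece \<xi> m (Suc k) i) t / d i (Suc (Suc k)) - poly (bspline_piece \<xi> m (Suc k) (i + 1)) t / d (i + 1) (Suc (Suc k)))"
      unfolding key' distrib_right mult_1 ..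
    finally show "poly (pderiv (bspline_piece \<xi> m (Suc (Suc k)) i)) t =
      poly (Polynomial.smult (real (Suc (Suc k))) (Polynomial.smult (1 / (\<xi> (i + Suc (Suc k)) - \<xi> i)) (bspline_piece \<xi> m (Suc k) i)
       - Polynomial.smult (1 / (\<xi> (i + Suc (Suc k) + 1) - \<xi> (i + 1))) (bspline_piece \<xi> m (Suc k) (i + 1)))) t"
      by (simp add: d_def algebra_simps del: bspline_piece.simps)
  qed
qed

text \<open>Each lower B-spline enters two neighbours, with weights \<omega> and 1 - \<omega>.
  Raising the degree therefore changes the sum only by a telescoping one, whose boundary terms
  vanish because the first and the last index lie off the interval \<open>m\<close>.\<close>

lemma sum_bspline_piece:
  assumes "k \<le> m" "m \<le> M"
  shows "(\<Sum>i\<le>M. poly (bspline_piece \<xi> m k i) t) = 1"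
  using assms
proof (induction k)
  case 0
  have "(\<Sum>i\<le>M. poly (bspline_piece \<xi> m 0 i) t) = (\<Sum>i\<le>M. if i = m then 1 else 0)"
    by (intro sum.cong) auto
  then show ?case using \<open>m \<le> M\<close> by simp
next
  case (Suc k)
  define N where "N j = poly (bspline_piece \<xi> m k j) t" for j
  define \<omega> where "\<omega> j = (t - \<xi> j) / (\<xi> (j + Suc k) - \<xi> j)" for j
  have N0: "N 0 = 0" "N (Suc M) = 0" using Suc.prems by (auto simp: N_def bspline_piece_outside)
  have r: "poly (bspline_piece \<xi> m (Suc k) i) t = \<omega> i * N i + (N (Suc i) - \<omega> (Suc i) * N (Suc i))" for i
  proof (cases "N (Suc i) = 0")
    case False
    then have "\<not> (m < i + 1 \<or> i + 1 + k < m)" using bspline_piece_outside[of m "i + 1" k \<xi>] by (auto simp: N_def)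
    then have "\<xi> (Suc i) < \<xi> (Suc i + Suc k)" using knots_less_support[of "i + 1" "Suc k"] by auto
    then have e: "(\<xi> (i + Suc k + 1) - t) / (\<xi> (i + Suc k + 1) - \<xi> (i + 1)) = 1 - \<omega> (Suc i)"
      by (simp add: \<omega>_def field_simps)
    show ?thesis unfolding poly_bspline_piece_Suc e by (simp add: N_def \<omega>_def left_diff_distrib)
  qed (simp add: poly_bspline_piece_Suc N_def \<omega>_def del: bspline_piece.simps)
  have "(\<Sum>i\<le>M. poly (bspline_piece \<xi> m (Suc k) i) t)
      = (\<Sum>i\<le>M. \<omega> i * N i - \<omega> (Suc i) * N (Suc i)) + (\<Sum>i\<le>M. N (Suc i))"
    unfolding r sum.distrib[symmetric] by (simp add: algebra_simps)
  also have "(\<Sum>i\<le>M. \<omega> i * N i - \<omega> (Suc i) * N (Suc i)) = 0"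
    using sum_telescope[of "\<lambda>i. \<omega> i * N i" M] by (simp add: N0)
  also have "(\<Sum>i\<le>M. N (Suc i)) = (\<Sum>i\<le>Suc M. N i)"
    by (simp only: sum.atMost_Suc_shift[of N M] N0)
  also have "\<dots> = 1" using Suc by (simp add: N0) (simp add: N_def)
  finally show ?case by simp
qed

text \<open>The knots from \<open>m - k\<close> to \<open>m\<close> coincide, so the factor
  \<open>t - \<xi> i\<close> of the recursion is 0 whenever B-spline \<open>i\<close> lives on the
  interval; the other summand is covered by induction. The next lemma is the mirror image.\<close>

lemma bspline_piece_left_end:
  assumes "k \<le> m" "\<xi> (m - k) = \<xi> m" "m < i + k"
  shows "poly (bspline_piece \<xi> m k i) (\<xi> m) = 0"
  using assms
proof (induction k arbitrary: i)
  case 0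
  then show ?case by simp
next
  case (Suc k)
  have eq: "\<xi> j = \<xi> m" if "m - Suc k \<le> j" "j \<le> m" for j
    using monoD[OF knots_mono that(1)] monoD[OF knots_mono that(2)] Suc.prems by simp
  have "poly (bspline_piece \<xi> m k (i + 1)) (\<xi> m) = 0"
    using Suc eq[of "m - k"] by (intro Suc.IH) auto
  moreover have "(\<xi> m - \<xi> i) * poly (bspline_piece \<xi> m k i) (\<xi> m) = 0"
    using eq[of i] bspline_piece_outside[of m i k \<xi>] Suc.prems by (cases "i \<le> m") auto
  ultimately show ?case unfolding poly_bspline_piece_Suc by auto
qed

lemma bspline_piece_right_end:
  assumes "\<xi> (m + 1 + k) = \<xi> (Suc m)" "i < m"
  shows "poly (bspline_piece \<xi> m k i) (\<xi> (Suc m)) = 0"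
  using assms
proof (induction k arbitrary: i)
  case 0
  then show ?case by simp
next
  case (Suc k)
  have "\<xi> (m + 1 + k) = \<xi> (Suc m)"
    using monoD[OF knots_mono, of "Suc m" "m + 1 + k"] monoD[OF knots_mono, of "m + 1 + k" "m + 1 + Suc k"] Suc.prems by auto
  then have IH: "poly (bspline_piece \<xi> m k j) (\<xi> (Suc m)) = 0" if "j < m" for j using Suc.IH that by blast
  have "i + 1 < m \<or> i + 1 = m" using Suc.prems by linarith
  then have "(\<xi> (i + Suc k + 1) - \<xi> (Suc m)) * poly (bspline_piece \<xi> m k (i + 1)) (\<xi> (Suc m)) = 0"
    using IH[of "i + 1"] Suc.prems \<open>\<xi> (m + 1 + k) = \<xi> (Suc m)\<close> by (auto simp: add_ac)
  then show ?case unfolding poly_bspline_piece_Suc using IH[OF Suc.prems(2)] by auto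
qed

text \<open>Only hat functions have to be computed at the simple knot. Higher degrees inherit the
  agreement, since the recursion uses the same linear factors on both sides.\<close>

lemma bspline_piece_continuous:
  assumes "\<xi> (Suc m) < \<xi> (Suc (Suc m))"
  shows "poly (bspline_piece \<xi> m (Suc k) i) (\<xi> (Suc m)) = poly (bspline_piece \<xi> (Suc m) (Suc k) i) (\<xi> (Suc m))"
proof (induction k arbitrary: i)
  case 0
  consider "i = m" | "i = Suc m" | "Suc i = m" | "i \<noteq> m" "i \<noteq> Suc m" "Suc i \<noteq> m" by blast
  moreover have "\<xi> (Suc m) - \<xi> m \<noteq> 0" "\<xi> (Suc (Suc m)) - \<xi> (Suc m) \<noteq> 0" using knots_less assms by auto
  ultimately show ?case by cases (auto simp: diff_divide_distrib[symmetric])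
next
  case (Suc k)
  show ?case unfolding poly_bspline_piece_Suc[of _ _ "Suc k"] Suc.IH ..
qed

end

section \<open>Splines on a uniform grid\<close>

locale time_grid =
  fixes T :: real and N :: nat
  assumes T_pos: "T > 0" and N_pos: "N \<ge> 1"
begin

definition mesh :: real where "mesh = T / real N"

abbreviation node :: "nat \<Rightarrow> real" where "node \<equiv> time_node T N"

lemma mesh_pos: "mesh > 0"
  using T_pos N_pos by (simp add: mesh_def)

lemma node_eq: "node k = real k * mesh"
  by (simp add: time_node_def mesh_def)

lemma node_0 [simp]: "node 0 = 0"
  by (simp add: node_eq)

lemma node_N [simp]: "node N = T"
  using N_pos by (simp add: node_eq mesh_def)

lemma node_Suc: "node (Suc k) = node k + mesh"
  by (simp add: node_eq algebra_simps)

lemma node_less_Suc: "node k < node (Suc k)"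
  using mesh_pos by (simp add: node_Suc)

lemma node_mono: "j \<le> k \<Longrightarrow> node j \<le> node k"
  using mesh_pos by (simp add: node_eq)

lemma node_le_T: "k \<le> N \<Longrightarrow> node k \<le> T"
  using node_mono[of k N] by simp

lemma node_nonneg: "0 \<le> node k"
  using node_mono[of 0 k] by simp

lemma piece_cover:
  assumes "0 \<le> t" "t < T"
  obtains k where "k < N" "node k \<le> t" "t < node (Suc k)"
proof -
  define k where "k = nat \<lfloor>t / mesh\<rfloor>"
  have nn: "0 \<le> t / mesh" using assms mesh_pos by simp
  then have k: "real k \<le> t / mesh" "t / mesh < real k + 1" unfolding k_def by linarith+
  then have "node k \<le> t" "t < node (Suc k)" using mesh_pos by (auto simp: node_eq field_simps)
  moreover have "k < N"
  proof (rule ccontr)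
    assume "\<not> k < N"
    then have "T \<le> node k" using node_mono[of N k] by simp
    with calculation assms show False by simp
  qed
  ultimately show ?thesis using that by blast
qed

lemma piece_cover_closed:
  assumes "t \<in> {0..T}"
  obtains k where "k < N" "t \<in> {node k..node (Suc k)}"
proof (cases "t = T")
  case True
  have "Suc (N - 1) = N" using N_pos by simp
  then show ?thesis using that[of "N - 1"] True N_pos node_N node_less_Suc[of "N - 1"] by auto
next
  case False
  then obtain k where "k < N" "node k \<le> t" "t < node (Suc k)" using piece_cover[of t] assms by auto
  then show ?thesis using that[of k] by auto
qed

lemma interval_eq_pieces: "{0..T} = (\<Union>k<N. {node k..node (Suc k)})"
proof
  show "{0..T} \<subseteq> (\<Union>k<N. {node k..node (Suc k)})"
    using piece_cover_closed by blast
  show "(\<Union>k<N. {node k..node (Suc k)}) \<subseteq> {0..T}"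
  proof
    fix t assume "t \<in> (\<Union>k<N. {node k..node (Suc k)})"
    then obtain k where "k < N" "node k \<le> t" "t \<le> node (Suc k)" by auto
    then show "t \<in> {0..T}" using node_nonneg[of k] node_le_T[of "Suc k"] by auto
  qed
qed

lemma open_piece_cover:
  assumes "t \<in> {0..T} - node ` {..N}"
  obtains k where "k < N" "t \<in> {node k<..<node (Suc k)}"
proof -
  have "T \<in> node ` {..N}" by (rule image_eqI[of _ _ N]) auto
  then have "0 \<le> t" "t < T" using assms by (auto simp: less_le)
  then obtain k where k: "k < N" "node k \<le> t" "t < node (Suc k)" by (rule piece_cover)
  moreover have "t \<noteq> node k" using assms k(1) by auto
  ultimately show ?thesis using that[of k] by auto
qed

lemma mono_open_knot: "mono (open_knot T N q)"
  unfolding open_knot_def mono_def by (auto intro: node_mono)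

lemma open_knot_add: "k \<le> N \<Longrightarrow> open_knot T N q (k + q) = node k"
  by (simp add: open_knot_def)

lemma open_knot_le_T: "open_knot T N q i \<le> T"
  by (simp add: open_knot_def node_le_T)

text \<open>Dropping one copy of the knot 0 lowers the degree of an open knot vector by one. This is
  why derivatives of the basis are expressed in the basis of the next lower degree, with indices
  shifted by one.\<close>

lemma open_knot_Suc: "(\<lambda>j. open_knot T N (Suc q) (Suc j)) = open_knot T N q"
  by (simp add: open_knot_def fun_eq_iff)

text \<open>The first \<open>q\<close> knot intervals are empty, so the grid interval
  \<open>k\<close> is the knot interval \<open>k + q\<close>.\<close>

definition piece :: "nat \<Rightarrow> nat \<Rightarrow> nat \<Rightarrow> real poly" where
  "piece q k j = bspline_piece (open_knot T N q) (k + q) q j"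

lemma knot_interval:
  assumes "k < N"
  shows "open_knot T N q (k + q) = node k" "open_knot T N q (Suc (k + q)) = node (Suc k)"
    "open_knot T N q (k + q) < open_knot T N q (Suc (k + q))"
  using assms open_knot_add[of k q] open_knot_add[of "Suc k" q] node_less_Suc[of k] by auto

lemma bspline_eq_piece:
  assumes "k < N" "node k \<le> t" "t < node (Suc k)"
  shows "bspline T N q j t = poly (piece q k j) t"
  unfolding bspline_def piece_def
  using assms knot_interval[OF assms(1), of q] node_le_T[of "Suc k"]
  by (intro cox_de_boor_eq_piece mono_open_knot) auto

lemma bspline_eq_piece_T: "bspline T N q j T = poly (piece q (N - 1) j) T"
  unfolding bspline_def piece_def
  using knot_interval[of "N - 1" q] N_pos open_knot_le_T
  by (intro cox_de_boor_eq_piece_right_end mono_open_knot) auto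

text \<open>At an interior right end this is the continuity across a simple knot, hence positive
  degree; at T it is the closing convention of the recursion.\<close>

lemma bspline_eq_piece_closed:
  assumes "q \<ge> 1" "k < N" "t \<in> {node k..node (Suc k)}"
  shows "bspline T N q j t = poly (piece q k j) t"
proof -
  consider "t < node (Suc k)" | "t = node (Suc k)" "Suc k < N" | "t = node (Suc k)" "Suc k = N"
    using assms by fastforce
  then show ?thesis
  proof cases
    case 1
    then show ?thesis using assms bspline_eq_piece by simp
  next
    case 2
    obtain r where r: "q = Suc r" using assms(1) by (cases q) auto
    have "poly (piece q k j) t = poly (piece q (Suc k) j) t"
      using bspline_piece_continuous[OF mono_open_knot, of q "k + q" r j] knot_interval[OF assms(2), of q]
        knot_interval[OF 2(2), of q] 2 by (simp add: piece_def r)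
    also have "\<dots> = bspline T N q j t"
      using 2 node_less_Suc[of "Suc k"] by (intro bspline_eq_piece[symmetric]) auto
    finally show ?thesis ..
  next
    case 3
    then have "k = N - 1" "t = T" by auto
    then show ?thesis using bspline_eq_piece_T by simp
  qed
qed

lemma bspline_nonneg:
  assumes "0 \<le> t" "t < T"
  shows "0 \<le> bspline T N q j t"
proof -
  obtain k where k: "k < N" "node k \<le> t" "t < node (Suc k)" using piece_cover assms by metis
  show ?thesis unfolding bspline_eq_piece[OF k] piece_def
    using k knot_interval[OF k(1), of q] by (intro bspline_piece_nonneg mono_open_knot) auto
qed

lemma bspline_support:
  assumes "k < N" "node k \<le> t" "t < node (Suc k)" "bspline T N q j t \<noteq> 0"
  shows "k \<le> j \<and> j \<le> k + q"
proof -
  have "\<not> (k + q < j \<or> j + q < k + q)"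
    using assms(4) bspline_piece_outside[of "k + q" j q "open_knot T N q"]
    unfolding bspline_eq_piece[OF assms(1-3)] piece_def by auto
  then show ?thesis by linarith
qed

lemma sum_piece:
  assumes "k < N"
  shows "(\<Sum>j<N + q. poly (piece q k j) t) = 1"
proof -
  have "{..<N + q} = {..N + q - 1}" using N_pos by auto
  moreover have "(\<Sum>j\<le>N + q - 1. poly (piece q k j) t) = 1"
    unfolding piece_def using assms
    by (intro sum_bspline_piece[OF mono_open_knot knot_interval(3)[OF assms]]) auto
  ultimately show ?thesis by simp
qed

lemma sum_bspline:
  assumes "t \<in> {0..T}"
  shows "(\<Sum>j<N + q. bspline T N q j t) = 1"
proof (cases "t = T")
  case True
  then show ?thesis using sum_piece[of "N - 1" q] N_pos by (simp add: bspline_eq_piece_T)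
next
  case False
  then obtain k where k: "k < N" "node k \<le> t" "t < node (Suc k)" using piece_cover[of t] assms by auto
  then show ?thesis using sum_piece[of k q] by (simp add: bspline_eq_piece)
qed

text \<open>The multiple knot at 0 kills all B-splines but the first, and the partition of unity
  leaves the value 1 for that one. The argument at T is the same.\<close>

lemma bspline_at_0:
  assumes "j < N + q"
  shows "bspline T N q j 0 = (if j = 0 then 1 else 0)"
proof -
  have 0: "bspline T N q i 0 = 0" if "i > 0" for i
  proof -
    have "poly (bspline_piece (open_knot T N q) q q i) (open_knot T N q q) = 0"
      using that knot_interval[of 0 q] N_pos open_knot_add[of 0 q]
      by (intro bspline_piece_left_end mono_open_knot) (auto simp: open_knot_def)
    moreover have "open_knot T N q q = 0" using open_knot_add[of 0 q] by simp
    ultimately show ?thesis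
      using N_pos T_pos node_less_Suc[of 0] by (subst bspline_eq_piece[of 0]) (auto simp: piece_def)
  qed
  have "(\<Sum>i<N + q. bspline T N q i 0) = (\<Sum>i\<in>{0}. bspline T N q i 0)"
    using 0 N_pos by (intro sum.mono_neutral_right) auto
  then have "bspline T N q 0 0 = 1" using sum_bspline[of 0 q] T_pos by simp
  then show ?thesis using 0 by simp
qed

lemma bspline_at_T:
  assumes "j < N + q"
  shows "bspline T N q j T = (if j = N + q - 1 then 1 else 0)"
proof -
  have 0: "bspline T N q i T = 0" if "i < N + q - 1" for i
  proof -
    have e: "Suc (N - 1 + q) = N + q" using N_pos by simp
    have "poly (bspline_piece (open_knot T N q) (N - 1 + q) q i) (open_knot T N q (Suc (N - 1 + q))) = 0"
      using that knot_interval[of "N - 1" q] N_pos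
      by (intro bspline_piece_right_end mono_open_knot) (auto simp: open_knot_def)
    moreover have "open_knot T N q (Suc (N - 1 + q)) = T" unfolding e using open_knot_add[of N q] by simp
    ultimately show ?thesis by (simp add: bspline_eq_piece_T piece_def)
  qed
  have "(\<Sum>i<N + q. bspline T N q i T) = (\<Sum>i\<in>{N + q - 1}. bspline T N q i T)"
  proof (intro sum.mono_neutral_right ballI)
    fix i assume "i \<in> {..<N + q} - {N + q - 1}"
    then show "bspline T N q i T = 0" by (intro 0) auto
  qed (use N_pos in auto)
  then have "bspline T N q (N + q - 1) T = 1" using sum_bspline[of T q] T_pos by simp
  then show ?thesis using 0 assms by auto
qed

text \<open>The length of the support of B-spline \<open>i\<close> of degree \<open>q\<close>. After
  the index shift of \<open>open_knot_Suc\<close> it is also the denominator in the derivative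
  formula one degree higher.\<close>

definition knot_span :: "nat \<Rightarrow> nat \<Rightarrow> real" where
  "knot_span q i = open_knot T N q (i + Suc q) - open_knot T N q i"

lemma knot_span_bounds:
  assumes "i < N + q"
  shows "mesh \<le> knot_span q i" "knot_span q i \<le> real (Suc q) * mesh"
proof -
  \<comment> \<open>The number of mesh cells in the support: \<open>q + 1\<close> in the interior,
    fewer near the ends, but never 0.\<close>
  define d where "d = min (Suc i) N - (i - q)"
  have d: "i - q \<le> min (Suc i) N" "1 \<le> d" "d \<le> Suc q" "i - q \<le> N" "i + Suc q - q = Suc i"
    using assms N_pos by (auto simp: d_def)
  have "knot_span q i = real d * mesh"
    using d by (simp add: knot_span_def open_knot_def node_eq d_def of_nat_diff left_diff_distrib min_def)
  moreover have "1 * mesh \<le> real d * mesh" "real d * mesh \<le> real (Suc q) * mesh"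
    using d mesh_pos by (intro mult_right_mono; simp)+
  ultimately show "mesh \<le> knot_span q i" "knot_span q i \<le> real (Suc q) * mesh" by auto
qed

text \<open>The first \<open>q + 2\<close> knots coincide, so the first quotient of the derivative
  formula has denominator 0 and drops out.\<close>

lemma pderiv_piece_0:
  "pderiv (piece (Suc q) k 0) = Polynomial.smult (- (real (Suc q) / knot_span q 0)) (piece q k 0)"
  if "k < N"
proof -
  have z: "open_knot T N (Suc q) (Suc q) = open_knot T N (Suc q) 0" by (simp add: open_knot_def)
  have "open_knot T N (Suc q) (Suc (Suc q)) - open_knot T N (Suc q) (Suc 0) = knot_span q 0"
    by (simp add: knot_span_def open_knot_def)
  moreover have "bspline_piece (open_knot T N (Suc q)) (Suc (k + q)) q (Suc 0) = piece q k 0"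
    unfolding piece_def bspline_piece_shift open_knot_Suc ..
  ultimately show ?thesis
    using pderiv_bspline_piece[OF mono_open_knot, of "Suc q" "k + Suc q" q 0] knot_interval[OF that, of "Suc q"] z
    by (simp add: piece_def[of "Suc q"] del: of_nat_Suc)
qed

lemma pderiv_piece_Suc:
  assumes "k < N"
  shows "pderiv (piece (Suc q) k (Suc i)) = Polynomial.smult (real (Suc q))
     (Polynomial.smult (1 / knot_span q i) (piece q k i) -
      Polynomial.smult (1 / knot_span q (Suc i)) (piece q k (Suc i)))"
proof -
  have "open_knot T N (Suc q) (Suc j + Suc q) - open_knot T N (Suc q) (Suc j) = knot_span q j" for j
    by (simp add: knot_span_def open_knot_def)
  moreover have "bspline_piece (open_knot T N (Suc q)) (Suc (k + q)) q (Suc j) = piece q k j" for j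
    unfolding piece_def bspline_piece_shift open_knot_Suc ..
  ultimately show ?thesis
    using pderiv_bspline_piece[OF mono_open_knot, of "Suc q" "k + Suc q" q "Suc i"] knot_interval[OF assms, of "Suc q"]
    by (simp add: piece_def[of "Suc q"] del: of_nat_Suc) (metis add_Suc add_Suc_right)
qed

definition spline :: "nat \<Rightarrow> (nat \<Rightarrow> 'a) \<Rightarrow> real \<Rightarrow> 'a::real_normed_field" where
  "spline q a t = (\<Sum>j<N + q. a j * of_real (bspline T N q j t))"

text \<open>The coefficients of the derivative, in degree \<open>q\<close>, of the spline of degree
  \<open>q + 1\<close> with coefficients \<open>a\<close>.\<close>

definition diff_coeff :: "nat \<Rightarrow> (nat \<Rightarrow> 'a) \<Rightarrow> nat \<Rightarrow> 'a::real_normed_field" where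
  "diff_coeff q a i = of_nat (Suc q) * (a (Suc i) - a i) / of_real (knot_span q i)"

text \<open>Summation by parts. The upper boundary term is 0 because the B-spline of degree
  \<open>q\<close> with index \<open>N + q\<close> lies beyond the last interval.\<close>

lemma sum_pderiv_piece:
  fixes a :: "nat \<Rightarrow> 'a::real_normed_field"
  assumes "k < N"
  shows "(\<Sum>j<N + Suc q. a j * of_real (poly (pderiv (piece (Suc q) k j)) t)) =
     (\<Sum>i<N + q. diff_coeff q a i * of_real (poly (piece q k i) t))"
proof -
  define g :: "nat \<Rightarrow> 'a" where "g i = of_real (poly (piece q k i) t / knot_span q i)" for i
  have gN: "g (N + q) = 0" using assms by (simp add: g_def piece_def bspline_piece_outside)
  have "(\<Sum>j<Suc (N + q). a j * of_real (poly (pderiv (piece (Suc q) k j)) t))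
     = - (of_nat (Suc q) * a 0 * g 0) + (\<Sum>i<N + q. a (Suc i) * (of_nat (Suc q) * (g i - g (Suc i))))"
    unfolding sum.lessThan_Suc_shift pderiv_piece_0[OF assms] pderiv_piece_Suc[OF assms]
    by (simp add: g_def del: of_nat_Suc)
  also have "(\<Sum>i<N + q. a (Suc i) * (of_nat (Suc q) * (g i - g (Suc i)))) =
     of_nat (Suc q) * ((\<Sum>i<N + q. a (Suc i) * g i) - (\<Sum>i<N + q. a (Suc i) * g (Suc i)))"
    unfolding sum_subtractf[symmetric] sum_distrib_left by (intro sum.cong) (auto simp: algebra_simps)
  also have "(\<Sum>i<N + q. a (Suc i) * g (Suc i)) = (\<Sum>i<N + q. a i * g i) - a 0 * g 0"
    using sum.lessThan_Suc_shift[of "\<lambda>i. a i * g i" "N + q"] gN by simp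
  also have "- (of_nat (Suc q) * a 0 * g 0) + of_nat (Suc q) *
       ((\<Sum>i<N + q. a (Suc i) * g i) - ((\<Sum>i<N + q. a i * g i) - a 0 * g 0))
     = (\<Sum>i<N + q. of_nat (Suc q) * (a (Suc i) - a i) * g i)"
    by (simp add: algebra_simps sum_distrib_left sum_subtractf sum.distrib)
  also have "\<dots> = (\<Sum>i<N + q. diff_coeff q a i * of_real (poly (piece q k i) t))"
    by (intro sum.cong) (auto simp: diff_coeff_def g_def)
  finally show ?thesis by simp
qed

lemma has_vector_derivative_piece:
  fixes a :: "nat \<Rightarrow> 'a::real_normed_field"
  assumes "k < N"
  shows "((\<lambda>t. \<Sum>j<N + Suc q. a j * of_real (poly (piece (Suc q) k j) t)) has_vector_derivative
    (\<Sum>i<N + q. diff_coeff q a i * of_real (poly (piece q k i) t))) (at t within S)"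
  unfolding sum_pderiv_piece[OF assms, symmetric]
proof (intro has_vector_derivative_sum has_vector_derivative_mult_right)
  fix j
  have "(poly (piece (Suc q) k j) has_real_derivative poly (pderiv (piece (Suc q) k j)) t) (at t within S)"
    by (rule has_field_derivative_at_within[OF poly_DERIV])
  then show "((\<lambda>t. of_real (poly (piece (Suc q) k j) t) :: 'a) has_vector_derivative
      of_real (poly (pderiv (piece (Suc q) k j)) t)) (at t within S)"
    by (rule has_vector_derivative_of_real)
qed

lemma spline_eq_piece:
  assumes "k < N" "node k \<le> t" "t < node (Suc k)"
  shows "spline q a t = (\<Sum>j<N + q. a j * of_real (poly (piece q k j) t))"
  using assms by (simp add: spline_def bspline_eq_piece)

lemma spline_eq_piece_closed:
  assumes "q \<ge> 1" "k < N" "t \<in> {node k..node (Suc k)}"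
  shows "spline q a t = (\<Sum>j<N + q. a j * of_real (poly (piece q k j) t))"
  unfolding spline_def bspline_eq_piece_closed[OF assms] ..

lemma spline_has_vector_derivative_open:
  assumes "k < N" "t \<in> {node k<..<node (Suc k)}"
  shows "(spline (Suc q) a has_vector_derivative spline q (diff_coeff q a) t) (at t)"
proof -
  have e: "spline q (diff_coeff q a) t = (\<Sum>i<N + q. diff_coeff q a i * of_real (poly (piece q k i) t))"
    using assms by (intro spline_eq_piece) auto
  show ?thesis unfolding e
  proof (rule has_vector_derivative_transform_within_open[OF has_vector_derivative_piece[OF assms(1)]])
    show "(\<Sum>j<N + Suc q. a j * of_real (poly (piece (Suc q) k j) y)) = spline (Suc q) a y"
      if "y \<in> {node k<..<node (Suc k)}" for y
      using that assms by (subst spline_eq_piece) auto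
  qed (use assms in auto)
qed

lemma spline_degree_0:
  assumes "k < N" "node k \<le> t" "t < node (Suc k)"
  shows "spline 0 a t = a k"
proof -
  have "spline 0 a t = (\<Sum>i<N. if i = k then a i else 0)"
    unfolding spline_eq_piece[OF assms] by (intro sum.cong) (auto simp: piece_def)
  then show ?thesis using assms by simp
qed

lemma spline_continuous_on:
  assumes "q \<ge> 1"
  shows "continuous_on {0..T} (spline q a)"
  unfolding interval_eq_pieces
proof (rule continuous_on_closed_Union)
  fix k assume "k \<in> {..<N}"
  then show "continuous_on {node k..node (Suc k)} (spline q a)"
    by (subst continuous_on_cong[OF refl spline_eq_piece_closed[OF assms]])
       (auto intro!: continuous_intros)
qed auto

text \<open>For positive \<open>q\<close> the derivative spline is continuous, so at a node both
  adjacent pieces have the same one-sided derivative. The difference quotients are glued over the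
  finitely many closed pieces; on a piece not containing \<open>t\<close> the limit is
  trivial.\<close>

lemma spline_has_vector_derivative:
  assumes "q \<ge> 1" "t \<in> {0..T}"
  shows "(spline (Suc q) a has_vector_derivative spline q (diff_coeff q a) t) (at t within {0..T})"
proof -
  let ?d = "\<lambda>h. h *\<^sub>R spline q (diff_coeff q a) t"
  let ?f = "spline (Suc q) a"
  have piece: "((\<lambda>y. ((?f y - ?f t) - ?d (y - t)) /\<^sub>R norm (y - t)) \<longlongrightarrow> 0) (at t within {node k..node (Suc k)})"
    if k: "k < N" for k
  proof (cases "t \<in> {node k..node (Suc k)}")
    case True
    have "(?f has_vector_derivative spline q (diff_coeff q a) t) (at t within {node k..node (Suc k)})"
      unfolding spline_eq_piece_closed[OF assms(1) k True]
      by (rule has_vector_derivative_transform[OF True _ has_vector_derivative_piece[OF k]])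
         (use k spline_eq_piece_closed[of "Suc q"] in auto)
    then show ?thesis by (simp add: has_vector_derivative_def has_derivative_at_within)
  next
    case False
    then have "at t within {node k..node (Suc k)} = bot"
      by (auto simp: at_within_eq_bot_iff closure_minimal)
    then show ?thesis by simp
  qed
  have "((\<lambda>y. ((?f y - ?f t) - ?d (y - t)) /\<^sub>R norm (y - t)) \<longlongrightarrow> 0) (at t within (\<Union>k<n. {node k..node (Suc k)}))"
    if "n \<le> N" for n
    using that
  proof (induction n)
    case (Suc n)
    have "(\<Union>k<Suc n. {node k..node (Suc k)}) = (\<Union>k<n. {node k..node (Suc k)}) \<union> {node n..node (Suc n)}"
      unfolding lessThan_Suc UN_insert by (rule Un_commute)
    then show ?case using Suc piece[of n] by (auto simp only: Lim_within_Un)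
  qed simp
  from this[of N] show ?thesis
    unfolding has_vector_derivative_def has_derivative_at_within interval_eq_pieces
    by (simp add: bounded_linear_scaleR_left)
qed

lemma spline_C_k: "spline (Suc q) a \<in> C_k_on q {0..T}"
proof (induction q arbitrary: a)
  case 0
  have "continuous_on {0..T} (spline 1 a)" by (rule spline_continuous_on) simp
  then show ?case by (auto simp: C_k_on_def intro!: exI[of _ "\<lambda>_. spline 1 a"])
next
  case (Suc q)
  from Suc[of "diff_coeff (Suc q) a"] obtain D where D: "D 0 = spline (Suc q) (diff_coeff (Suc q) a)"
    "\<And>j t. j < q \<Longrightarrow> t \<in> {0..T} \<Longrightarrow> (D j has_vector_derivative D (Suc j) t) (at t within {0..T})"
    "continuous_on {0..T} (D q)"
    unfolding C_k_on_def by auto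
  define D' where "D' = case_nat (spline (Suc (Suc q)) a) D"
  have "(D' j has_vector_derivative D' (Suc j) t) (at t within {0..T})" if "j < Suc q" "t \<in> {0..T}" for j t
    using that D(2)[of "j - 1" t] spline_has_vector_derivative[of "Suc q" t a]
    by (cases j) (auto simp: D'_def D(1))
  moreover have "D' 0 = spline (Suc (Suc q)) a" "continuous_on {0..T} (D' (Suc q))"
    using D by (auto simp: D'_def)
  ultimately show ?case unfolding C_k_on_def by blast
qed

lemma poly_of_real:
  "\<exists>P::'a::real_normed_field poly. degree P \<le> degree p \<and> (\<forall>t. poly P (of_real t) = of_real (poly p t))"
proof (intro exI conjI allI)
  show "degree (map_poly of_real p :: 'a poly) \<le> degree p" by (intro degree_le) (simp add: coeff_map_poly coeff_eq_0)
  show "poly (map_poly of_real p) (of_real t) = (of_real (poly p t) :: 'a)" for t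
    by (induction p) (auto simp: map_poly_pCons)
qed

lemma spline_piecewise_poly:
  fixes a :: "nat \<Rightarrow> 'a::real_normed_field"
  assumes "k < N"
  shows "\<exists>P. degree P \<le> q \<and> (\<forall>t\<in>{node k<..<node (Suc k)}. spline q a t = poly P (of_real t))"
proof -
  have "\<forall>j. \<exists>P::'a poly. degree P \<le> q \<and> (\<forall>t. poly P (of_real t) = of_real (poly (piece q k j) t))"
    using poly_of_real degree_bspline_piece[of "open_knot T N q" "k + q" q]
    unfolding piece_def by (meson order_trans)
  then obtain P :: "nat \<Rightarrow> 'a poly" where P: "\<And>j. degree (P j) \<le> q"
    "\<And>j t. poly (P j) (of_real t) = of_real (poly (piece q k j) t)" by metis
  define Q where "Q = (\<Sum>j<N + q. Polynomial.smult (a j) (P j))"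
  have "degree Q \<le> q" unfolding Q_def
    by (intro degree_sum_le order.trans[OF degree_smult_le P(1)]) simp
  moreover have "spline q a t = poly Q (of_real t)" if "t \<in> {node k<..<node (Suc k)}" for t
    using that assms by (simp add: spline_eq_piece Q_def poly_sum P(2))
  ultimately show ?thesis by blast
qed

lemma spline_in_spline_space: "spline q a \<in> spline_space T N q"
proof -
  have "\<exists>P. degree P \<le> q \<and> (\<forall>t\<in>{node (j - 1)<..<node j}. spline q a t = poly P (of_real t))"
    if "j \<in> {1..N}" for j
    using spline_piecewise_poly[of "j - 1" q a] that by auto
  moreover have "q \<ge> 1 \<longrightarrow> spline q a \<in> C_k_on (q - 1) {0..T}"
    using spline_C_k[of "q - 1" a] by auto
  ultimately show ?thesis unfolding spline_space_def by blast
qed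

lemma spline_at_0: "spline q a 0 = a 0"
proof -
  have "spline q a 0 = (\<Sum>j<N + q. if j = 0 then a j else 0)"
    unfolding spline_def by (intro sum.cong) (auto simp: bspline_at_0)
  then show ?thesis using N_pos by simp
qed

lemma spline_at_T: "spline q a T = a (N + q - 1)"
proof -
  have "spline q a T = (\<Sum>j<N + q. if j = N + q - 1 then a j else 0)"
    unfolding spline_def by (intro sum.cong) (auto simp: bspline_at_T)
  then show ?thesis using N_pos by simp
qed

lemma spline_const: "t \<in> {0..T} \<Longrightarrow> spline q (\<lambda>j. a j + c) t = spline q a t + c"
proof -
  assume "t \<in> {0..T}"
  then have "c * of_real (\<Sum>j<N + q. bspline T N q j t) = c" by (simp add: sum_bspline)
  then show ?thesis by (simp only: spline_def distrib_right sum.distrib of_real_sum sum_distrib_left)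
qed

text \<open>Partial sums form a discrete antiderivative: every spline of degree \<open>q\<close> is
  the derivative of one that vanishes at 0.\<close>

lemma diff_coeff_surj: "\<exists>a. a 0 = 0 \<and> (\<forall>i<N + q. diff_coeff q a i = b i)"
proof -
  define a where "a j = (\<Sum>i<j. b i * of_real (knot_span q i) / of_nat (Suc q))" for j
  have "knot_span q i \<noteq> 0" if "i < N + q" for i using knot_span_bounds[OF that] mesh_pos by auto
  then show ?thesis
    by (intro exI[of _ a]) (auto simp: a_def diff_coeff_def simp del: of_nat_Suc)
qed

lemma spline_cong: "(\<And>i. i < N + q \<Longrightarrow> a i = b i) \<Longrightarrow> spline q a = spline q b"
  by (auto simp: spline_def intro!: sum.cong)

end

section \<open>Stability of the B-spline basis\<close>

text \<open>The degree is raised by integrating: the coefficients of the derivative are controlled by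
  Markov's inequality and the induction hypothesis, and the first coefficient is the value at 0.\<close>

lemma spline_coeff_bound:
  fixes T :: real
  assumes "T > 0"
  shows "\<exists>C\<ge>0. \<exists>s. \<forall>N\<ge>1. \<forall>(a::nat \<Rightarrow> real) M. (\<forall>t\<in>{0..<T}. \<bar>time_grid.spline T N q a t\<bar> \<le> M) \<longrightarrow>
     (\<forall>j<N + q. \<bar>a j\<bar> \<le> C * real N ^ s * M)"
proof (induction q)
  case 0
  have "\<bar>a j\<bar> \<le> 1 * real N ^ 0 * M"
    if "N \<ge> 1" "\<forall>t\<in>{0..<T}. \<bar>time_grid.spline T N 0 a t\<bar> \<le> M" "j < N + 0" for N j and a :: "nat \<Rightarrow> real" and M
  proof -
    interpret time_grid T N using assms that by unfold_locales auto
    have "spline 0 a (node j) = a j" using that node_less_Suc[of j] by (intro spline_degree_0) auto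
    moreover have "node j \<in> {0..<T}"
      using that node_nonneg[of j] node_less_Suc[of j] node_le_T[of "Suc j"] by auto
    ultimately show ?thesis using that(2) by fastforce
  qed
  then show ?case by (intro exI[of _ 1] conjI exI[of _ 0]) auto
next
  case (Suc q)
  then obtain C s where C: "C \<ge> 0" "\<And>N (a::nat \<Rightarrow> real) M j. N \<ge> 1 \<Longrightarrow>
     (\<forall>t\<in>{0..<T}. \<bar>time_grid.spline T N q a t\<bar> \<le> M) \<Longrightarrow> j < N + q \<Longrightarrow> \<bar>a j\<bar> \<le> C * real N ^ s * M"
    by metis
  obtain C' where C': "C' \<ge> 0" "\<And>(P::real poly) M a h x. degree P \<le> Suc q \<Longrightarrow> h > 0 \<Longrightarrow>
     (\<forall>x\<in>{a..<a+h}. \<bar>poly P x\<bar> \<le> M) \<Longrightarrow> x \<in> {a..<a+h} \<Longrightarrow> \<bar>poly (pderiv P) x\<bar> \<le> C' * M / h"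
    using poly_pderiv_bound[of "Suc q"] by metis
  have "\<bar>a j\<bar> \<le> (1 + real (Suc q) * (C * C')) * real N ^ Suc s * M"
    if N: "N \<ge> 1" and b: "\<forall>t\<in>{0..<T}. \<bar>time_grid.spline T N (Suc q) a t\<bar> \<le> M" and j: "j < N + Suc q"
    for N j and a :: "nat \<Rightarrow> real" and M
  proof -
    interpret time_grid T N using assms N by unfold_locales auto
    have M: "M \<ge> 0" using b[rule_format, of 0] assms by auto
    define D where "D = C * C' * real N ^ s * M"
    have D: "D \<ge> 0" using C(1) C'(1) M by (simp add: D_def)
    have deriv: "\<bar>spline q (diff_coeff q a) t\<bar> \<le> C' * M / mesh" if t: "t \<in> {0..<T}" for t
    proof -
      obtain k where k: "k < N" "node k \<le> t" "t < node (Suc k)" using piece_cover[of t] t by auto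
      define P where "P = (\<Sum>j<N + Suc q. Polynomial.smult (a j) (piece (Suc q) k j))"
      have "degree P \<le> Suc q" unfolding P_def piece_def
        by (intro degree_sum_le order.trans[OF degree_smult_le degree_bspline_piece]) simp
      moreover have "\<bar>poly P x\<bar> \<le> M" if "x \<in> {node k..<node k + mesh}" for x
      proof -
        have x: "node k \<le> x" "x < node (Suc k)" using that by (auto simp: node_Suc)
        moreover have "x \<in> {0..<T}" using x k node_nonneg[of k] node_le_T[of "Suc k"] by auto
        ultimately show ?thesis using b[rule_format, of x] spline_eq_piece[OF k(1), of x "Suc q" a]
          by (simp add: P_def poly_sum del: sum.lessThan_Suc)
      qed
      ultimately have "\<bar>poly (pderiv P) t\<bar> \<le> C' * M / mesh"
        using C'(2)[of P mesh "node k" M t] k mesh_pos by (auto simp: node_Suc)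
      moreover have "poly (pderiv P) t = spline q (diff_coeff q a) t"
        unfolding spline_eq_piece[OF k]
        using sum_pderiv_piece[OF k(1), where 'a = real and q = q and a = a and t = t]
        by (simp add: P_def poly_sum pderiv_sum pderiv_smult del: sum.lessThan_Suc)
      ultimately show ?thesis by simp
    qed
    \<comment> \<open>The \<open>1 / mesh\<close> of Markov's inequality cancels against the span,
      which is at most \<open>(q + 1) * mesh\<close>. The additional power of \<open>N\<close> comes
      from adding up to \<open>(q + 1) * N\<close> such increments below.\<close>
    have step: "\<bar>a (Suc i) - a i\<bar> \<le> D" if i: "i < N + q" for i
    proof -
      note w = knot_span_bounds[OF i]
      have w0: "knot_span q i > 0" using w mesh_pos by linarith
      have "\<bar>diff_coeff q a i\<bar> \<le> C * real N ^ s * (C' * M / mesh)"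
        using C(2)[OF N _ i] deriv by blast
      also have "\<dots> = D / mesh" by (simp add: D_def)
      finally have "\<bar>a (Suc i) - a i\<bar> * real (Suc q) / knot_span q i \<le> D / mesh"
        using w0 by (simp add: diff_coeff_def abs_mult mult.commute del: of_nat_Suc)
      then have "\<bar>a (Suc i) - a i\<bar> * real (Suc q) \<le> D / mesh * knot_span q i"
        using w0 by (simp add: pos_divide_le_eq del: of_nat_Suc)
      also have "\<dots> \<le> D / mesh * (real (Suc q) * mesh)"
        using w D mesh_pos by (intro mult_left_mono) auto
      also have "\<dots> = D * real (Suc q)" using mesh_pos by simp
      finally show ?thesis by (simp del: of_nat_Suc)
    qed
    have "\<bar>a i\<bar> \<le> M + real i * D" if "i < N + Suc q" for i
      using that
    proof (induction i)
      case 0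
      then show ?case using b[rule_format, of 0] spline_at_0[of "Suc q" a] assms by simp
    next
      case (Suc i)
      then show ?case using step[of i] by (simp add: algebra_simps)
    qed
    from this[OF j] have "\<bar>a j\<bar> \<le> M + real j * D" .
    also have "real j * D \<le> (real (Suc q) * real N) * D"
    proof (intro mult_right_mono D)
      have "q * 1 \<le> q * N" using N by (intro mult_left_mono) auto
      then have "j \<le> Suc q * N" using j unfolding mult_Suc by linarith
      then show "real j \<le> real (Suc q) * real N" by (metis of_nat_le_iff of_nat_mult)
    qed
    also have "M + (real (Suc q) * real N) * D = 1 * M + real (Suc q) * (C * C') * real N ^ Suc s * M"
      by (simp add: D_def del: of_nat_Suc)
    also have "1 * M \<le> real N ^ Suc s * M"
      using N M by (intro mult_right_mono one_le_power) auto
    finally show ?thesis by (simp add: algebra_simps del: of_nat_Suc)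
  qed
  then show ?case using C(1) C'(1)
    by (intro exI[of _ "1 + real (Suc q) * (C * C')"] conjI exI[of _ "Suc s"]) auto
qed

lemma C_k_on_continuous: "f \<in> C_k_on k S \<Longrightarrow> continuous_on S f"
proof -
  assume "f \<in> C_k_on k S"
  then obtain D where D: "D 0 = f"
    "\<And>j t. j < k \<Longrightarrow> t \<in> S \<Longrightarrow> (D j has_vector_derivative D (Suc j) t) (at t within S)"
    "continuous_on S (D k)"
    unfolding C_k_on_def by auto
  then show ?thesis
    by (cases k) (auto simp: continuous_on_eq_continuous_within intro!: has_vector_derivative_continuous)
qed

context time_grid
begin

text \<open>The Curry--Schoenberg theorem for the uniform grid.\<close>

lemma spline_space_eq_spline:
  fixes f :: "real \<Rightarrow> 'a::{real_normed_field, banach}"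
  assumes "f \<in> spline_space T N q"
  shows "\<exists>a. \<forall>k<N. \<forall>t\<in>{node k<..<node (Suc k)}. f t = spline q a t"
  using assms
proof (induction q arbitrary: f)
  case 0
  have "\<forall>k\<in>{..<N}. \<exists>P. degree P \<le> 0 \<and> (\<forall>t\<in>{node k<..<node (Suc k)}. f t = poly P (of_real t))"
  proof
    fix k assume "k \<in> {..<N}"
    then have "Suc k \<in> {1..N}" by auto
    then show "\<exists>P. degree P \<le> 0 \<and> (\<forall>t\<in>{node k<..<node (Suc k)}. f t = poly P (of_real t))"
      using 0 unfolding spline_space_def by fastforce
  qed
  then obtain P where P: "\<And>k. k < N \<Longrightarrow> degree (P k) = 0"
    "\<And>k t. k < N \<Longrightarrow> t \<in> {node k<..<node (Suc k)} \<Longrightarrow> f t = poly (P k) (of_real t)"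
    by (metis lessThan_iff le_zero_eq)
  have "f t = spline 0 (\<lambda>k. coeff (P k) 0) t" if k: "k < N" and t: "t \<in> {node k<..<node (Suc k)}" for k t
  proof -
    have "spline 0 (\<lambda>k. coeff (P k) 0) t = coeff (P k) 0" using t k by (intro spline_degree_0) auto
    also have "\<dots> = poly (P k) (of_real t)"
      by (rule degree_eq_zeroE[OF P(1)[OF k]]) simp
    finally show ?thesis using P(2)[OF k t] by simp
  qed
  then show ?case by blast
next
  case (Suc q)
  have "\<forall>k\<in>{..<N}. \<exists>P. degree P \<le> Suc q \<and> (\<forall>t\<in>{node k<..<node (Suc k)}. f t = poly P (of_real t))"
  proof
    fix k assume "k \<in> {..<N}"
    then have "Suc k \<in> {1..N}" by auto
    then show "\<exists>P. degree P \<le> Suc q \<and> (\<forall>t\<in>{node k<..<node (Suc k)}. f t = poly P (of_real t))"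
      using Suc.prems unfolding spline_space_def by fastforce
  qed
  then obtain P where P: "\<And>k. k < N \<Longrightarrow> degree (P k) \<le> Suc q"
    "\<And>k t. k < N \<Longrightarrow> t \<in> {node k<..<node (Suc k)} \<Longrightarrow> f t = poly (P k) (of_real t)"
    by (metis lessThan_iff)
  have Ck: "f \<in> C_k_on q {0..T}" using Suc.prems by (simp add: spline_space_def)
  have f': "(f has_vector_derivative poly (pderiv (P k)) (of_real t)) (at t)"
    if "k < N" "t \<in> {node k<..<node (Suc k)}" for k t
  proof (rule has_vector_derivative_transform_within_open[where S = "{node k<..<node (Suc k)}"])
    show "((\<lambda>t. poly (P k) (of_real t)) has_vector_derivative poly (pderiv (P k)) (of_real t)) (at t)"
      by (rule has_vector_derivative_real_field) (rule poly_DERIV)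
  qed (use that P(2) in auto)
  have deg: "degree (pderiv (P k)) \<le> q" if "k < N" for k
    using P(1)[OF that] by (intro degree_le) (auto simp: coeff_pderiv coeff_eq_0)
  \<comment> \<open>The induction hypothesis needs a function that represents the derivative inside
    the pieces and has one order of smoothness less; its values at the nodes are left to the
    witness.\<close>
  have "\<exists>g\<in>spline_space T N q. \<forall>k<N. \<forall>t\<in>{node k<..<node (Suc k)}. g t = poly (pderiv (P k)) (of_real t)"
  proof -
    have pieces: "\<exists>P. degree P \<le> q \<and> (\<forall>t\<in>{node (j - 1)<..<node j}. g t = poly P (of_real t))"
      if g: "\<And>k t. k < N \<Longrightarrow> t \<in> {node k<..<node (Suc k)} \<Longrightarrow> g t = poly (pderiv (P k)) (of_real t)"
        and j: "j \<in> {1..N}" for g j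
      using j deg g[of "j - 1"] by (intro exI[of _ "pderiv (P (j - 1))"]) auto
    show ?thesis
    proof (cases q)
      case 0
      \<comment> \<open>Degree 0 requires no smoothness, so the arbitrary values of the classical
        derivative at the nodes do no harm.\<close>
      have "vector_derivative f (at t) = poly (pderiv (P k)) (of_real t)"
        if "k < N" "t \<in> {node k<..<node (Suc k)}" for k t
        using f'[OF that] by (rule vector_derivative_at)
      with 0 pieces show ?thesis
        by (intro bexI[of _ "\<lambda>t. vector_derivative f (at t)"]) (auto simp: spline_space_def)
    next
      case (Suc r)
      obtain D where D: "D 0 = f"
        "\<And>j t. j < q \<Longrightarrow> t \<in> {0..T} \<Longrightarrow> (D j has_vector_derivative D (Suc j) t) (at t within {0..T})"
        "continuous_on {0..T} (D q)"
        using Ck unfolding C_k_on_def by auto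
      have "D 1 t = poly (pderiv (P k)) (of_real t)" if k: "k < N" and t: "t \<in> {node k<..<node (Suc k)}" for k t
      proof -
        have "t \<in> {0<..<T}" using k t node_nonneg[of k] node_le_T[of "Suc k"] by auto
        then have "(f has_vector_derivative D 1 t) (at t)"
          using D(2)[of 0 t] Suc D(1) by (simp add: at_within_Icc_at)
        with f'[OF k t] show ?thesis by (rule vector_derivative_unique_at[symmetric])
      qed
      moreover have "D 1 \<in> C_k_on r {0..T}" unfolding C_k_on_def
        using D(2)[of "Suc _"] D(3) Suc by (auto intro!: exI[of _ "\<lambda>j. D (Suc j)"])
      ultimately show ?thesis using pieces[of "D 1"] Suc by (intro bexI[of _ "D 1"]) (auto simp: spline_space_def)
    qed
  qed
  then obtain g b where gb: "\<And>k t. k < N \<Longrightarrow> t \<in> {node k<..<node (Suc k)} \<Longrightarrow> g t = poly (pderiv (P k)) (of_real t)"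
    "\<And>k t. k < N \<Longrightarrow> t \<in> {node k<..<node (Suc k)} \<Longrightarrow> g t = spline q b t"
    using Suc.IH by metis
  obtain a where "\<forall>i<N + q. diff_coeff q a i = b i" using diff_coeff_surj by metis
  then have a: "spline q (diff_coeff q a) = spline q b" by (intro spline_cong) auto
  \<comment> \<open>Off the nodes both derivatives equal \<open>g\<close>, and continuity at the
    nodes makes the difference constant. The partition of unity then absorbs the constant into the
    coefficients.\<close>
  have "f t - spline (Suc q) a t = f 0 - spline (Suc q) a 0" if "t \<in> {0..T}" for t
  proof (rule has_derivative_zero_unique_strong_interval[of "node ` {..N}" 0 T "\<lambda>t. f t - spline (Suc q) a t"])
    show "continuous_on {0..T} (\<lambda>t. f t - spline (Suc q) a t)"
      by (intro continuous_on_diff C_k_on_continuous[OF Ck] spline_continuous_on) simp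
    fix x assume "x \<in> {0..T} - node ` {..N}"
    then obtain k where k: "k < N" "x \<in> {node k<..<node (Suc k)}" by (rule open_piece_cover)
    have "((\<lambda>t. f t - spline (Suc q) a t) has_vector_derivative 0) (at x)"
      using has_vector_derivative_diff[OF f'[OF k] spline_has_vector_derivative_open[OF k, of q a]]
        gb(1)[OF k] gb(2)[OF k] by (simp add: a)
    then show "((\<lambda>t. f t - spline (Suc q) a t) has_derivative (\<lambda>h. 0)) (at x within {0..T})"
      by (auto simp: has_vector_derivative_def intro: has_derivative_at_withinI)
  qed (use that in auto)
  then have "f t = spline (Suc q) (\<lambda>j. a j + (f 0 - spline (Suc q) a 0)) t" if "t \<in> {0..T}" for t
    using that by (subst spline_const) (auto simp: algebra_simps)
  moreover have "t \<in> {0..T}" if "k < N" "t \<in> {node k<..<node (Suc k)}" for k t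
    using that node_nonneg[of k] node_le_T[of "Suc k"] by auto
  ultimately show ?case by blast
qed

section \<open>Integrals of piecewise polynomials\<close>

text \<open>Neither the degree nor the values at the nodes are restricted. The class is therefore
  closed under products and under changes at the nodes, and integrability below reduces to
  membership.\<close>

definition pw_poly :: "(real \<Rightarrow> 'a::real_normed_field) \<Rightarrow> bool" where
  "pw_poly f \<longleftrightarrow> (\<forall>k<N. \<exists>P. \<forall>t\<in>{node k<..<node (Suc k)}. f t = poly P (of_real t))"

lemma pw_poly_const: "pw_poly (\<lambda>_. c)"
  unfolding pw_poly_def by (auto intro!: exI[of _ "[:c:]"])

lemma pw_poly_add: "pw_poly f \<Longrightarrow> pw_poly g \<Longrightarrow> pw_poly (\<lambda>t. f t + g t)"
  unfolding pw_poly_def by (metis poly_add)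

lemma pw_poly_diff: "pw_poly f \<Longrightarrow> pw_poly g \<Longrightarrow> pw_poly (\<lambda>t. f t - g t)"
  unfolding pw_poly_def by (metis poly_diff)

lemma pw_poly_mult: "pw_poly f \<Longrightarrow> pw_poly g \<Longrightarrow> pw_poly (\<lambda>t. f t * g t)"
  unfolding pw_poly_def by (metis poly_mult)

lemma pw_poly_sum: "finite I \<Longrightarrow> (\<And>i. i \<in> I \<Longrightarrow> pw_poly (f i)) \<Longrightarrow> pw_poly (\<lambda>t. \<Sum>i\<in>I. f i t)"
  by (induction I rule: finite_induct) (auto intro: pw_poly_const pw_poly_add)

lemma pw_poly_power2: "pw_poly f \<Longrightarrow> pw_poly (\<lambda>t. (f t)\<^sup>2)"
  unfolding power2_eq_square by (rule pw_poly_mult)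

lemma pw_poly_of_real:
  assumes "pw_poly (f :: real \<Rightarrow> real)"
  shows "pw_poly (\<lambda>t. of_real (f t) :: 'a::real_normed_field)"
  unfolding pw_poly_def
proof (intro allI impI)
  fix k assume "k < N"
  then obtain p where p: "\<forall>t\<in>{node k<..<node (Suc k)}. f t = poly p t"
    using assms unfolding pw_poly_def by auto
  obtain P :: "'a poly" where "\<forall>t. poly P (of_real t) = of_real (poly p t)" using poly_of_real by blast
  with p show "\<exists>P. \<forall>t\<in>{node k<..<node (Suc k)}. (of_real (f t) :: 'a) = poly P (of_real t)"
    by (intro exI[of _ P]) auto
qed

lemma pw_poly_spline: "pw_poly (spline q a)"
  unfolding pw_poly_def using spline_piecewise_poly by blast

lemma pw_poly_cong:
  assumes "pw_poly f" "\<And>k t. k < N \<Longrightarrow> t \<in> {node k<..<node (Suc k)} \<Longrightarrow> g t = f t"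
  shows "pw_poly g"
  using assms unfolding pw_poly_def by (metis (no_types, lifting))

lemmas pw_poly_intros = pw_poly_const pw_poly_add pw_poly_diff pw_poly_mult pw_poly_power2
  pw_poly_of_real pw_poly_spline

lemma pw_poly_absolutely_integrable:
  fixes f :: "real \<Rightarrow> 'a::{real_normed_field, euclidean_space}"
  assumes "pw_poly f"
  shows "f absolutely_integrable_on {0..T}"
proof -
  have "f absolutely_integrable_on {0..node n}" if "n \<le> N" for n
    using that
  proof (induction n)
    case 0
    then show ?case by (auto intro: absolutely_integrable_on_null[of 0 0, simplified])
  next
    case (Suc n)
    then obtain P where P: "\<forall>t\<in>{node n<..<node (Suc n)}. f t = poly P (of_real t)"
      using assms unfolding pw_poly_def by (metis Suc_le_lessD)
    have "(\<lambda>t. poly P (of_real t)) absolutely_integrable_on {node n..node (Suc n)}"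
      by (intro absolutely_integrable_continuous_real continuous_intros)
    then have "f absolutely_integrable_on {node n..node (Suc n)}"
      by (rule absolutely_integrable_spike[OF _ negligible_finite[of "{node n, node (Suc n)}"]]) (use P in auto)
    moreover have "{0..node (Suc n)} = {0..node n} \<union> {node n..node (Suc n)}"
      using node_nonneg[of n] node_less_Suc[of n] by (simp add: ivl_disj_un_two_touch)
    ultimately show ?case using Suc by (simp add: absolutely_integrable_Un)
  qed
  from this[of N] show ?thesis by simp
qed

lemma pw_poly_integrable:
  fixes f :: "real \<Rightarrow> 'a::{real_normed_field, euclidean_space}"
  assumes "pw_poly f"
  shows "f integrable_on {0..T}"
  using pw_poly_absolutely_integrable[OF assms] set_lebesgue_integral_eq_integral(1) by blast

lemma pw_poly_integrable_sub:
  fixes f :: "real \<Rightarrow> 'a::{real_normed_field, euclidean_space}"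
  assumes "pw_poly f" "0 \<le> s" "t \<le> T"
  shows "f integrable_on {s..t}"
  by (rule integrable_subinterval_real[OF pw_poly_integrable[OF assms(1)]]) (use assms in auto)

text \<open>The bridge from the Lebesgue integrals of the formulation to the gauge integral, for
  which the fundamental theorem is used.\<close>

lemma pw_poly_lebesgue_integral:
  fixes f :: "real \<Rightarrow> 'a::{real_normed_field, euclidean_space}"
  assumes "pw_poly f"
  shows "(LINT t|lebesgue_on {0<..<T}. f t) = integral {0..T} f"
proof -
  have "f absolutely_integrable_on {0<..<T}"
    by (rule set_integrable_subset[OF pw_poly_absolutely_integrable[OF assms]]) auto
  then have "integrable (lebesgue_on {0<..<T}) f"
    by (rule absolutely_integrable_imp_integrable) simp
  then have "(LINT t|lebesgue_on {0<..<T}. f t) = integral {0<..<T} f"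
    by (rule lebesgue_integral_eq_integral) simp
  then show ?thesis by (simp add: integral_open_interval_real)
qed

lemma integral_cong_pieces:
  assumes "\<And>k t. k < N \<Longrightarrow> t \<in> {node k<..<node (Suc k)} \<Longrightarrow> f t = g t"
  shows "integral {0..T} f = integral {0..T} g"
proof (rule integral_spike[of "node ` {..N}"])
  fix t assume "t \<in> {0..T} - node ` {..N}"
  then obtain k where "k < N" "t \<in> {node k<..<node (Suc k)}" by (rule open_piece_cover)
  with assms show "g t = f t" by simp
qed (simp add: negligible_finite)

text \<open>Splines of degree one need not be differentiable at the nodes; the fundamental theorem
  admits this finite exceptional set.\<close>

lemma has_integral_derivative_pieces:
  fixes F :: "real \<Rightarrow> 'a::banach"
  assumes "0 \<le> s" "s \<le> t" "t \<le> T" "continuous_on {0..T} F"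
    and "\<And>k t. k < N \<Longrightarrow> t \<in> {node k<..<node (Suc k)} \<Longrightarrow> (F has_vector_derivative f t) (at t)"
  shows "(f has_integral (F t - F s)) {s..t}"
proof (rule fundamental_theorem_of_calculus_interior_strong[of "node ` {..N}"])
  fix x assume x: "x \<in> {s<..<t} - node ` {..N}"
  then have "x \<in> {0..T} - node ` {..N}" using assms by auto
  then obtain k where "k < N" "x \<in> {node k<..<node (Suc k)}" by (rule open_piece_cover)
  with assms show "(F has_vector_derivative f x) (at x)" by simp
qed (use assms in \<open>auto intro: continuous_on_subset\<close>)

section \<open>Energy estimate\<close>

definition ip :: "(real \<Rightarrow> real) \<Rightarrow> (real \<Rightarrow> real) \<Rightarrow> real" where
  "ip f g = integral {0..T} (\<lambda>t. f t * g t)"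

lemma ip_commute: "ip f g = ip g f"
  by (simp add: ip_def mult.commute)

lemma ip_add_left: "pw_poly f \<Longrightarrow> pw_poly g \<Longrightarrow> pw_poly w \<Longrightarrow> ip (\<lambda>t. f t + g t) w = ip f w + ip g w"
  unfolding ip_def distrib_right by (intro integral_add pw_poly_integrable pw_poly_intros)

lemma ip_diff_left: "pw_poly f \<Longrightarrow> pw_poly g \<Longrightarrow> pw_poly w \<Longrightarrow> ip (\<lambda>t. f t - g t) w = ip f w - ip g w"
  unfolding ip_def left_diff_distrib by (intro integral_diff pw_poly_integrable pw_poly_intros)

lemma ip_scale_left: "ip (\<lambda>t. c * f t) w = c * ip f w"
  unfolding ip_def mult.assoc by (rule integral_mult_right)

lemma ip_sum_left:
  assumes "finite I" "\<And>i. i \<in> I \<Longrightarrow> pw_poly (f i)" "pw_poly w"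
  shows "ip (\<lambda>t. \<Sum>i\<in>I. c i * f i t) w = (\<Sum>i\<in>I. c i * ip (f i) w)"
  using assms(1,2)
proof (induction I rule: finite_induct)
  case empty
  then show ?case by (simp add: ip_def)
next
  case (insert i I)
  have "ip (\<lambda>t. c i * f i t + (\<Sum>i\<in>I. c i * f i t)) w = ip (\<lambda>t. c i * f i t) w + ip (\<lambda>t. \<Sum>i\<in>I. c i * f i t) w"
    using insert assms(3) by (intro ip_add_left pw_poly_sum pw_poly_mult pw_poly_const) auto
  then show ?case using insert by (simp add: ip_scale_left)
qed

lemma ip_mono:
  assumes "pw_poly f" "pw_poly g" "\<And>t. t \<in> {0..T} \<Longrightarrow> (f t)\<^sup>2 \<le> g t"
  shows "ip f f \<le> integral {0..T} g"
  unfolding ip_def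
  by (intro integral_le pw_poly_integrable pw_poly_intros assms) (use assms(3) in \<open>auto simp: power2_eq_square\<close>)

lemma ip_self_nonneg: "0 \<le> ip f f"
proof (cases "(\<lambda>t. f t * f t) integrable_on {0..T}")
  case True
  then show ?thesis unfolding ip_def by (intro integral_nonneg) auto
qed (simp add: ip_def not_integrable_integral)

lemma ip_self_add:
  assumes "pw_poly f" "pw_poly g"
  shows "ip (\<lambda>t. f t + c * g t) (\<lambda>t. f t + c * g t) = ip f f + 2 * c * ip f g + c\<^sup>2 * ip g g"
proof -
  have "ip (\<lambda>t. f t + c * g t) (\<lambda>t. f t + c * g t) = ip f (\<lambda>t. f t + c * g t) + c * ip g (\<lambda>t. f t + c * g t)"
    using assms by (simp add: ip_add_left ip_scale_left pw_poly_intros)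
  moreover have "ip h (\<lambda>t. f t + c * g t) = ip f h + c * ip g h" if "pw_poly h" for h
    using assms that by (simp add: ip_commute[of h] ip_add_left ip_scale_left pw_poly_intros)
  ultimately show ?thesis using assms by (simp add: ip_commute[of g f] power2_eq_square algebra_simps)
qed

lemma ip_self_add_le:
  assumes "pw_poly f" "pw_poly g"
  shows "ip (\<lambda>t. f t + c * g t) (\<lambda>t. f t + c * g t) \<le> 2 * ip f f + 2 * c\<^sup>2 * ip g g"
  using ip_self_add[OF assms, of c] ip_self_add[OF assms, of "-c"]
    ip_self_nonneg[of "\<lambda>t. f t + - c * g t"] unfolding power2_minus by linarith

lemma ip_young:
  assumes "pw_poly f" "pw_poly g"
  shows "\<bar>2 * c * ip f g\<bar> \<le> ip f f + c\<^sup>2 * ip g g"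
  using ip_self_add[OF assms, of c] ip_self_add[OF assms, of "-c"]
    ip_self_nonneg[of "\<lambda>t. f t + - c * g t"] ip_self_nonneg[of "\<lambda>t. f t + c * g t"]
  unfolding power2_minus by (intro abs_leI; linarith)

text \<open>The Cauchy-Schwarz inequality against the constant 1, obtained from the nonnegative
  variance of \<open>f\<close> about its mean \<open>m\<close>.\<close>

lemma integral_square_le:
  assumes "pw_poly f" "0 \<le> s" "s \<le> t" "t \<le> T"
  shows "(integral {s..t} f)\<^sup>2 \<le> (t - s) * ip f f"
proof (cases "s = t")
  case False
  then have st: "t - s > 0" using assms by simp
  define m where "m = integral {s..t} f / (t - s)"
  have i1: "f integrable_on {s..t}" and i2: "(\<lambda>x. (f x)\<^sup>2) integrable_on {s..t}"
    using assms by (auto intro!: pw_poly_integrable_sub pw_poly_intros)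
  have "0 \<le> integral {s..t} (\<lambda>x. (f x - m)\<^sup>2)"
    using assms by (intro integral_nonneg pw_poly_integrable_sub pw_poly_intros) auto
  also have "(\<lambda>x. (f x - m)\<^sup>2) = (\<lambda>x. ((f x)\<^sup>2 - (2 * m) * f x) + m\<^sup>2)"
    by (simp add: power2_eq_square algebra_simps)
  also have "integral {s..t} (\<lambda>x. ((f x)\<^sup>2 - (2 * m) * f x) + m\<^sup>2)
      = integral {s..t} (\<lambda>x. (f x)\<^sup>2) - 2 * m * integral {s..t} f + m\<^sup>2 * (t - s)"
    using i1 i2 st
    by (subst integral_add) (auto simp: integral_diff integrable_on_mult_right intro!: integrable_diff)
  also have "2 * m * integral {s..t} f = 2 * (m\<^sup>2 * (t - s))"
    using st by (simp add: m_def power2_eq_square)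
  finally have "m\<^sup>2 * (t - s) \<le> integral {s..t} (\<lambda>x. (f x)\<^sup>2)" by (simp add: mult.commute)
  also have "\<dots> \<le> integral {0..T} (\<lambda>x. (f x)\<^sup>2)"
    using assms i2 by (intro integral_subset_le pw_poly_integrable pw_poly_intros) auto
  finally have "(t - s) * (m\<^sup>2 * (t - s)) \<le> (t - s) * integral {0..T} (\<lambda>x. (f x)\<^sup>2)"
    using st by (intro mult_left_mono) auto
  moreover have "(t - s) * (m\<^sup>2 * (t - s)) = (integral {s..t} f)\<^sup>2"
    using st by (simp add: m_def power2_eq_square)
  ultimately show ?thesis by (simp add: ip_def power2_eq_square)
qed simp

text \<open>A function with square integrable derivative is Hoelder continuous with exponent 1/2.
  This is the source of the order of the quasi-interpolant.\<close>

lemma spline_increment: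
  assumes "s \<in> {0..T}" "t \<in> {0..T}"
  shows "(spline (Suc q) x t - spline (Suc q) x s)\<^sup>2
    \<le> \<bar>t - s\<bar> * ip (spline q (diff_coeff q x)) (spline q (diff_coeff q x))"
proof -
  have *: "(spline (Suc q) x t - spline (Suc q) x s)\<^sup>2 \<le> (t - s) * ip (spline q (diff_coeff q x)) (spline q (diff_coeff q x))"
    if "0 \<le> s" "s \<le> t" "t \<le> T" for s t
  proof -
    have "(spline q (diff_coeff q x) has_integral spline (Suc q) x t - spline (Suc q) x s) {s..t}"
      using that by (intro has_integral_derivative_pieces spline_continuous_on spline_has_vector_derivative_open) auto
    then show ?thesis
      using integral_square_le[OF pw_poly_spline[of q "diff_coeff q x"] that] by (simp add: integral_unique)
  qed
  show ?thesis
  proof (cases "s \<le> t")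
    case True
    then show ?thesis using *[of s t] assms by auto
  next
    case False
    then show ?thesis using *[of t s] assms by (auto simp: power2_commute)
  qed
qed

text \<open>A Schoenberg type quasi-interpolant: sampling at grid points near the supports and using a
  partition of unity gives an approximation of order \<open>mesh\<^sup>1\<^sup>/\<^sup>2\<close> in the energy norm.\<close>

definition quasi_interp :: "nat \<Rightarrow> (real \<Rightarrow> real) \<Rightarrow> nat \<Rightarrow> real" where
  "quasi_interp q f j = f (node (min j N))"

text \<open>A B-spline alive at a point of interval \<open>k\<close> has index between
  \<open>k\<close> and \<open>k + q\<close>, so its sampling node is at most
  \<open>(q + 1) * mesh\<close> away; averaging with nonnegative weights of sum 1 keeps the bound.
  The minimum with \<open>N\<close> in the sampling index keeps the node inside the
  interval.\<close>

lemma quasi_interp_error: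
  fixes x :: "nat \<Rightarrow> real" and q :: nat
  assumes "t \<in> {0..<T}"
  defines "E \<equiv> ip (spline q (diff_coeff q x)) (spline q (diff_coeff q x))"
  shows "(spline (Suc q) x t - spline q (quasi_interp q (spline (Suc q) x)) t)\<^sup>2 \<le> real (Suc q) * mesh * E"
proof -
  define U where "U = spline (Suc q) x"
  define M where "M = real (Suc q) * mesh * E"
  have E: "E \<ge> 0" unfolding E_def by (rule ip_self_nonneg)
  then have M: "M \<ge> 0" using mesh_pos by (simp add: M_def)
  obtain k where k: "k < N" "node k \<le> t" "t < node (Suc k)" using piece_cover[of t] assms by auto
  have one: "(\<Sum>j<N + q. bspline T N q j t) = 1" using assms by (intro sum_bspline) auto
  have "\<bar>U t - U (node (min j N))\<bar> * bspline T N q j t \<le> sqrt M * bspline T N q j t" for j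
  proof (cases "bspline T N q j t = 0")
    case False
    then have j: "k \<le> j" "j \<le> k + q" using bspline_support[OF k] by auto
    then have "node k \<le> node (min j N)" "node (min j N) \<le> node (k + q)" using k by (auto intro!: node_mono)
    moreover have "node (k + q) = node k + real q * mesh" by (simp add: node_eq algebra_simps)
    moreover have "0 \<le> real q * mesh" using mesh_pos by simp
    ultimately have d: "\<bar>t - node (min j N)\<bar> \<le> real (Suc q) * mesh"
      using k(2,3) mesh_pos unfolding node_Suc of_nat_Suc distrib_right mult_1 by linarith
    have "(U t - U (node (min j N)))\<^sup>2 \<le> \<bar>t - node (min j N)\<bar> * E"
      unfolding U_def E_def using assms node_nonneg node_le_T by (intro spline_increment) auto
    also have "\<dots> \<le> M" unfolding M_def using d E by (intro mult_right_mono)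
    finally have "\<bar>U t - U (node (min j N))\<bar> \<le> sqrt M" by (simp add: real_le_rsqrt)
    then show ?thesis using bspline_nonneg[of t] assms by (intro mult_right_mono) auto
  qed simp
  then have "(\<Sum>j<N + q. \<bar>U t - U (node (min j N))\<bar> * bspline T N q j t) \<le> (\<Sum>j<N + q. sqrt M * bspline T N q j t)"
    by (intro sum_mono)
  then have b: "(\<Sum>j<N + q. \<bar>U t - U (node (min j N))\<bar> * bspline T N q j t) \<le> sqrt M"
    by (simp add: sum_distrib_left[symmetric] one)
  have "U t - spline q (quasi_interp q U) t = (\<Sum>j<N + q. (U t - U (node (min j N))) * bspline T N q j t)"
    by (simp add: spline_def quasi_interp_def left_diff_distrib sum_subtractf sum_distrib_left[symmetric] one)
  also have "\<bar>\<dots>\<bar> \<le> (\<Sum>j<N + q. \<bar>U t - U (node (min j N))\<bar> * bspline T N q j t)"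
    using bspline_nonneg[of t] assms by (intro order.trans[OF sum_abs]) (auto simp: abs_mult)
  finally have "\<bar>U t - spline q (quasi_interp q U) t\<bar> \<le> sqrt M" using b by linarith
  then have "(U t - spline q (quasi_interp q U) t)\<^sup>2 \<le> (sqrt M)\<^sup>2"
    using power_mono[of "\<bar>U t - spline q (quasi_interp q U) t\<bar>" "sqrt M" 2] by simp
  then show ?thesis using M by (simp add: U_def M_def)
qed

lemma quasi_interp_ip:
  fixes x :: "nat \<Rightarrow> real" and q :: nat
  defines "E \<equiv> ip (spline q (diff_coeff q x)) (spline q (diff_coeff q x))"
  defines "r \<equiv> (\<lambda>t. spline (Suc q) x t - spline q (quasi_interp q (spline (Suc q) x)) t)"
  shows "ip r r \<le> T * (real (Suc q) * mesh) * E"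
proof -
  \<comment> \<open>The pointwise bound is available only to the left of T, so the error is set to 0
    at this single point.\<close>
  define r' where "r' t = (if t = T then 0 else r t)" for t
  have pr: "pw_poly r" unfolding r_def by (intro pw_poly_intros)
  have eq: "r' t = r t" if "k < N" "t \<in> {node k<..<node (Suc k)}" for k t
    using that node_le_T[of "Suc k"] by (auto simp: r'_def)
  have pr': "pw_poly r'" by (rule pw_poly_cong[OF pr eq])
  have "ip r r = ip r' r'" unfolding ip_def by (intro integral_cong_pieces) (simp add: eq)
  also have "\<dots> \<le> integral {0..T} (\<lambda>t. real (Suc q) * mesh * E)"
  proof (rule ip_mono[OF pr' pw_poly_const])
    fix t assume "t \<in> {0..T}"
    moreover have "0 \<le> real (Suc q) * mesh * E"
      unfolding E_def using ip_self_nonneg mesh_pos by (intro mult_nonneg_nonneg) auto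
    ultimately show "(r' t)\<^sup>2 \<le> real (Suc q) * mesh * E"
      using quasi_interp_error[of t q x] by (auto simp: r'_def r_def E_def)
  qed
  also have "\<dots> = T * (real (Suc q) * mesh) * E" using T_pos by (simp add: mult_ac)
  finally show ?thesis .
qed

lemma spline_add: "spline q a t + spline q b t = spline q (\<lambda>j. a j + b j) t"
  by (simp add: spline_def distrib_right sum.distrib)

lemma spline_scale: "c * spline q a t = spline q (\<lambda>j. c * a j) t"
  by (simp add: spline_def sum_distrib_left mult.assoc)

text \<open>Testing with the spline \<open>v + \<alpha> Q\<close>, where \<open>Q\<close> is the quasi-interpolant of \<open>U\<close>.\<close>

lemma residual_estimate:
  fixes x z :: "nat \<Rightarrow> real" and q :: nat and \<alpha> \<Lambda> :: real
  defines "U \<equiv> spline (Suc q) x" and "v \<equiv> spline q (diff_coeff q z)"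
  defines "A \<equiv> ip (spline q (diff_coeff q x)) (spline q (diff_coeff q x))"
  assumes test: "\<And>b. (ip (\<lambda>t. v t + \<alpha> * U t) (spline q b))\<^sup>2 \<le> \<Lambda> * ip (spline q b) (spline q b)"
    and \<Lambda>: "\<Lambda> \<ge> 0"
  shows "ip (\<lambda>t. v t + \<alpha> * U t) (\<lambda>t. v t + \<alpha> * U t) \<le> 4 * \<Lambda> + 6 * \<alpha>\<^sup>2 * (T * (real (Suc q) * mesh) * A)"
proof -
  define Q where "Q = spline q (quasi_interp q U)"
  define b where "b j = diff_coeff q z j + \<alpha> * quasi_interp q U j" for j
  define W where "W = spline q b"
  define r where "r t = U t - Q t" for t
  define g where "g t = v t + \<alpha> * U t" for t
  have pw: "pw_poly Q" "pw_poly W" "pw_poly U" "pw_poly v"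
    by (simp_all add: Q_def W_def U_def v_def pw_poly_spline)
  have pr: "pw_poly r" "pw_poly g" unfolding r_def g_def using pw by (auto intro!: pw_poly_intros)
  have W: "W t = v t + \<alpha> * Q t" for t
    by (simp add: W_def v_def Q_def spline_scale spline_add b_def[abs_def])
  have Wg: "W = (\<lambda>t. g t - \<alpha> * r t)" by (auto simp: W g_def r_def algebra_simps)
  have "ip r r \<le> T * (real (Suc q) * mesh) * A"
    unfolding r_def Q_def U_def A_def by (rule quasi_interp_ip)
  then have r: "\<alpha>\<^sup>2 * ip r r \<le> \<alpha>\<^sup>2 * (T * (real (Suc q) * mesh) * A)" by (intro mult_left_mono) auto
  have WW: "ip W W = ip g W - \<alpha> * ip r W"
    by (subst (1) Wg) (use pw pr in \<open>simp add: ip_diff_left ip_scale_left pw_poly_intros\<close>)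
  \<comment> \<open>Both terms of \<open>WW\<close> are split by Young's inequality with weight 1/4,
    which leaves half of \<open>ip W W\<close> to be absorbed. The return from \<open>W\<close> to
    \<open>g\<close> then doubles and yields the constants 4 and 6.\<close>
  have "\<bar>ip g W\<bar> \<le> \<Lambda> + ip W W / 4"
  proof -
    have "(ip g W)\<^sup>2 \<le> \<Lambda> * ip W W" using test[of b] by (simp add: g_def[abs_def] W_def)
    also have "\<dots> \<le> (\<Lambda> + ip W W / 4)\<^sup>2"
      using zero_le_power2[of "\<Lambda> - ip W W / 4"] by (simp add: power2_eq_square algebra_simps)
    finally have "(ip g W)\<^sup>2 \<le> (\<Lambda> + ip W W / 4)\<^sup>2" .
    then have "\<bar>ip g W\<bar> \<le> \<bar>\<Lambda> + ip W W / 4\<bar>" by (simp only: abs_le_square_iff)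
    then show ?thesis using \<Lambda> ip_self_nonneg[of W] by simp
  qed
  moreover have "\<bar>\<alpha> * ip r W\<bar> \<le> \<alpha>\<^sup>2 * ip r r + ip W W / 4"
    using ip_young[OF pw(2) pr(1), of "2 * \<alpha>"] by (simp add: ip_commute[of r W] power_mult_distrib)
  ultimately have "ip W W \<le> 2 * \<Lambda> + 2 * (\<alpha>\<^sup>2 * ip r r)" using WW by linarith
  moreover have "ip g g \<le> 2 * ip W W + 2 * \<alpha>\<^sup>2 * ip r r"
  proof -
    have "g = (\<lambda>t. W t + \<alpha> * r t)" by (auto simp: Wg)
    then show ?thesis using ip_self_add_le[OF pw(2) pr(1), of \<alpha>] by simp
  qed
  ultimately have "ip g g \<le> 4 * \<Lambda> + 6 * (\<alpha>\<^sup>2 * ip r r)" by simp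
  also have "\<dots> \<le> 4 * \<Lambda> + 6 * (\<alpha>\<^sup>2 * (T * (real (Suc q) * mesh) * A))" using r by simp
  finally show ?thesis by (simp add: g_def[abs_def] mult.assoc)
qed

text \<open>With the residuals \<open>g1\<close> and \<open>g2\<close> the derivative of
  \<open>U^2 + V^2\<close> is \<open>2 U g2 + 2 V g1\<close>, as the \<alpha>-terms cancel. The
  residuals thus control \<open>U\<close> and \<open>V\<close>, and through their definitions also
  \<open>u\<close> and \<open>v\<close>. Conversely the residuals are bounded by \<Lambda> plus a
  multiple of the mesh times the energies of \<open>U\<close> and \<open>V\<close>;
  \<open>small\<close> lets the left-hand side absorb the latter.\<close>

lemma energy_estimate:
  fixes x z :: "nat \<Rightarrow> real" and q :: nat and \<alpha> \<Lambda> :: real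
  defines "U \<equiv> spline (Suc q) x" and "V \<equiv> spline (Suc q) z"
  defines "u \<equiv> spline q (diff_coeff q x)" and "v \<equiv> spline q (diff_coeff q z)"
  defines "L \<equiv> 2 + 8 * \<alpha>\<^sup>2 * T\<^sup>2"
  assumes init: "x 0 = 0" "z 0 = 0"
    and test1: "\<And>b. ip (\<lambda>t. v t + \<alpha> * U t) (spline q b) = 0"
    and test2: "\<And>b. (ip (\<lambda>t. u t + - \<alpha> * V t) (spline q b))\<^sup>2 \<le> \<Lambda> * ip (spline q b) (spline q b)"
    and \<Lambda>: "\<Lambda> \<ge> 0"
    and small: "12 * L * \<alpha>\<^sup>2 * (T * (real (Suc q) * mesh)) \<le> 1"
  shows "ip u u \<le> 8 * L * \<Lambda>"
proof -
  define m where "m = T * (real (Suc q) * mesh)"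
  define g1 where "g1 t = v t + \<alpha> * U t" for t
  define g2 where "g2 t = u t + - \<alpha> * V t" for t
  define G where "G = ip g1 g1 + ip g2 g2"
  define E where "E t = (U t)\<^sup>2 + (V t)\<^sup>2" for t
  define Eint where "Eint = integral {0..T} E"
  have pw: "pw_poly U" "pw_poly V" "pw_poly u" "pw_poly v"
    by (simp_all add: U_def V_def u_def v_def pw_poly_spline)
  have pg: "pw_poly g1" "pw_poly g2" "pw_poly E"
    unfolding g1_def g2_def E_def by (intro pw_poly_intros pw)+
  have L: "L \<ge> 2" by (simp add: L_def)
  have "ip g1 g1 \<le> 4 * 0 + 6 * \<alpha>\<^sup>2 * (m * ip u u)"
    unfolding g1_def[abs_def] m_def u_def U_def v_def
    by (rule residual_estimate) (use test1 in \<open>auto simp: U_def v_def\<close>)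
  moreover have "ip g2 g2 \<le> 4 * \<Lambda> + 6 * (- \<alpha>)\<^sup>2 * (m * ip v v)"
    unfolding g2_def[abs_def] m_def u_def V_def v_def
    by (rule residual_estimate) (use test2 \<Lambda> in \<open>auto simp: V_def u_def\<close>)
  ultimately have G: "G \<le> 4 * \<Lambda> + 6 * \<alpha>\<^sup>2 * m * (ip u u + ip v v)"
    unfolding G_def by (simp add: algebra_simps)
  have Ebound: "E t \<le> Eint / (2 * T) + 2 * T * G" if t: "t \<in> {0..T}" for t
  proof -
    define D where "D t = (U t * u t + u t * U t) + (V t * v t + v t * V t)" for t
    define R where "R t = (1 / (2 * T)) * E t + (2 * T) * ((g1 t)\<^sup>2 + (g2 t)\<^sup>2)" for t
    have pD: "pw_poly D" "pw_poly R" unfolding D_def R_def by (intro pw_poly_intros pw pg)+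
    have "(D has_integral E t - E 0) {0..t}"
    proof (rule has_integral_derivative_pieces)
      show "continuous_on {0..T} E"
        unfolding E_def U_def V_def by (intro continuous_intros spline_continuous_on) auto
      fix k t assume k: "k < N" "t \<in> {node k<..<node (Suc k)}"
      show "(E has_vector_derivative D t) (at t)"
        unfolding E_def D_def power2_eq_square U_def V_def u_def v_def
        by (intro has_vector_derivative_add has_vector_derivative_mult spline_has_vector_derivative_open[OF k])
    qed (use t in auto)
    moreover have "E 0 = 0" by (simp add: E_def U_def V_def spline_at_0 init)
    ultimately have "E t = integral {0..t} D" by (simp add: integral_unique)
    also have "\<dots> \<le> integral {0..t} R"
    proof (rule integral_le)
      fix s
      \<comment> \<open>The weight \<open>2 * T\<close> makes the integral of the resulting bound
        over the whole interval contain only half of \<open>Eint\<close>. This absorption takes the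
        place of Gronwall's inequality.\<close>
      have y: "2 * a * b \<le> (1 / (2 * T)) * a\<^sup>2 + (2 * T) * b\<^sup>2" for a b :: real
      proof -
        have "0 \<le> (1 / (2 * T)) * (a - 2 * T * b)\<^sup>2" using T_pos by simp
        also have "\<dots> = (1 / (2 * T)) * a\<^sup>2 + (2 * T) * b\<^sup>2 - 2 * a * b"
          using T_pos by (simp add: power2_eq_square field_simps)
        finally show ?thesis by simp
      qed
      have "D s = 2 * U s * g2 s + 2 * V s * g1 s" by (simp add: D_def g1_def g2_def algebra_simps)
      also have "\<dots> \<le> R s" using y[of "U s" "g2 s"] y[of "V s" "g1 s"]
        unfolding R_def E_def distrib_left by linarith
      finally show "D s \<le> R s" .
    qed (use t pD in \<open>auto intro: pw_poly_integrable_sub\<close>)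
    also have "\<dots> \<le> integral {0..T} R"
    proof (rule integral_subset_le)
      show "\<forall>s\<in>{0..T}. 0 \<le> R s" using T_pos by (simp add: R_def E_def)
    qed (use t pD in \<open>auto intro: pw_poly_integrable_sub pw_poly_integrable\<close>)
    also have "integral {0..T} R = integral {0..T} (\<lambda>t. (1 / (2 * T)) * E t)
        + integral {0..T} (\<lambda>t. (2 * T) * ((g1 t)\<^sup>2 + (g2 t)\<^sup>2))"
      unfolding R_def by (intro integral_add pw_poly_integrable pw_poly_intros pg)
    also have "\<dots> = (1 / (2 * T)) * Eint + (2 * T) * integral {0..T} (\<lambda>t. (g1 t)\<^sup>2 + (g2 t)\<^sup>2)"
      unfolding Eint_def integral_mult_right ..
    also have "integral {0..T} (\<lambda>t. (g1 t)\<^sup>2 + (g2 t)\<^sup>2) = G"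
      unfolding G_def ip_def power2_eq_square using pg
      by (intro integral_add pw_poly_integrable pw_poly_intros)
    finally show ?thesis by simp
  qed
  have "Eint \<le> integral {0..T} (\<lambda>t. Eint / (2 * T) + 2 * T * G)"
    unfolding Eint_def[symmetric] by (subst (1) Eint_def, intro integral_le pw_poly_integrable pg pw_poly_const Ebound)
  also have "\<dots> = Eint / 2 + 2 * T\<^sup>2 * G" using T_pos by (simp add: field_simps power2_eq_square)
  finally have Eint: "Eint \<le> 4 * T\<^sup>2 * G" by simp
  have "Eint = ip U U + ip V V"
    unfolding Eint_def E_def ip_def power2_eq_square using pw
    by (intro integral_add pw_poly_integrable pw_poly_intros)
  moreover have "ip u u \<le> 2 * ip g2 g2 + 2 * \<alpha>\<^sup>2 * ip V V"
    using ip_self_add_le[OF pg(2) pw(2), of \<alpha>] by (simp add: g2_def[abs_def])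
  moreover have "ip v v \<le> 2 * ip g1 g1 + 2 * \<alpha>\<^sup>2 * ip U U"
    using ip_self_add_le[OF pg(1) pw(1), of "- \<alpha>"] by (simp add: g1_def[abs_def])
  ultimately have "ip u u + ip v v \<le> 2 * G + 2 * \<alpha>\<^sup>2 * Eint"
    by (simp add: G_def algebra_simps)
  also have "2 * \<alpha>\<^sup>2 * Eint \<le> 2 * \<alpha>\<^sup>2 * (4 * T\<^sup>2 * G)" using Eint by (intro mult_left_mono) auto
  \<comment> \<open>The origin of \<open>L\<close>: the 2 is the residual part, the rest is the
    bound \<open>4 * T^2 * G\<close> for \<open>Eint\<close> times
    \<open>2 * \<alpha>^2\<close>.\<close>
  also have "2 * G + 2 * \<alpha>\<^sup>2 * (4 * T\<^sup>2 * G) = L * G" by (simp add: L_def algebra_simps)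
  also have "\<dots> \<le> L * (4 * \<Lambda> + 6 * \<alpha>\<^sup>2 * m * (ip u u + ip v v))" using G L by (intro mult_left_mono) auto
  also have "\<dots> = 4 * L * \<Lambda> + (12 * L * \<alpha>\<^sup>2 * m) * ((ip u u + ip v v) / 2)" by (simp add: algebra_simps)
  also have "(12 * L * \<alpha>\<^sup>2 * m) * ((ip u u + ip v v) / 2) \<le> 1 * ((ip u u + ip v v) / 2)"
    using small ip_self_nonneg[of u] ip_self_nonneg[of v] unfolding m_def by (intro mult_right_mono) auto
  finally have "ip u u + ip v v \<le> 4 * L * \<Lambda> + (ip u u + ip v v) / 2" by simp
  moreover have "s \<le> 8 * w" if "s \<le> 4 * w + s / 2" for s w :: real using that by linarith
  ultimately have "ip u u + ip v v \<le> 8 * L * \<Lambda>" by (simp only: mult.assoc)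
  then show ?thesis using ip_self_nonneg[of v] by linarith
qed

text \<open>The boundary terms vanish because the first coefficient is the value at 0 and the last
  one, with index \<open>N + q\<close>, is the value at T.\<close>

lemma integration_by_parts:
  assumes "x 0 = 0" "a (N + q) = 0"
  shows "ip (spline q (diff_coeff q x)) (spline (Suc q) a) = - ip (spline (Suc q) x) (spline q (diff_coeff q a))"
proof -
  let ?U = "spline (Suc q) x" and ?u = "spline q (diff_coeff q x)"
  let ?X = "spline (Suc q) a" and ?X' = "spline q (diff_coeff q a)"
  have "((\<lambda>t. ?U t * ?X' t + ?u t * ?X t) has_integral (?U T * ?X T - ?U 0 * ?X 0)) {0..T}"
  proof (rule has_integral_derivative_pieces)
    show "continuous_on {0..T} (\<lambda>t. ?U t * ?X t)" by (intro continuous_intros spline_continuous_on) auto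
  qed (use T_pos in \<open>auto intro!: has_vector_derivative_mult spline_has_vector_derivative_open\<close>)
  moreover have "?X T = 0" "?U 0 = 0" using assms by (simp_all add: spline_at_T spline_at_0)
  ultimately have "integral {0..T} (\<lambda>t. ?U t * ?X' t + ?u t * ?X t) = 0" by (simp add: integral_unique)
  moreover have "integral {0..T} (\<lambda>t. ?U t * ?X' t + ?u t * ?X t) = ip ?U ?X' + ip ?u ?X"
    unfolding ip_def by (intro integral_add pw_poly_integrable pw_poly_intros)
  ultimately show ?thesis by simp
qed

end

section \<open>The matrices of the discrete formulation\<close>

context time_grid
begin

definition unit_coeff :: "nat \<Rightarrow> nat \<Rightarrow> real" where
  "unit_coeff j i = (if i = j then 1 else 0)"

lemma bspline_eq_spline: "j < N + q \<Longrightarrow> bspline T N q j = spline q (unit_coeff j)"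
  by (simp add: spline_def unit_coeff_def fun_eq_iff if_distrib[of "\<lambda>x. x * _"] cong: if_cong)

lemma spline_diff_coeff_sum:
  "spline q (diff_coeff q x) t = (\<Sum>j<N + Suc q. x j * spline q (diff_coeff q (unit_coeff j)) t)"
proof -
  have "diff_coeff q x i = (\<Sum>j<N + Suc q. x j * diff_coeff q (unit_coeff j) i)" if "i < N + q" for i
  proof -
    have "(\<Sum>j<N + Suc q. x j * diff_coeff q (unit_coeff j) i)
      = (\<Sum>j<N + Suc q. real (Suc q) / knot_span q i * ((if j = Suc i then x j else 0) - (if j = i then x j else 0)))"
      by (intro sum.cong) (auto simp: diff_coeff_def unit_coeff_def)
    also have "\<dots> = real (Suc q) / knot_span q i * (x (Suc i) - x i)"
      using that unfolding sum_distrib_left[symmetric] sum_subtractf by (simp del: sum.lessThan_Suc of_nat_Suc)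
    finally show ?thesis by (simp add: diff_coeff_def del: sum.lessThan_Suc)
  qed
  then have "spline q (diff_coeff q x) t = (\<Sum>i<N + q. (\<Sum>j<N + Suc q. x j * diff_coeff q (unit_coeff j) i) * bspline T N q i t)"
    unfolding spline_def by (intro sum.cong) auto
  also have "\<dots> = (\<Sum>j<N + Suc q. x j * spline q (diff_coeff q (unit_coeff j)) t)"
    unfolding spline_def sum_distrib_left sum_distrib_right
    by (subst sum.swap) (auto simp: mult_ac intro!: sum.cong)
  finally show ?thesis .
qed

lemma dt_spline:
  assumes "k < N" "t \<in> {node k<..<node (Suc k)}"
  shows "dt (spline (Suc q) a) t = spline q (diff_coeff q a) t"
  unfolding dt_def using spline_has_vector_derivative_open[OF assms] by (rule vector_derivative_at)

lemma real_inner_J_eq_ip: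
  assumes "pw_poly f'" "pw_poly g'"
    and "\<And>k t. k < N \<Longrightarrow> t \<in> {node k<..<node (Suc k)} \<Longrightarrow> f t = f' t"
    and "\<And>k t. k < N \<Longrightarrow> t \<in> {node k<..<node (Suc k)} \<Longrightarrow> g t = g' t"
  shows "real_inner_J T f g = ip f' g'"
proof -
  have "pw_poly (\<lambda>t. f t * g t)"
    using assms by (intro pw_poly_mult pw_poly_cong[of f' f] pw_poly_cong[of g' g])
  then have "real_inner_J T f g = integral {0..T} (\<lambda>t. f t * g t)"
    unfolding real_inner_J_def by (rule pw_poly_lebesgue_integral)
  also have "\<dots> = ip f' g'" unfolding ip_def by (intro integral_cong_pieces) (simp add: assms)
  finally show ?thesis .
qed

text \<open>Trial functions omit the first B-spline and test functions the last one, hence padding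
  by 0 in front with a shift here and at the end without a shift below. The splines vanish at 0 and
  at T respectively.\<close>

definition trial_coeff :: "real Matrix.vec \<Rightarrow> nat \<Rightarrow> real" where
  "trial_coeff x j = (if j = 0 then 0 else x $ (j - 1))"

definition test_coeff :: "real Matrix.vec \<Rightarrow> nat \<Rightarrow> real" where
  "test_coeff a j = (if j < dim_vec a then a $ j else 0)"

lemma B_mat_carrier: "B_mat T N (Suc q) \<in> carrier_mat (N + q) (N + q)"
  by (simp add: B_mat_def)

lemma C_mat_carrier: "C_mat T N (Suc q) \<in> carrier_mat (N + q) (N + q)"
  by (simp add: C_mat_def)

lemma bilinear_matrix_form:
  assumes "x \<in> carrier_vec n" "a \<in> carrier_vec n" "\<And>j. pw_poly (f j)" "\<And>j. pw_poly (g j)"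
    and M: "M = Matrix.mat n n (\<lambda>(r, c). ip (f (c + 1)) (g r))"
  shows "scalar_prod a (M *\<^sub>v x) = ip (\<lambda>t. \<Sum>j<Suc n. trial_coeff x j * f j t) (\<lambda>t. \<Sum>j<Suc n. test_coeff a j * g j t)"
proof -
  have w: "(M *\<^sub>v x) $ r = (\<Sum>c<n. ip (f (c + 1)) (g r) * x $ c)" if "r < n" for r
    using that assms(1) by (simp add: M scalar_prod_def atLeast0LessThan)
  have "scalar_prod a (M *\<^sub>v x) = (\<Sum>r<n. a $ r * (\<Sum>c<n. ip (f (c + 1)) (g r) * x $ c))"
    using assms(2) w by (simp add: scalar_prod_def M atLeast0LessThan)
  also have "\<dots> = (\<Sum>r<Suc n. test_coeff a r * ip (\<lambda>t. \<Sum>j<Suc n. trial_coeff x j * f j t) (g r))"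
  proof -
    have "(\<Sum>c<n. ip (f (c + 1)) (g r) * x $ c) = ip (\<lambda>t. \<Sum>j<Suc n. trial_coeff x j * f j t) (g r)" for r
      using assms(3,4) by (subst ip_sum_left, simp_all only: sum.lessThan_Suc_shift finite_lessThan)
        (auto simp: trial_coeff_def mult.commute)
    then show ?thesis using assms(2) by (auto simp: test_coeff_def intro!: sum.cong)
  qed
  also have "\<dots> = ip (\<lambda>t. \<Sum>j<Suc n. test_coeff a j * g j t) (\<lambda>t. \<Sum>j<Suc n. trial_coeff x j * f j t)"
    using assms(3,4)
    by (subst ip_sum_left) (auto simp del: sum.lessThan_Suc simp: ip_commute[of "g _"] intro!: pw_poly_sum pw_poly_mult pw_poly_const)
  finally show ?thesis by (simp only: ip_commute)
qed

lemma B_mat_form: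
  assumes "x \<in> carrier_vec (N + q)" "a \<in> carrier_vec (N + q)"
  shows "scalar_prod a (B_mat T N (Suc q) *\<^sub>v x) =
    ip (spline q (diff_coeff q (trial_coeff x))) (spline q (diff_coeff q (test_coeff a)))"
proof -
  define f where "f j = spline q (diff_coeff q (unit_coeff j))" for j
  have "B_mat T N (Suc q) = Matrix.mat (N + q) (N + q) (\<lambda>(r, c). ip (f (c + 1)) (f r))"
    unfolding B_mat_def
    by (intro cong_mat) (auto simp: f_def dt_spline bspline_eq_spline pw_poly_spline intro!: real_inner_J_eq_ip)
  from bilinear_matrix_form[OF assms _ _ this] show ?thesis
    unfolding f_def spline_diff_coeff_sum[of q "trial_coeff x", abs_def]
      spline_diff_coeff_sum[of q "test_coeff a", abs_def]
    by (simp add: pw_poly_spline del: sum.lessThan_Suc)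
qed

lemma C_mat_form:
  assumes "x \<in> carrier_vec (N + q)" "a \<in> carrier_vec (N + q)"
  shows "scalar_prod a (C_mat T N (Suc q) *\<^sub>v x) =
    ip (spline q (diff_coeff q (trial_coeff x))) (spline (Suc q) (test_coeff a))"
proof -
  define f where "f j = spline q (diff_coeff q (unit_coeff j))" for j
  define g where "g j = spline (Suc q) (unit_coeff j)" for j
  have "C_mat T N (Suc q) = Matrix.mat (N + q) (N + q) (\<lambda>(r, c). ip (f (c + 1)) (g r))"
    unfolding C_mat_def
    by (intro cong_mat) (auto simp: f_def g_def dt_spline bspline_eq_spline pw_poly_spline intro!: real_inner_J_eq_ip)
  moreover have "(\<Sum>j<N + Suc q. test_coeff a j * g j t) = spline (Suc q) (test_coeff a) t" for t
    unfolding g_def spline_def[of "Suc q" "test_coeff a"]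
    by (intro sum.cong refl) (subst bspline_eq_spline[symmetric], auto)
  ultimately show ?thesis
    using bilinear_matrix_form[OF assms, of f g "C_mat T N (Suc q)"]
    unfolding f_def spline_diff_coeff_sum[of q "trial_coeff x", abs_def]
    by (simp add: pw_poly_spline g_def del: sum.lessThan_Suc)
qed

text \<open>Subtracting the last coefficient from a discrete antiderivative makes it vanish at T
  without changing its derivative. So derivatives of test functions exhaust the splines of degree
  \<open>q\<close>.\<close>

lemma test_coeff_surj:
  "\<exists>a\<in>carrier_vec (N + q). spline q (diff_coeff q (test_coeff a)) = spline q b"
proof -
  obtain c where c: "\<forall>i<N + q. diff_coeff q c i = b i" using diff_coeff_surj by metis
  define a where "a = Matrix.vec (N + q) (\<lambda>j. c j - c (N + q))"
  have "test_coeff a j = c j - c (N + q)" if "j \<le> N + q" for j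
    using that by (auto simp: test_coeff_def a_def)
  then have "diff_coeff q (test_coeff a) i = b i" if "i < N + q" for i
    using that c by (simp add: diff_coeff_def)
  then have "spline q (diff_coeff q (test_coeff a)) = spline q b" by (rule spline_cong)
  moreover have "a \<in> carrier_vec (N + q)" by (simp add: a_def)
  ultimately show ?thesis by blast
qed

text \<open>A Friedrichs inequality, applied with \<open>s\<close> at the left end for trial
  functions and at the right end for test functions.\<close>

lemma spline_square_le:
  assumes "s \<in> {0..T}" "t \<in> {0..T}" "spline (Suc q) x s = 0"
  shows "(spline (Suc q) x t)\<^sup>2 \<le> T * ip (spline q (diff_coeff q x)) (spline q (diff_coeff q x))"
proof -
  have "(spline (Suc q) x t)\<^sup>2 \<le> \<bar>t - s\<bar> * ip (spline q (diff_coeff q x)) (spline q (diff_coeff q x))"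
    using spline_increment[OF assms(1,2), of q x] assms(3) by simp
  also have "\<dots> \<le> T * ip (spline q (diff_coeff q x)) (spline q (diff_coeff q x))"
    using assms by (intro mult_right_mono ip_self_nonneg) auto
  finally show ?thesis .
qed

end

section \<open>Coefficient vectors versus energy norms\<close>

locale stable_time_grid = time_grid +
  fixes q :: nat and K :: real
  assumes K_nonneg: "K \<ge> 0"
    and coeff_bound: "\<And>a M j. (\<forall>t\<in>{0..<T}. \<bar>spline (Suc q) a t\<bar> \<le> M) \<Longrightarrow> j < N + Suc q \<Longrightarrow> \<bar>a j\<bar> \<le> K * M"
begin

text \<open>The loss in passing from the squared energy norm to the squared Euclidean norm of the
  coefficients: \<open>K\<close> comes from the supremum norm, \<open>T\<close> from Friedrichs,
  \<open>N + q\<close> from the number of coefficients.\<close>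

definition stab :: real where "stab = real (N + q) * (K\<^sup>2 * T)"

lemma stab_nonneg: "stab \<ge> 0"
  using T_pos by (simp add: stab_def)

lemma coeff_square_le:
  assumes "s \<in> {0..T}" "spline (Suc q) a s = 0" "j < N + Suc q"
  shows "(a j)\<^sup>2 \<le> K\<^sup>2 * T * ip (spline q (diff_coeff q a)) (spline q (diff_coeff q a))"
proof -
  define E where "E = T * ip (spline q (diff_coeff q a)) (spline q (diff_coeff q a))"
  have E: "E \<ge> 0" using T_pos ip_self_nonneg by (simp add: E_def)
  have "\<forall>t\<in>{0..<T}. \<bar>spline (Suc q) a t\<bar> \<le> sqrt E"
    using spline_square_le[OF assms(1) _ assms(2)] by (auto simp: E_def intro!: real_le_rsqrt)
  then have "\<bar>a j\<bar> \<le> K * sqrt E" using coeff_bound assms(3) by blast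
  then have "\<bar>a j\<bar>\<^sup>2 \<le> (K * sqrt E)\<^sup>2" by (intro power_mono) auto
  then show ?thesis using E by (simp add: power_mult_distrib E_def mult.assoc)
qed

lemma trial_bound:
  assumes "x \<in> carrier_vec (N + q)"
  defines "u \<equiv> spline q (diff_coeff q (trial_coeff x))"
  shows "scalar_prod x x \<le> stab * ip u u"
proof -
  have "scalar_prod x x = (\<Sum>i<N + q. (trial_coeff x (Suc i))\<^sup>2)"
    using assms(1) by (simp add: scalar_prod_def trial_coeff_def power2_eq_square atLeast0LessThan)
  also have "\<dots> \<le> (\<Sum>i<N + q. K\<^sup>2 * T * ip u u)"
    unfolding u_def using T_pos
    by (intro sum_mono coeff_square_le[of 0]) (auto simp: spline_at_0 trial_coeff_def)
  finally show ?thesis by (simp add: stab_def mult_ac)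
qed

lemma test_bound:
  assumes "a \<in> carrier_vec (N + q)"
  defines "w \<equiv> spline q (diff_coeff q (test_coeff a))"
  shows "scalar_prod a a \<le> stab * ip w w"
proof -
  have "scalar_prod a a = (\<Sum>i<N + q. (test_coeff a i)\<^sup>2)"
    using assms(1) by (simp add: scalar_prod_def test_coeff_def power2_eq_square atLeast0LessThan)
  also have "\<dots> \<le> (\<Sum>i<N + q. K\<^sup>2 * T * ip w w)"
    unfolding w_def using T_pos assms(1)
    by (intro sum_mono coeff_square_le[of T]) (auto simp: spline_at_T test_coeff_def)
  finally show ?thesis by (simp add: stab_def mult_ac)
qed

text \<open>A right-hand side \<open>y\<close> acts as a functional on the derivatives
  \<open>w\<close> of the test functions. This is its squared norm, the \<Lambda> of the energy
  estimate.\<close>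

lemma load_bound:
  assumes "a \<in> carrier_vec (N + q)" "y \<in> carrier_vec (N + q)"
  defines "w \<equiv> spline q (diff_coeff q (test_coeff a))"
  shows "(scalar_prod a y)\<^sup>2 \<le> stab * scalar_prod y y * ip w w"
proof -
  have "(scalar_prod a y)\<^sup>2 \<le> scalar_prod a a * scalar_prod y y" using assms by (intro scalar_prod_Cauchy_Schwarz)
  also have "\<dots> \<le> (stab * ip w w) * scalar_prod y y"
    unfolding w_def using assms by (intro mult_right_mono test_bound scalar_prod_self_nonneg)
  finally show ?thesis by (simp add: mult_ac)
qed

text \<open>Some test function has the same derivative as the trial function; pairing with it turns
  \<open>B\<close> into the energy \<open>ip u u\<close>.\<close>

lemma B_mat_lower_bound:
  assumes x: "x \<in> carrier_vec (N + q)"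
  defines "y \<equiv> B_mat T N (Suc q) *\<^sub>v x"
  shows "scalar_prod x x \<le> stab\<^sup>2 * scalar_prod y y"
proof -
  define u where "u = spline q (diff_coeff q (trial_coeff x))"
  have y: "y \<in> carrier_vec (N + q)" unfolding y_def using B_mat_carrier x by (rule mult_mat_vec_carrier)
  obtain a where a: "a \<in> carrier_vec (N + q)" "spline q (diff_coeff q (test_coeff a)) = u"
    using test_coeff_surj[of q "diff_coeff q (trial_coeff x)"] unfolding u_def by blast
  have Y: "stab * scalar_prod y y \<ge> 0" using stab_nonneg scalar_prod_self_nonneg by simp
  have "(ip u u)\<^sup>2 \<le> stab * scalar_prod y y * ip u u"
    using load_bound[OF a(1) y] B_mat_form[OF x a(1)] unfolding y_def a(2) u_def[symmetric] by simp
  then have "ip u u \<le> stab * scalar_prod y y"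
    using ip_self_nonneg[of u] Y by (cases "ip u u = 0") (simp_all add: power2_eq_square)
  then have "stab * ip u u \<le> stab * (stab * scalar_prod y y)" using stab_nonneg by (intro mult_left_mono)
  with trial_bound[OF x] show ?thesis unfolding u_def by (simp add: power2_eq_square mult.assoc)
qed

context
  fixes x y z :: "real Matrix.vec" and \<mu> \<alpha> :: real
  assumes x: "x \<in> carrier_vec (N + q)" and z: "z \<in> carrier_vec (N + q)"
    and zx: "B_mat T N (Suc q) *\<^sub>v z = C_mat T N (Suc q) *\<^sub>v x"
    and y: "y = B_mat T N (Suc q) *\<^sub>v x + \<mu> \<cdot>\<^sub>v (C_mat T N (Suc q) *\<^sub>v z)"
    and \<alpha>: "\<alpha>\<^sup>2 = \<mu>"
begin

lemma schur_residuals: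
  defines "X \<equiv> trial_coeff x" and "Z \<equiv> (\<lambda>j. \<alpha> * trial_coeff z j)"
  shows "ip (\<lambda>t. spline q (diff_coeff q Z) t + \<alpha> * spline (Suc q) X t) (spline q b) = 0"
    and "(ip (\<lambda>t. spline q (diff_coeff q X) t + - \<alpha> * spline (Suc q) Z t) (spline q b))\<^sup>2
       \<le> stab * scalar_prod y y * ip (spline q b) (spline q b)"
proof -
  obtain a where a: "a \<in> carrier_vec (N + q)" "spline q (diff_coeff q (test_coeff a)) = spline q b"
    using test_coeff_surj by blast
  have aN: "test_coeff a (N + q) = 0" using a(1) by (simp add: test_coeff_def)
  have tz: "spline q (diff_coeff q Z) = (\<lambda>t. \<alpha> * spline q (diff_coeff q (trial_coeff z)) t)"
    "spline (Suc q) Z = (\<lambda>t. \<alpha> * spline (Suc q) (trial_coeff z) t)"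
  proof -
    have "diff_coeff q Z = (\<lambda>j. \<alpha> * diff_coeff q (trial_coeff z) j)"
      by (simp add: Z_def diff_coeff_def fun_eq_iff right_diff_distrib)
    then show "spline q (diff_coeff q Z) = (\<lambda>t. \<alpha> * spline q (diff_coeff q (trial_coeff z)) t)"
      by (simp add: spline_scale)
    show "spline (Suc q) Z = (\<lambda>t. \<alpha> * spline (Suc q) (trial_coeff z) t)"
      by (simp add: Z_def spline_scale)
  qed
  \<comment> \<open>The derivative is moved to the test function, so that only the arbitrary spline
    with coefficients \<open>b\<close> is left of it.\<close>
  have parts: "ip (spline q (diff_coeff q (trial_coeff w))) (spline (Suc q) (test_coeff a))
      = - ip (spline (Suc q) (trial_coeff w)) (spline q b)" for w
    using integration_by_parts[of "trial_coeff w" "test_coeff a" q] aN unfolding a(2) by (simp add: trial_coeff_def)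
  have Bc: "B_mat T N (Suc q) *\<^sub>v w \<in> carrier_vec (N + q)" "C_mat T N (Suc q) *\<^sub>v w \<in> carrier_vec (N + q)"
    if "w \<in> carrier_vec (N + q)" for w
    using that by (auto intro: mult_mat_vec_carrier[OF B_mat_carrier] mult_mat_vec_carrier[OF C_mat_carrier])
  have "ip (spline q (diff_coeff q (trial_coeff z))) (spline q b) = - ip (spline (Suc q) X) (spline q b)"
    using arg_cong[OF zx, of "\<lambda>w. scalar_prod a w"] B_mat_form[OF z a(1)] C_mat_form[OF x a(1)] parts[of x]
    unfolding a(2) X_def by simp
  then show "ip (\<lambda>t. spline q (diff_coeff q Z) t + \<alpha> * spline (Suc q) X t) (spline q b) = 0"
    unfolding tz by (subst ip_add_left) (auto simp: ip_scale_left intro!: pw_poly_intros)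
  have "scalar_prod a y = scalar_prod a (B_mat T N (Suc q) *\<^sub>v x) + \<mu> * (scalar_prod a (C_mat T N (Suc q) *\<^sub>v z))"
    unfolding y using a(1) Bc x z by (subst scalar_prod_add_distrib[of _ "N + q"]) auto
  also have "\<dots> = ip (spline q (diff_coeff q X)) (spline q b) - \<mu> * ip (spline (Suc q) (trial_coeff z)) (spline q b)"
    using B_mat_form[OF x a(1)] C_mat_form[OF z a(1)] parts[of z] unfolding a(2) X_def by simp
  also have "\<dots> = ip (\<lambda>t. spline q (diff_coeff q X) t + - \<alpha> * spline (Suc q) Z t) (spline q b)"
  proof -
    let ?u = "spline q (diff_coeff q X)" and ?V = "spline (Suc q) (trial_coeff z)"
    have e: "(\<lambda>t. ?u t + - \<alpha> * (\<alpha> * ?V t)) = (\<lambda>t. ?u t + (- \<mu>) * ?V t)"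
      by (simp add: \<alpha>[symmetric] power2_eq_square mult.assoc)
    have "ip (\<lambda>t. ?u t + (- \<mu>) * ?V t) (spline q b) = ip ?u (spline q b) + ip (\<lambda>t. (- \<mu>) * ?V t) (spline q b)"
      by (intro ip_add_left pw_poly_intros)
    then show ?thesis unfolding tz e ip_scale_left by simp
  qed
  finally have "scalar_prod a y = \<dots>" .
  moreover have "y \<in> carrier_vec (N + q)" unfolding y using Bc x z by auto
  ultimately show "(ip (\<lambda>t. spline q (diff_coeff q X) t + - \<alpha> * spline (Suc q) Z t) (spline q b))\<^sup>2
       \<le> stab * scalar_prod y y * ip (spline q b) (spline q b)"
    using load_bound[OF a(1), of y] unfolding a(2) by simp
qed

text \<open>One factor \<open>stab\<close> measures the load \<open>y\<close>, the other recovers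
  the coefficients \<open>x\<close> from the energy.\<close>

lemma schur_lower_bound:
  defines "L \<equiv> 2 + 8 * \<mu> * T\<^sup>2"
  assumes "12 * L * \<mu> * (T * (real (Suc q) * mesh)) \<le> 1"
  shows "scalar_prod x x \<le> 8 * L * stab\<^sup>2 * scalar_prod y y"
proof -
  have "stab * scalar_prod y y \<ge> 0" using stab_nonneg scalar_prod_self_nonneg by simp
  with schur_residuals assms have "ip (spline q (diff_coeff q (trial_coeff x))) (spline q (diff_coeff q (trial_coeff x)))
      \<le> 8 * L * (stab * scalar_prod y y)"
    unfolding L_def \<alpha>[symmetric]
    by (intro energy_estimate[of "trial_coeff x" "\<lambda>j. \<alpha> * trial_coeff z j"]) (auto simp: trial_coeff_def)
  then have "stab * ip (spline q (diff_coeff q (trial_coeff x))) (spline q (diff_coeff q (trial_coeff x)))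
      \<le> stab * (8 * L * (stab * scalar_prod y y))"
    by (intro mult_left_mono stab_nonneg)
  with trial_bound[OF x] show ?thesis by (simp add: power2_eq_square mult_ac)
qed

end

end

section \<open>Injectivity from the uniqueness assumption\<close>

context time_grid
begin

lemma spline_Re_Im: "spline q c t = of_real (spline q (\<lambda>j. Re (c j)) t) + \<i> * of_real (spline q (\<lambda>j. Im (c j)) t)"
  by (rule complex_eqI) (simp_all add: spline_def)

lemma cnj_spline: "cnj (spline q c t) = spline q (\<lambda>j. cnj (c j)) t"
  by (simp add: spline_def)

lemma inner_J_spline:
  assumes "pw_poly f'"
    and f: "\<And>k t. k < N \<Longrightarrow> t \<in> {node k<..<node (Suc k)} \<Longrightarrow> f t = f' t"
    and w: "\<And>k t. k < N \<Longrightarrow> t \<in> {node k<..<node (Suc k)} \<Longrightarrow> w t = spline q b t"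
  shows "((\<lambda>t. f' t * spline q (\<lambda>j. cnj (b j)) t) has_integral inner_J T f w) {0..T}"
proof -
  have pw: "pw_poly (\<lambda>t. f' t * spline q (\<lambda>j. cnj (b j)) t)"
    using assms(1) by (intro pw_poly_mult pw_poly_spline)
  then have "pw_poly (\<lambda>t. f t * cnj (w t))"
    by (rule pw_poly_cong) (simp add: f w cnj_spline)
  then have "inner_J T f w = integral {0..T} (\<lambda>t. f t * cnj (w t))"
    unfolding inner_J_def by (rule pw_poly_lebesgue_integral)
  also have "\<dots> = integral {0..T} (\<lambda>t. f' t * spline q (\<lambda>j. cnj (b j)) t)"
    by (rule integral_cong_pieces) (simp add: f w cnj_spline)
  finally show ?thesis using pw_poly_integrable[OF pw] by (simp add: has_integral_integral)
qed

text \<open>With \<open>\<psi> = U + \<i> V\<close> the two real residuals are, up to the factor \<open>\<i>\<close>, the imaginary and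
  real parts of \<open>\<psi>' + \<i> \<alpha> \<psi>\<close>.\<close>

lemma homogeneous_solution:
  fixes X Z :: "nat \<Rightarrow> real"
  assumes init: "X 0 = 0" "Z 0 = 0"
    and r1: "\<And>b. ip (\<lambda>t. spline q (diff_coeff q Z) t + \<alpha> * spline (Suc q) X t) (spline q b) = 0"
    and r2: "\<And>b. ip (\<lambda>t. spline q (diff_coeff q X) t + - \<alpha> * spline (Suc q) Z t) (spline q b) = 0"
  shows "discrete_ode_solution T N (Suc q) (- \<alpha>) (\<lambda>_. 0) 0 (spline (Suc q) (\<lambda>j. Complex (X j) (Z j)))"
proof -
  define c where "c j = Complex (X j) (Z j)" for j
  define \<psi> where "\<psi> = spline (Suc q) c"
  define \<psi>' where "\<psi>' = spline q (diff_coeff q c)"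
  define g1 where "g1 t = spline q (diff_coeff q Z) t + \<alpha> * spline (Suc q) X t" for t
  define g2 where "g2 t = spline q (diff_coeff q X) t + - \<alpha> * spline (Suc q) Z t" for t
  have pg: "pw_poly g1" "pw_poly g2" unfolding g1_def g2_def by (intro pw_poly_intros)+
  have "Re (diff_coeff q c j) = diff_coeff q X j \<and> Im (diff_coeff q c j) = diff_coeff q Z j" for j
    by (simp add: diff_coeff_def c_def del: of_nat_Suc)
  then have \<psi>'_eq: "\<psi>' t = of_real (spline q (diff_coeff q X) t) + \<i> * of_real (spline q (diff_coeff q Z) t)" for t
    unfolding \<psi>'_def by (subst spline_Re_Im) simp
  have \<psi>_eq: "\<psi> t = of_real (spline (Suc q) X t) + \<i> * of_real (spline (Suc q) Z t)" for t
    unfolding \<psi>_def by (subst spline_Re_Im) (simp add: c_def)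
  have "\<i> * inner_J T (dt \<psi>) w + complex_of_real (- \<alpha>) * inner_J T \<psi> w = inner_J T (\<lambda>_. 0) w"
    if ws: "w \<in> spline_space T N q" for w
  proof -
    obtain b where w: "\<And>k t. k < N \<Longrightarrow> t \<in> {node k<..<node (Suc k)} \<Longrightarrow> w t = spline q b t"
      using spline_space_eq_spline[OF ws] by metis
    \<comment> \<open>The inner product conjugates the test function, so the conjugate is split into
      two real splines, to which \<open>r1\<close> and \<open>r2\<close> apply.\<close>
    define W where "W = spline q (\<lambda>j. cnj (b j))"
    define W1 where "W1 = spline q (\<lambda>j. Re (cnj (b j)))"
    define W2 where "W2 = spline q (\<lambda>j. Im (cnj (b j)))"
    have W: "W t = of_real (W1 t) + \<i> * of_real (W2 t)" for t
      unfolding W_def W1_def W2_def by (rule spline_Re_Im)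
    have h: "((\<lambda>t. f t * spline q d t) has_integral ip f (spline q d)) {0..T}" if "pw_poly f" for f and d :: "nat \<Rightarrow> real"
      unfolding ip_def using that by (intro integrable_integral pw_poly_integrable pw_poly_intros)
    have gW: "((\<lambda>t. g1 t * W1 t) has_integral 0) {0..T}" "((\<lambda>t. g1 t * W2 t) has_integral 0) {0..T}"
      "((\<lambda>t. g2 t * W1 t) has_integral 0) {0..T}" "((\<lambda>t. g2 t * W2 t) has_integral 0) {0..T}"
      using h[OF pg(1)] h[OF pg(2)] r1 r2 unfolding g1_def g2_def W1_def W2_def by (metis (no_types))+
    have I1: "((\<lambda>t. - complex_of_real (g1 t * W1 t + g2 t * W2 t) + \<i> * complex_of_real (g2 t * W1 t - g1 t * W2 t))
       has_integral (- complex_of_real (0 + 0) + \<i> * complex_of_real (0 - 0))) {0..T}"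
      by (intro has_integral_add has_integral_diff has_integral_neg has_integral_mult_right has_integral_of_real gW)
    have eq: "- complex_of_real (g1 t * W1 t + g2 t * W2 t) + \<i> * complex_of_real (g2 t * W1 t - g1 t * W2 t)
      = \<i> * (\<psi>' t * W t) + complex_of_real (- \<alpha>) * (\<psi> t * W t)" for t
      unfolding \<psi>'_eq \<psi>_eq W g1_def g2_def by (rule complex_eqI) (simp_all add: algebra_simps)
    have I2: "((\<lambda>t. \<i> * (\<psi>' t * W t) + complex_of_real (- \<alpha>) * (\<psi> t * W t)) has_integral
       (\<i> * inner_J T (dt \<psi>) w + complex_of_real (- \<alpha>) * inner_J T \<psi> w)) {0..T}"
      unfolding W_def \<psi>'_def \<psi>_def
      by (intro has_integral_add has_integral_mult_right inner_J_spline pw_poly_spline dt_spline w refl)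
    have "\<i> * inner_J T (dt \<psi>) w + complex_of_real (- \<alpha>) * inner_J T \<psi> w = 0"
      using has_integral_unique[OF I2 I1[unfolded eq]] by simp
    then show ?thesis by (simp add: inner_J_def)
  qed
  moreover have "\<psi> \<in> spline_space_init T N (Suc q)"
    unfolding spline_space_init_def \<psi>_def using spline_in_spline_space by (simp add: spline_at_0 c_def init complex_eq_iff)
  ultimately show ?thesis unfolding discrete_ode_solution_def \<psi>_def c_def[abs_def] by simp
qed

section \<open>Bounds for the matrix entries\<close>

lemma bspline_nonneg_closed:
  assumes "t \<in> {0..T}" "j < N + q"
  shows "0 \<le> bspline T N q j t"
  using bspline_nonneg[of t q j] bspline_at_T[OF assms(2)] assms(1) by (cases "t = T") auto

lemma spline_abs_le:
  assumes "t \<in> {0..T}" "\<And>j. j < N + q \<Longrightarrow> \<bar>d j\<bar> \<le> D"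
  shows "\<bar>spline q d t\<bar> \<le> (D::real)"
proof -
  have "\<bar>spline q d t\<bar> \<le> (\<Sum>j<N + q. D * bspline T N q j t)"
    unfolding spline_def
    by (rule order.trans[OF sum_abs], rule sum_mono)
       (use assms bspline_nonneg_closed in \<open>auto simp: abs_mult intro!: mult_right_mono\<close>)
  also have "\<dots> = D" using sum_bspline[OF assms(1)] by (simp add: sum_distrib_left[symmetric])
  finally show ?thesis .
qed

lemma ip_abs_le:
  assumes "pw_poly f" "pw_poly g" "\<And>t. t \<in> {0..T} \<Longrightarrow> \<bar>f t\<bar> \<le> F" "\<And>t. t \<in> {0..T} \<Longrightarrow> \<bar>g t\<bar> \<le> G"
  shows "\<bar>ip f g\<bar> \<le> T * (F * G)"
proof -
  have "norm (ip f g) \<le> integral {0..T} (\<lambda>t. F * G)"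
    unfolding ip_def
  proof (rule integral_norm_bound_integral)
    fix t assume t: "t \<in> {0..T}"
    have "\<bar>f t\<bar> * \<bar>g t\<bar> \<le> F * G" using assms(3,4)[OF t] by (intro mult_mono) auto
    then show "norm (f t * g t) \<le> F * G" by (simp add: abs_mult)
  qed (use assms in \<open>auto intro!: pw_poly_integrable pw_poly_intros\<close>)
  then show ?thesis using T_pos by (simp add: mult_ac)
qed

text \<open>A spline is an average of its coefficients, hence bounded by them; the derivative of one
  B-spline has coefficients of modulus at most \<open>(q + 1) / mesh\<close>.\<close>

lemma matrix_entry_bounds:
  assumes "r < N + q" "c < N + q"
  defines "D \<equiv> real (Suc q) / mesh"
  shows "\<bar>B_mat T N (Suc q) $$ (r, c)\<bar> \<le> T * (D * D)" "\<bar>C_mat T N (Suc q) $$ (r, c)\<bar> \<le> T * (D * 1)"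
proof -
  have d: "\<bar>spline q (diff_coeff q (unit_coeff j)) t\<bar> \<le> D" if "t \<in> {0..T}" for j t
  proof (rule spline_abs_le[OF that])
    fix i assume i: "i < N + q"
    have "\<bar>diff_coeff q (unit_coeff j) i\<bar> \<le> real (Suc q) / knot_span q i"
      using knot_span_bounds[OF i] mesh_pos by (auto simp: diff_coeff_def unit_coeff_def simp del: of_nat_Suc)
    also have "\<dots> \<le> D" unfolding D_def
      using knot_span_bounds[OF i] mesh_pos by (intro divide_left_mono mult_pos_pos) auto
    finally show "\<bar>diff_coeff q (unit_coeff j) i\<bar> \<le> D" .
  qed
  have e: "\<bar>spline (Suc q) (unit_coeff j) t\<bar> \<le> 1" if "t \<in> {0..T}" for j t
    by (rule spline_abs_le[OF that]) (simp add: unit_coeff_def)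
  have "B_mat T N (Suc q) $$ (r, c) =
    ip (spline q (diff_coeff q (unit_coeff (c + 1)))) (spline q (diff_coeff q (unit_coeff r)))"
    using assms by (auto simp: B_mat_def dt_spline bspline_eq_spline pw_poly_spline intro!: real_inner_J_eq_ip)
  then show "\<bar>B_mat T N (Suc q) $$ (r, c)\<bar> \<le> T * (D * D)"
    using ip_abs_le[OF pw_poly_spline pw_poly_spline d d] by simp
  have "C_mat T N (Suc q) $$ (r, c) =
    ip (spline q (diff_coeff q (unit_coeff (c + 1)))) (spline (Suc q) (unit_coeff r))"
    using assms by (auto simp: C_mat_def dt_spline bspline_eq_spline pw_poly_spline intro!: real_inner_J_eq_ip)
  then show "\<bar>C_mat T N (Suc q) $$ (r, c)\<bar> \<le> T * (D * 1)"
    using ip_abs_le[OF pw_poly_spline pw_poly_spline d e] by simp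
qed

end

context stable_time_grid
begin

text \<open>For \<open>y = 0\<close> both residuals vanish, so the complex spline solves the
  homogeneous problem and coincides with the zero spline. The coefficient bound with
  \<open>M = 0\<close> then removes the coefficients.\<close>

lemma schur_injective:
  assumes x: "x \<in> carrier_vec (N + q)" and z: "z \<in> carrier_vec (N + q)"
    and zx: "B_mat T N (Suc q) *\<^sub>v z = C_mat T N (Suc q) *\<^sub>v x"
    and y: "0\<^sub>v (N + q) = B_mat T N (Suc q) *\<^sub>v x + \<mu> \<cdot>\<^sub>v (C_mat T N (Suc q) *\<^sub>v z)"
    and \<alpha>: "\<alpha>\<^sup>2 = \<mu>"
    and unique: "\<And>\<psi> \<psi>' t. discrete_ode_solution T N (Suc q) (- \<alpha>) (\<lambda>_. 0) 0 \<psi> \<Longrightarrow>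
      discrete_ode_solution T N (Suc q) (- \<alpha>) (\<lambda>_. 0) 0 \<psi>' \<Longrightarrow> t \<in> {0..T} \<Longrightarrow> \<psi> t = \<psi>' t"
  shows "x = 0\<^sub>v (N + q)"
proof -
  let ?X = "trial_coeff x" and ?Z = "\<lambda>j. \<alpha> * trial_coeff z j"
  note res = schur_residuals[OF x z zx y \<alpha>]
  have r2: "ip (\<lambda>t. spline q (diff_coeff q ?X) t + - \<alpha> * spline (Suc q) ?Z t) (spline q b) = 0" for b
    using res(2)[of b] by simp
  have "discrete_ode_solution T N (Suc q) (- \<alpha>) (\<lambda>_. 0) 0 (spline (Suc q) (\<lambda>j. Complex (?X j) (?Z j)))"
    by (rule homogeneous_solution[OF _ _ res(1) r2]) (auto simp: trial_coeff_def)
  moreover have "discrete_ode_solution T N (Suc q) (- \<alpha>) (\<lambda>_. 0) 0 (spline (Suc q) (\<lambda>j. Complex 0 0))"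
    by (rule homogeneous_solution) (auto simp: spline_def diff_coeff_def ip_def)
  ultimately have "spline (Suc q) (\<lambda>j. Complex (?X j) (?Z j)) t = spline (Suc q) (\<lambda>j. Complex 0 0) t"
    if "t \<in> {0..T}" for t using unique that by blast
  then have "Re (spline (Suc q) (\<lambda>j. Complex (?X j) (?Z j)) t) = 0" if "t \<in> {0..T}" for t
    using that by (simp add: spline_def)
  then have "spline (Suc q) ?X t = 0" if "t \<in> {0..T}" for t
    using that by (subst (asm) spline_Re_Im) simp
  then have "?X j = 0" if "j < N + Suc q" for j
    using coeff_bound[of ?X 0 j] that by auto
  from this[of "Suc _"] show ?thesis
    using x by (intro eq_vecI) (auto simp: trial_coeff_def)
qed

end

section \<open>Condition numbers\<close>

lemma injective_imp_mat_inverse: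
  fixes A :: "real Matrix.mat"
  assumes A: "A \<in> carrier_mat n n"
    and inj: "\<And>x. x \<in> carrier_vec n \<Longrightarrow> A *\<^sub>v x = 0\<^sub>v n \<Longrightarrow> x = 0\<^sub>v n"
  shows "invertible_mat A" "mat_inv A \<in> carrier_mat n n" "A * mat_inv A = 1\<^sub>m n" "mat_inv A * A = 1\<^sub>m n"
proof -
  have "det A \<noteq> 0" using det_0_iff_vec_prod_zero[OF A] inj by blast
  then have "A \<in> Units (ring_mat TYPE(real) n ())" by (rule det_non_zero_imp_unit[OF A])
  then obtain I where I: "mat_inverse A = Some I" using mat_inverse(1)[OF A, of "()"] by (cases "mat_inverse A") auto
  from mat_inverse(2)[OF A I] show "mat_inv A \<in> carrier_mat n n" "A * mat_inv A = 1\<^sub>m n" "mat_inv A * A = 1\<^sub>m n"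
    by (simp_all add: I)
  then show "invertible_mat A"
    unfolding invertible_mat_def inverts_mat_def using A by (auto intro!: exI[of _ "mat_inv A"])
qed

lemma spectral_norm_bounds:
  assumes "A \<in> carrier_mat n n" "K \<ge> 0"
    and "\<And>v. v \<in> carrier_vec n \<Longrightarrow> scalar_prod (A *\<^sub>v v) (A *\<^sub>v v) \<le> K * scalar_prod v v"
  shows "0 \<le> spectral_norm A" "spectral_norm A \<le> sqrt K"
proof -
  let ?V = "{v \<in> carrier_vec (dim_col A). euclid_norm v \<le> 1}"
  have le: "euclid_norm (A *\<^sub>v v) \<le> sqrt K" if "v \<in> ?V" for v
  proof -
    have "scalar_prod (A *\<^sub>v v) (A *\<^sub>v v) \<le> K * scalar_prod v v" using that assms by auto
    also have "\<dots> \<le> K * 1" using that assms(2) by (intro mult_left_mono) (auto simp: euclid_norm_def)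
    finally show ?thesis by (simp add: euclid_norm_def)
  qed
  have z: "0\<^sub>v (dim_col A) \<in> ?V" by (simp add: euclid_norm_def)
  then show "spectral_norm A \<le> sqrt K"
    unfolding spectral_norm_def by (intro cSUP_least le) blast+
  have "0 \<le> euclid_norm (A *\<^sub>v 0\<^sub>v (dim_col A))" by (simp add: euclid_norm_def scalar_prod_self_nonneg)
  also have "\<dots> \<le> spectral_norm A"
    unfolding spectral_norm_def using z by (intro cSUP_upper bdd_aboveI2[of _ _ "sqrt K"] le)
  finally show "0 \<le> spectral_norm A" .
qed

text \<open>Cauchy-Schwarz row by row: the Frobenius norm is at most \<open>n\<close> times the
  largest entry.\<close>

lemma scalar_prod_mult_mat_vec_le:
  fixes A :: "real Matrix.mat"
  assumes A: "A \<in> carrier_mat n n" and v: "v \<in> carrier_vec n"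
    and M: "\<And>i j. i < n \<Longrightarrow> j < n \<Longrightarrow> \<bar>A $$ (i, j)\<bar> \<le> M"
  shows "scalar_prod (A *\<^sub>v v) (A *\<^sub>v v) \<le> (real n * M)\<^sup>2 * scalar_prod v v"
proof -
  have row: "((A *\<^sub>v v) $ i)\<^sup>2 \<le> real n * M\<^sup>2 * scalar_prod v v" if i: "i < n" for i
  proof -
    have "(A *\<^sub>v v) $ i = (\<Sum>j\<in>{0..<n}. A $$ (i, j) * v $ j)"
      using A v i by (simp add: scalar_prod_def)
    then have "((A *\<^sub>v v) $ i)\<^sup>2 \<le> (\<Sum>j\<in>{0..<n}. (A $$ (i, j))\<^sup>2) * (\<Sum>j\<in>{0..<n}. (v $ j)\<^sup>2)"
      by (simp add: Cauchy_Schwarz_ineq_sum)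
    also have "(\<Sum>j\<in>{0..<n}. (v $ j)\<^sup>2) = scalar_prod v v"
      using v by (simp add: scalar_prod_def power2_eq_square)
    also have "(\<Sum>j\<in>{0..<n}. (A $$ (i, j))\<^sup>2) \<le> (\<Sum>j\<in>{0..<n}. M\<^sup>2)"
    proof (rule sum_mono)
      fix j assume "j \<in> {0..<n}"
      then have "\<bar>A $$ (i, j)\<bar>\<^sup>2 \<le> M\<^sup>2" using M[OF i] by (intro power_mono) auto
      then show "(A $$ (i, j))\<^sup>2 \<le> M\<^sup>2" by simp
    qed
    finally show ?thesis using scalar_prod_self_nonneg[of v] by (simp add: mult_right_mono)
  qed
  have "scalar_prod (A *\<^sub>v v) (A *\<^sub>v v) = (\<Sum>i\<in>{0..<n}. ((A *\<^sub>v v) $ i)\<^sup>2)"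
    using A by (simp add: scalar_prod_def power2_eq_square)
  also have "\<dots> \<le> (\<Sum>i\<in>{0..<n}. real n * M\<^sup>2 * scalar_prod v v)"
    by (intro sum_mono row) auto
  finally show ?thesis by (simp add: power_mult_distrib power2_eq_square mult_ac)
qed

lemma condition_number_bounds:
  fixes A :: "real Matrix.mat"
  assumes A: "A \<in> carrier_mat n n"
    and inj: "\<And>x. x \<in> carrier_vec n \<Longrightarrow> A *\<^sub>v x = 0\<^sub>v n \<Longrightarrow> x = 0\<^sub>v n"
  shows "0 \<le> condition_number A"
    and "\<lbrakk>Q \<ge> 0; P \<ge> 0;
       \<And>v. v \<in> carrier_vec n \<Longrightarrow> scalar_prod (A *\<^sub>v v) (A *\<^sub>v v) \<le> Q * scalar_prod v v;
       \<And>v. v \<in> carrier_vec n \<Longrightarrow> scalar_prod v v \<le> P * scalar_prod (A *\<^sub>v v) (A *\<^sub>v v)\<rbrakk>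
      \<Longrightarrow> condition_number A \<le> 1 + Q * P"
proof -
  note I = injective_imp_mat_inverse[OF A inj]
  have nonneg: "0 \<le> spectral_norm D" if D: "D \<in> carrier_mat n n" for D :: "real Matrix.mat"
  proof -
    define M where "M = (\<Sum>i<n. \<Sum>j<n. \<bar>D $$ (i, j)\<bar>)"
    have "\<bar>D $$ (i, j)\<bar> \<le> M" if "i < n" "j < n" for i j
    proof -
      have "\<bar>D $$ (i, j)\<bar> \<le> (\<Sum>j<n. \<bar>D $$ (i, j)\<bar>)" using that by (intro member_le_sum) auto
      also have "\<dots> \<le> M" unfolding M_def using that
        by (intro member_le_sum[of i _ "\<lambda>i. \<Sum>j<n. \<bar>D $$ (i, j)\<bar>"]) (auto intro: sum_nonneg)
      finally show ?thesis .
    qed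
    from spectral_norm_bounds(1)[OF D _ scalar_prod_mult_mat_vec_le[OF D _ this]] show ?thesis by simp
  qed
  show "0 \<le> condition_number A"
    unfolding condition_number_def using nonneg[OF A] nonneg[OF I(2)] by simp
  assume Q: "Q \<ge> 0" and P: "P \<ge> 0"
    and up: "\<And>v. v \<in> carrier_vec n \<Longrightarrow> scalar_prod (A *\<^sub>v v) (A *\<^sub>v v) \<le> Q * scalar_prod v v"
    and low: "\<And>v. v \<in> carrier_vec n \<Longrightarrow> scalar_prod v v \<le> P * scalar_prod (A *\<^sub>v v) (A *\<^sub>v v)"
  have "spectral_norm A \<le> sqrt Q" using A Q up by (rule spectral_norm_bounds(2))
  moreover have "spectral_norm (mat_inv A) \<le> sqrt P"
  proof (rule spectral_norm_bounds(2)[OF I(2) P])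
    fix v :: "real Matrix.vec" assume v: "v \<in> carrier_vec n"
    have c: "mat_inv A *\<^sub>v v \<in> carrier_vec n" using I(2) v by (rule mult_mat_vec_carrier)
    have "A *\<^sub>v (mat_inv A *\<^sub>v v) = v"
      using assoc_mult_mat_vec[OF A I(2) v] I(3) v by simp
    then show "scalar_prod (mat_inv A *\<^sub>v v) (mat_inv A *\<^sub>v v) \<le> P * scalar_prod v v"
      using low[OF c] by simp
  qed
  ultimately have "condition_number A \<le> sqrt Q * sqrt P"
    unfolding condition_number_def using nonneg[OF I(2)] Q by (intro mult_mono) auto
  also have "\<dots> = sqrt (Q * P)" by (simp add: real_sqrt_mult)
  \<comment> \<open>Replacing the root by \<open>1 + Q * P\<close> keeps the bound inside sums and
    products, under which polynomial growth is closed.\<close>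
  also have "\<dots> \<le> sqrt ((1 + Q * P)\<^sup>2)"
    using Q P by (intro real_sqrt_le_mono) (simp add: power2_eq_square algebra_simps)
  also have "\<dots> = 1 + Q * P" using Q P by simp
  finally show "condition_number A \<le> 1 + Q * P" .
qed

section \<open>Polynomial growth in the number of subintervals\<close>

definition poly_growth :: "(nat \<Rightarrow> real) \<Rightarrow> bool" where
  "poly_growth f \<longleftrightarrow> (\<exists>C s. \<forall>N\<ge>1. \<bar>f N\<bar> \<le> C * real N ^ s)"

lemma poly_growth_const: "poly_growth (\<lambda>_. c)"
  unfolding poly_growth_def by (intro exI[of _ "\<bar>c\<bar>"] exI[of _ 0]) auto

lemma poly_growth_of_nat: "poly_growth real"
  unfolding poly_growth_def by (intro exI[of _ 1] exI[of _ 1]) auto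

lemma poly_growth_add:
  assumes "poly_growth f" "poly_growth g"
  shows "poly_growth (\<lambda>N. f N + g N)"
proof -
  obtain C s C' s' where f: "\<And>N. N \<ge> 1 \<Longrightarrow> \<bar>f N\<bar> \<le> C * real N ^ s" and g: "\<And>N. N \<ge> 1 \<Longrightarrow> \<bar>g N\<bar> \<le> C' * real N ^ s'"
    using assms unfolding poly_growth_def by metis
  have "0 \<le> C" "0 \<le> C'" using f[of 1] g[of 1] by auto
  have "\<bar>f N + g N\<bar> \<le> (C + C') * real N ^ (s + s')" if N: "N \<ge> 1" for N
  proof -
    have "C * real N ^ s \<le> C * real N ^ (s + s')" "C' * real N ^ s' \<le> C' * real N ^ (s + s')"
      using N \<open>0 \<le> C\<close> \<open>0 \<le> C'\<close> by (auto intro!: mult_left_mono power_increasing)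
    then show ?thesis using f[OF N] g[OF N] unfolding distrib_right by linarith
  qed
  then show ?thesis unfolding poly_growth_def by blast
qed

lemma poly_growth_mult:
  assumes "poly_growth f" "poly_growth g"
  shows "poly_growth (\<lambda>N. f N * g N)"
proof -
  obtain C s C' s' where f: "\<And>N. N \<ge> 1 \<Longrightarrow> \<bar>f N\<bar> \<le> C * real N ^ s" and g: "\<And>N. N \<ge> 1 \<Longrightarrow> \<bar>g N\<bar> \<le> C' * real N ^ s'"
    using assms unfolding poly_growth_def by metis
  have "\<bar>f N * g N\<bar> \<le> (C * C') * real N ^ (s + s')" if N: "N \<ge> 1" for N
  proof -
    have "\<bar>f N\<bar> * \<bar>g N\<bar> \<le> (C * real N ^ s) * (C' * real N ^ s')"
      using f[OF N] g[OF N] by (intro mult_mono) (auto intro: order.trans[OF abs_ge_zero])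
    then show ?thesis by (simp add: abs_mult power_add mult_ac)
  qed
  then show ?thesis unfolding poly_growth_def by blast
qed

lemma poly_growth_power: "poly_growth f \<Longrightarrow> poly_growth (\<lambda>N. f N ^ k)"
  by (induction k) (auto intro: poly_growth_const poly_growth_mult)

text \<open>The finitely many values below \<open>N0\<close> are added to the constant. This reduces
  the condition number bound to fine meshes.\<close>

lemma poly_growth_eventually:
  assumes "poly_growth f" "\<And>N. N \<ge> N0 \<Longrightarrow> \<bar>g N\<bar> \<le> f N"
  shows "poly_growth g"
proof -
  obtain C s where f: "\<And>N. N \<ge> 1 \<Longrightarrow> \<bar>f N\<bar> \<le> C * real N ^ s" using assms(1) unfolding poly_growth_def by metis
  define D where "D = (\<Sum>N<N0. \<bar>g N\<bar>)"
  have D: "D \<ge> 0" unfolding D_def by (intro sum_nonneg) auto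
  have C: "C \<ge> 0" using f[of 1] by auto
  have "\<bar>g N\<bar> \<le> (C + D) * real N ^ s" if N: "N \<ge> 1" for N
  proof (cases "N \<ge> N0")
    case True
    then have "\<bar>g N\<bar> \<le> C * real N ^ s" using assms(2)[of N] f[OF N] by linarith
    also have "\<dots> \<le> (C + D) * real N ^ s" using D by (intro mult_right_mono) auto
    finally show ?thesis .
  next
    case False
    then have "\<bar>g N\<bar> \<le> D" unfolding D_def by (intro member_le_sum[of N _ "\<lambda>N. \<bar>g N\<bar>"]) auto
    also have "\<dots> \<le> (C + D) * 1" using C by simp
    also have "\<dots> \<le> (C + D) * real N ^ s" using N C D by (intro mult_left_mono one_le_power) auto
    finally show ?thesis .
  qed
  then show ?thesis unfolding poly_growth_def by blast
qed

lemma scalar_prod_self_add_le: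
  assumes "a \<in> carrier_vec n" "b \<in> carrier_vec n"
  shows "scalar_prod (a + \<mu> \<cdot>\<^sub>v b) (a + \<mu> \<cdot>\<^sub>v b) \<le> 2 * scalar_prod a a + 2 * \<mu>\<^sup>2 * scalar_prod b (b :: real Matrix.vec)"
proof -
  have sq: "(x + \<mu> * y) * (x + \<mu> * y) \<le> 2 * (x * x) + 2 * \<mu>\<^sup>2 * (y * y)" for x y :: real
    using zero_le_power2[of "x - \<mu> * y"] by (simp add: power2_eq_square algebra_simps)
  have "scalar_prod (a + \<mu> \<cdot>\<^sub>v b) (a + \<mu> \<cdot>\<^sub>v b) = (\<Sum>i\<in>{0..<n}. (a $ i + \<mu> * b $ i) * (a $ i + \<mu> * b $ i))"
    using assms by (simp add: scalar_prod_def)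
  also have "\<dots> \<le> (\<Sum>i\<in>{0..<n}. 2 * (a $ i * a $ i) + 2 * \<mu>\<^sup>2 * (b $ i * b $ i))"
    by (intro sum_mono sq)
  also have "\<dots> = 2 * scalar_prod a a + 2 * \<mu>\<^sup>2 * scalar_prod b b"
    using assms by (simp add: scalar_prod_def sum.distrib sum_distrib_left)
  finally show ?thesis .
qed

section \<open>Bounds for the Schur complement\<close>

context stable_time_grid
begin

abbreviation "B \<equiv> B_mat T N (Suc q)"
abbreviation "C \<equiv> C_mat T N (Suc q)"

definition schur :: "real \<Rightarrow> real Matrix.mat" where
  "schur \<mu> = B + \<mu> \<cdot>\<^sub>m (C * mat_inv B * C)"

text \<open>With \<open>D = (q + 1) / mesh\<close>, the product \<open>D * (1 + D)\<close> dominates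
  both \<open>D * D\<close>, needed for \<open>B\<close>, and \<open>D\<close>, needed for
  \<open>C\<close>.\<close>

definition entry_bound :: real where
  "entry_bound = real (N + q) * (T * (real (Suc q) / mesh * (1 + real (Suc q) / mesh)))"

lemma B_mat_injective: "x \<in> carrier_vec (N + q) \<Longrightarrow> B *\<^sub>v x = 0\<^sub>v (N + q) \<Longrightarrow> x = 0\<^sub>v (N + q)"
proof -
  assume x: "x \<in> carrier_vec (N + q)" and "B *\<^sub>v x = 0\<^sub>v (N + q)"
  then have "scalar_prod x x \<le> 0" using B_mat_lower_bound[OF x] by simp
  then have "(\<Sum>i\<in>{0..<N + q}. (x $ i)\<^sup>2) = 0"
    using x scalar_prod_self_nonneg[of x] by (simp add: scalar_prod_def power2_eq_square)
  then show ?thesis using x by (intro eq_vecI) (auto simp: sum_nonneg_eq_0_iff)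
qed

lemmas B_inverse = injective_imp_mat_inverse[OF B_mat_carrier B_mat_injective]

lemma schur_carrier: "schur \<mu> \<in> carrier_mat (N + q) (N + q)"
proof -
  have "C * mat_inv B \<in> carrier_mat (N + q) (N + q)" using C_mat_carrier B_inverse(2) by (rule mult_carrier_mat)
  then have "C * mat_inv B * C \<in> carrier_mat (N + q) (N + q)" using C_mat_carrier by (rule mult_carrier_mat)
  then show ?thesis unfolding schur_def by simp
qed

lemma schur_mult_vec:
  assumes x: "x \<in> carrier_vec (N + q)"
  defines "z \<equiv> mat_inv B *\<^sub>v (C *\<^sub>v x)"
  shows "z \<in> carrier_vec (N + q)" "B *\<^sub>v z = C *\<^sub>v x" "schur \<mu> *\<^sub>v x = B *\<^sub>v x + \<mu> \<cdot>\<^sub>v (C *\<^sub>v z)"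
proof -
  note Bc = B_mat_carrier[of q] and Cc = C_mat_carrier[of q] and Ic = B_inverse(2)
  have Cx: "C *\<^sub>v x \<in> carrier_vec (N + q)" using Cc x by (rule mult_mat_vec_carrier)
  show z: "z \<in> carrier_vec (N + q)" unfolding z_def using Ic Cx by (rule mult_mat_vec_carrier)
  show "B *\<^sub>v z = C *\<^sub>v x"
    unfolding z_def using assoc_mult_mat_vec[OF Bc Ic Cx] B_inverse(3) Cx by simp
  have CI: "C * mat_inv B \<in> carrier_mat (N + q) (N + q)" using Cc Ic by simp
  have CIC: "C * mat_inv B * C \<in> carrier_mat (N + q) (N + q)" using CI Cc by simp
  have "schur \<mu> *\<^sub>v x = B *\<^sub>v x + (\<mu> \<cdot>\<^sub>m (C * mat_inv B * C)) *\<^sub>v x"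
    unfolding schur_def using Bc CIC x by (intro add_mult_distrib_mat_vec) auto
  also have "(\<mu> \<cdot>\<^sub>m (C * mat_inv B * C)) *\<^sub>v x = \<mu> \<cdot>\<^sub>v ((C * mat_inv B * C) *\<^sub>v x)"
    using CIC x by (intro eq_vecI) auto
  also have "(C * mat_inv B * C) *\<^sub>v x = C *\<^sub>v z"
    unfolding z_def using assoc_mult_mat_vec[OF CI Cc x] assoc_mult_mat_vec[OF Cc Ic Cx] by simp
  finally show "schur \<mu> *\<^sub>v x = B *\<^sub>v x + \<mu> \<cdot>\<^sub>v (C *\<^sub>v z)" .
qed

lemma matrix_upper_bounds:
  assumes "x \<in> carrier_vec (N + q)"
  shows "scalar_prod (B *\<^sub>v x) (B *\<^sub>v x) \<le> entry_bound\<^sup>2 * scalar_prod x x"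
    "scalar_prod (C *\<^sub>v x) (C *\<^sub>v x) \<le> entry_bound\<^sup>2 * scalar_prod x x"
proof -
  define D where "D = real (Suc q) / mesh"
  have "D \<ge> 0" using mesh_pos by (simp add: D_def)
  then have "T * (D * D) \<le> T * (D * (1 + D))" "T * (D * 1) \<le> T * (D * (1 + D))"
    using T_pos by (auto intro!: mult_left_mono simp: algebra_simps)
  then have entries: "\<bar>B $$ (r, c)\<bar> \<le> T * (D * (1 + D))" "\<bar>C $$ (r, c)\<bar> \<le> T * (D * (1 + D))"
    if "r < N + q" "c < N + q" for r c
    using matrix_entry_bounds[OF that] unfolding D_def[symmetric] by linarith+
  show "scalar_prod (B *\<^sub>v x) (B *\<^sub>v x) \<le> entry_bound\<^sup>2 * scalar_prod x x"
    "scalar_prod (C *\<^sub>v x) (C *\<^sub>v x) \<le> entry_bound\<^sup>2 * scalar_prod x x"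
    unfolding entry_bound_def D_def[symmetric]
    by (rule scalar_prod_mult_mat_vec_le[OF B_mat_carrier assms entries(1)]; assumption)
       (rule scalar_prod_mult_mat_vec_le[OF C_mat_carrier assms entries(2)]; assumption)
qed

text \<open>The inverse of \<open>B\<close> is never estimated entrywise: the vector
  \<open>z\<close> is bounded by \<open>B_mat_lower_bound\<close>, which contributes the factor
  \<open>stab^2\<close>.\<close>

lemma schur_upper_bound:
  assumes x: "x \<in> carrier_vec (N + q)"
  shows "scalar_prod (schur \<mu> *\<^sub>v x) (schur \<mu> *\<^sub>v x)
    \<le> (2 * entry_bound\<^sup>2 + 2 * \<mu>\<^sup>2 * (entry_bound\<^sup>2 * (stab\<^sup>2 * entry_bound\<^sup>2))) * scalar_prod x x"
proof -
  define z where "z = mat_inv B *\<^sub>v (C *\<^sub>v x)"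
  note z = schur_mult_vec[OF x, folded z_def]
  have "scalar_prod z z \<le> stab\<^sup>2 * scalar_prod (C *\<^sub>v x) (C *\<^sub>v x)"
    using B_mat_lower_bound[OF z(1)] z(2) by simp
  also have "\<dots> \<le> stab\<^sup>2 * (entry_bound\<^sup>2 * scalar_prod x x)"
    by (intro mult_left_mono matrix_upper_bounds x) auto
  finally have "entry_bound\<^sup>2 * scalar_prod z z \<le> entry_bound\<^sup>2 * (stab\<^sup>2 * (entry_bound\<^sup>2 * scalar_prod x x))"
    by (intro mult_left_mono) auto
  then have "scalar_prod (C *\<^sub>v z) (C *\<^sub>v z) \<le> entry_bound\<^sup>2 * (stab\<^sup>2 * (entry_bound\<^sup>2 * scalar_prod x x))"
    using matrix_upper_bounds(2)[OF z(1)] by linarith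
  then have "2 * \<mu>\<^sup>2 * scalar_prod (C *\<^sub>v z) (C *\<^sub>v z)
      \<le> 2 * \<mu>\<^sup>2 * (entry_bound\<^sup>2 * (stab\<^sup>2 * (entry_bound\<^sup>2 * scalar_prod x x)))"
    by (intro mult_left_mono) auto
  moreover have "scalar_prod (schur \<mu> *\<^sub>v x) (schur \<mu> *\<^sub>v x)
      \<le> 2 * scalar_prod (B *\<^sub>v x) (B *\<^sub>v x) + 2 * \<mu>\<^sup>2 * scalar_prod (C *\<^sub>v z) (C *\<^sub>v z)"
    unfolding z(3) using x z(1)
    by (intro scalar_prod_self_add_le[of _ "N + q"] mult_mat_vec_carrier[OF B_mat_carrier] mult_mat_vec_carrier[OF C_mat_carrier])
  ultimately show ?thesis using matrix_upper_bounds(1)[OF x] by (simp add: algebra_simps)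
qed

end

theorem theorem4p4:
  fixes T :: real and p :: nat
  assumes "T > 0" and "p \<ge> 1"
    and uniqueness:
      "\<And>(N::nat) (\<mu>::real) (f::real \<Rightarrow> complex) (\<psi>0::complex).
         N \<ge> 1 \<Longrightarrow> f \<in> L2_space T \<Longrightarrow>
         \<exists>\<psi>. discrete_ode_solution T N p \<mu> f \<psi>0 \<psi> \<and>
             (\<forall>\<psi>'. discrete_ode_solution T N p \<mu> f \<psi>0 \<psi>' \<longrightarrow> (\<forall>t\<in>{0..T}. \<psi>' t = \<psi> t))"
  shows "\<forall>\<mu>w>0.
     (\<forall>N\<ge>1. schur_complement (N + p - 1) (system_matrix T N p \<mu>w) =
        B_mat T N p + \<mu>w \<cdot>\<^sub>m (C_mat T N p * mat_inv (B_mat T N p) * C_mat T N p)) \<and>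
     weakly_well_conditioned (\<lambda>N.
        B_mat T N p + \<mu>w \<cdot>\<^sub>m (C_mat T N p * mat_inv (B_mat T N p) * C_mat T N p))"
proof (intro allI impI)
  fix \<mu> :: real assume \<mu>: "\<mu> > 0"
  obtain q where p: "p = Suc q" using assms(2) by (cases p) auto
  define \<alpha> where "\<alpha> = sqrt \<mu>"
  have \<alpha>: "\<alpha>\<^sup>2 = \<mu>" using \<mu> by (simp add: \<alpha>_def)
  obtain c s where c: "c \<ge> 0" "\<And>N (a::nat \<Rightarrow> real) M j. N \<ge> 1 \<Longrightarrow>
     (\<forall>t\<in>{0..<T}. \<bar>time_grid.spline T N (Suc q) a t\<bar> \<le> M) \<Longrightarrow> j < N + Suc q \<Longrightarrow> \<bar>a j\<bar> \<le> c * real N ^ s * M"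
    using spline_coeff_bound[OF assms(1), of "Suc q"] by metis
  have grid: "stable_time_grid T N q (c * real N ^ s)" if "N \<ge> 1" for N
    using that assms(1) c by unfold_locales auto
  have unique: "\<psi> t = \<psi>' t"
    if "N \<ge> 1" "discrete_ode_solution T N (Suc q) (- \<alpha>) (\<lambda>_. 0) 0 \<psi>"
      "discrete_ode_solution T N (Suc q) (- \<alpha>) (\<lambda>_. 0) 0 \<psi>'" "t \<in> {0..T}" for N \<psi> \<psi>' t
  proof -
    have "(\<lambda>_. 0 :: complex) \<in> L2_space T" by (simp add: L2_space_def)
    then show ?thesis using uniqueness[OF that(1), of "\<lambda>_. 0" "- \<alpha>" 0] that(2-4) unfolding p by metis
  qed
  define S where "S N = B_mat T N p + \<mu> \<cdot>\<^sub>m (C_mat T N p * mat_inv (B_mat T N p) * C_mat T N p)" for N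
  have S: "S N = stable_time_grid.schur T N q \<mu>" if "N \<ge> 1" for N
    unfolding S_def p stable_time_grid.schur_def[OF grid[OF that]] ..
  have S_carrier: "S N \<in> carrier_mat (N + q) (N + q)" if "N \<ge> 1" for N
    unfolding S[OF that] by (rule stable_time_grid.schur_carrier[OF grid[OF that]])
  \<comment> \<open>The uniqueness assumption enters here, with zero data and \<mu> replaced by
    -\<alpha>.\<close>
  have S_inj: "x = 0\<^sub>v (N + q)" if N: "N \<ge> 1" and x: "x \<in> carrier_vec (N + q)" "S N *\<^sub>v x = 0\<^sub>v (N + q)" for N x
  proof -
    interpret stable_time_grid T N q "c * real N ^ s" by (rule grid[OF N])
    note z = schur_mult_vec[OF x(1)]
    show ?thesis
      by (rule schur_injective[OF x(1) z(1,2) x(2)[unfolded S[OF N] z(3), symmetric] \<alpha>]) (rule unique[OF N])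
  qed
  define L where "L = 2 + 8 * \<mu> * T\<^sup>2"
  \<comment> \<open>\<open>e\<close> and \<open>st\<close> are \<open>entry_bound\<close> and
    \<open>stab\<close> with \<open>1 / mesh\<close> written as \<open>N / T\<close>, which shows
    them to be polynomials in \<open>N\<close>.\<close>
  define e where "e N = (real N + real q) * (T * ((real (Suc q) / T) * real N * (1 + (real (Suc q) / T) * real N)))" for N
  define st where "st N = (real N + real q) * ((c * real N ^ s)\<^sup>2 * T)" for N
  define Q where "Q N = 2 * (e N)\<^sup>2 + 2 * \<mu>\<^sup>2 * ((e N)\<^sup>2 * ((st N)\<^sup>2 * (e N)\<^sup>2))" for N
  define P where "P N = 8 * L * (st N)\<^sup>2" for N
  \<comment> \<open>From this index on the mesh satisfies the smallness condition of the energy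
    estimate; the added 1 ensures \<open>N \<ge> 1\<close>.\<close>
  define N0 where "N0 = nat \<lceil>12 * L * \<mu> * (T * (real (Suc q) * T))\<rceil> + 1"
  have growth: "poly_growth (\<lambda>N. 1 + Q N * P N)"
    unfolding Q_def P_def e_def st_def
    by (intro poly_growth_add poly_growth_mult poly_growth_power poly_growth_const poly_growth_of_nat)
  have bound: "\<bar>condition_number (S N)\<bar> \<le> 1 + Q N * P N" if N0: "N \<ge> N0" for N
  proof -
    have N: "N \<ge> 1" using N0 by (simp add: N0_def)
    interpret stable_time_grid T N q "c * real N ^ s" by (rule grid[OF N])
    have eN: "entry_bound = e N" and stN: "stab = st N"
      by (simp_all add: entry_bound_def stab_def e_def st_def mesh_def)
    have L: "L \<ge> 0" using \<mu> by (simp add: L_def)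
    have "12 * L * \<mu> * (T * (real (Suc q) * T)) \<le> real N" using N0 unfolding N0_def by linarith
    then have "12 * L * \<mu> * (T * (real (Suc q) * T)) / real N \<le> 1" using N by simp
    then have small: "12 * L * \<mu> * (T * (real (Suc q) * mesh)) \<le> 1" by (simp add: mesh_def mult_ac)
    have "scalar_prod (S N *\<^sub>v v) (S N *\<^sub>v v) \<le> Q N * scalar_prod v v" if "v \<in> carrier_vec (N + q)" for v
      using schur_upper_bound[OF that, of \<mu>] unfolding S[OF N] eN stN Q_def .
    moreover have "scalar_prod v v \<le> P N * scalar_prod (S N *\<^sub>v v) (S N *\<^sub>v v)" if v: "v \<in> carrier_vec (N + q)" for v
      using schur_lower_bound[OF v schur_mult_vec(1,2)[OF v] schur_mult_vec(3)[OF v] \<alpha>] small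
      unfolding S[OF N] stN P_def L_def by simp
    moreover have "Q N \<ge> 0" "P N \<ge> 0" using L by (simp_all add: Q_def P_def)
    ultimately show ?thesis using condition_number_bounds[OF S_carrier[OF N] S_inj[OF N]] by simp
  qed
  obtain D r where D: "\<And>N. N \<ge> 1 \<Longrightarrow> \<bar>condition_number (S N)\<bar> \<le> D * real N ^ r"
    using poly_growth_eventually[OF growth bound] unfolding poly_growth_def by metis
  have D0: "D \<ge> 0" using D[of 1] by auto
  have "condition_number (S N) \<le> D * real (dim_row (S N)) powr real r" if N: "N \<ge> 1" for N
  proof -
    have "condition_number (S N) \<le> D * real N ^ r" using D[OF N] by simp
    \<comment> \<open>The growth is measured in the matrix size \<open>N + q\<close>, which is at
      least \<open>N\<close>.\<close>
    also have "\<dots> \<le> D * real (N + q) ^ r" using D0 by (intro mult_left_mono power_mono) auto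
    also have "real (N + q) ^ r = real (dim_row (S N)) powr real r"
      using S_carrier[OF N] N by (simp add: powr_realpow)
    finally show ?thesis .
  qed
  moreover have "invertible_mat (S N)" if "N \<ge> 1" for N
    by (rule injective_imp_mat_inverse(1)[OF S_carrier[OF that] S_inj[OF that]])
  ultimately have "weakly_well_conditioned S"
    unfolding weakly_well_conditioned_def using D0 by (metis of_nat_0_le_iff)
  moreover have "schur_complement (N + p - 1) (system_matrix T N p \<mu>) = S N" if "N \<ge> 1" for N
    unfolding S_def using stable_time_grid.B_inverse(1)[OF grid[OF that]]
    by (intro schur_complement_system_matrix) (simp add: p)
  ultimately show "(\<forall>N\<ge>1. schur_complement (N + p - 1) (system_matrix T N p \<mu>) =
        B_mat T N p + \<mu> \<cdot>\<^sub>m (C_mat T N p * mat_inv (B_mat T N p) * C_mat T N p)) \<and>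
     weakly_well_conditioned (\<lambda>N.
        B_mat T N p + \<mu> \<cdot>\<^sub>m (C_mat T N p * mat_inv (B_mat T N p) * C_mat T N p))"
    unfolding S_def by blast
qed

end
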